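(* Let $G$ be adjoint of type $\mathbf{C}_n$, $n\ge6$. (1) Any section $\mathcal S$ given by $\mathcal S(s_i)=t_i\sigma_i$ with $$a_{1,1}a_{1,2}^2=a_{2,2}a_{2,3}^2=\cdots=a_{n-2,n-2}a_{n-2,n-1}^2=a_{n-1,n-1}a_{n-1,n-2}^2=-1$$ is an optimal section, whereas the Tits section $\mathcal N_\circ$ is not. Moreover, $\mathcal S(s_i)^2=1$ for all $i=1,\dots,n-1$, and $\mathcal S(s_n)^2\ne1$. Also $\mathcal N_\circ(s_i)^2\ne1$ for all $i=1,\dots,n$. There are only two order profiles of sections. (2) Two sections are $T$-conjugate if and only if they have the same value of $a_{1,1}a_{1,2}^2$. In particular, two sections are $T$-conjugate if and only if they have the same order profile.
   Context: $F$ is an algebraically closed field, $G$ an almost-simple connected reductive group over $F$, $T$ a maximal torus, $N=N_G(T)$, $W=N/T$, $\pi:N\to W$ the projection. Let $\alpha_1,\dots,\alpha_n$ be the simple roots in Bourbaki numbering ($\alpha_i=e_i-e_{i+1}$ for $i<n$, $\alpha_n=2e_n$), $s_i$ the corresponding reflections, $\alpha_i^\vee$ the simple coroots, $\omega_i$ the fundamental coweights. Fix a realization of the root system: isomorphisms $u_\alpha:\mathbf G_a\to U_\alpha$ onto the root subgroups with $tu_\alpha(x)t^{-1}=u_\alpha(\alpha(t)x)$, such that $\sigma_\alpha=u_\alpha(1)u_{-\alpha}(-1)u_\alpha(1)\in N$ maps to $s_\alpha$ and $u_\alpha(x)u_{-\alpha}(-x^{-1})u_\alpha(x)=\alpha^\vee(x)\sigma_\alpha$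 for $x\in F^\times$; put $\sigma_i=\sigma_{\alpha_i}$. A section is a map $\mathcal S:W\to N$ with $\pi\circ\mathcal S=\mathrm{id}$ satisfying the braid relations (equivalently $\mathcal S$ is multiplicative along reduced expressions). It is determined by $\mathcal S(s_i)=t_i\sigma_i$, $t_i\in T$. The Tits section $\mathcal N_\circ$ is the one with all $t_i=1$. The order profile of $\mathcal S$ is the Dynkin diagram with the node of each $\alpha_i$ labeled by the order of $\mathcal S(s_i)$. For two sections write $\mathcal S'<\mathcal S$ if the order of $\mathcal S'(s_i)$ is greater than the order of $\mathcal S(s_i)$ for all $i$; this translates to a partial order on order profiles, and a section is called optimal if it has the unique maximal order profile with respect to this partial order. Two sections $\mathcal S,\mathcal S'$ are $T$-conjugate if there is $t\in T$ with $t\mathcal S(w)t^{-1}=\mathcal S'(w)$ for all $w\in W$. Coordinates: $(x_1,\dots,x_n)$ denotes $\omega_1(x_1)\cdots\omega_n(x_n)\in T$. The sections are exactly those given by $t_i$ of the following form, with all $a_{i,j}\in F^\times$: $t_1=(a_{1,1},a_{1,2},1,\dots,1)$; for $2\le i\le n-2$, $t_i$ has coordinates $a_{i,i}^{-1}a_{i,i+1}^{-1},a_{i,i},a_{i,i+1}$ in positions $i-1,i,i+1$ and $1$ elsewhere; $t_{n-1}=(1,\dots,1,a_{n-1,n-2},a_{n-1,n-1},a_{n-1,n-2}^{-2}a_{n-1,n-1}^{-2})$; $t_n=(1,\dots,1,a_{n,n-1},a_{n,n-1}^{-2})$; subject to $a_{1,1}a_{1,2}^2=a_{2,2}a_{2,3}^2=\cdots=a_{n-2,n-2}a_{n-2,n-1}^2=a_{n-1,n-1}a_{n-1,n-2}^2$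 and $(a_{n-1,n-1}a_{n-1,n-2}^2)^2=1$.
   Formalization: F has characteristic not 2 (in characteristic 2 the Tits section has all squares 1, so part (1) fails); S' < S means orders at least as large at every node and larger at some node, since with strict inequality at all nodes the two profiles (equal at node n) are incomparable. *)

theory Defs
  imports
    "Jordan_Normal_Form.Matrix"
    "HOL-Computational_Algebra.Polynomial"
    "HOL-Algebra.Algebra"
begin

section \<open>The root system of type C\<close>

text \<open>
  The vector \<open>c 1 e_1 + ... + c n e_n\<close> of \<open>\<int>^n\<close> is represented by its coefficient function
  \<open>c :: nat \<Rightarrow> int\<close>, with value \<open>0\<close> outside \<open>{1..n}\<close>.
\<close>

definition eps :: "nat \<Rightarrow> nat \<Rightarrow> int" where
  "eps i = (\<lambda>k. if k = i then 1 else 0)"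

definition roots_C :: "nat \<Rightarrow> (nat \<Rightarrow> int) set" where
  "roots_C n =
     {(\<lambda>k. a * eps i k + b * eps j k) | a b i j.
        a \<in> {1, -1} \<and> b \<in> {1, -1} \<and> i \<in> {1..n} \<and> j \<in> {1..n} \<and> i < j}
   \<union> {(\<lambda>k. a * 2 * eps i k) | a i. a \<in> {1, -1} \<and> i \<in> {1..n}}"

definition simple_root :: "nat \<Rightarrow> nat \<Rightarrow> (nat \<Rightarrow> int)" where
  "simple_root n i =
     (if i = n then (\<lambda>k. 2 * eps n k) else (\<lambda>k. eps i k - eps (Suc i) k))"

definition neg_root :: "(nat \<Rightarrow> int) \<Rightarrow> (nat \<Rightarrow> int)" where
  "neg_root \<alpha> = (\<lambda>k. - \<alpha> k)"

definition inner_Z :: "nat \<Rightarrow> (nat \<Rightarrow> int) \<Rightarrow> (nat \<Rightarrow> int) \<Rightarrow> int" where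
  "inner_Z n \<alpha> \<beta> = (\<Sum>k = 1..n. \<alpha> k * \<beta> k)"

text \<open>The integer \<open>\<langle>\<beta>, \<alpha>\<^sup>\<or>\<rangle> = 2 (\<beta>, \<alpha>) / (\<alpha>, \<alpha>)\<close>; the division is exact for roots.\<close>

definition cartan_int :: "nat \<Rightarrow> (nat \<Rightarrow> int) \<Rightarrow> (nat \<Rightarrow> int) \<Rightarrow> int" where
  "cartan_int n \<beta> \<alpha> = 2 * inner_Z n \<beta> \<alpha> div inner_Z n \<alpha> \<alpha>"


section \<open>The projective symplectic similitude group\<close>

text \<open>
  Rows and columns are numbered \<open>0, ..., 2 n - 1\<close>, and the basis vector number \<open>k\<close> is paired
  with number \<open>n + k\<close> by the alternating form.
\<close>

definition symp_form :: "nat \<Rightarrow> 'a::field mat" where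
  "symp_form n = mat (2 * n) (2 * n)
     (\<lambda>(i, j). if j = i + n then 1 else if i = j + n then - 1 else 0)"

definition GSp :: "nat \<Rightarrow> 'a::field mat monoid" where
  "GSp n =
     \<lparr>carrier = {A \<in> carrier_mat (2 * n) (2 * n).
        \<exists>\<mu>. \<mu> \<noteq> 0 \<and> transpose_mat A * symp_form n * A = \<mu> \<cdot>\<^sub>m symp_form n},
      mult = (*), one = 1\<^sub>m (2 * n)\<rparr>"

definition scalar_mats :: "nat \<Rightarrow> 'a::field mat set" where
  "scalar_mats n = {c \<cdot>\<^sub>m 1\<^sub>m (2 * n) | c. c \<noteq> 0}"

definition PGSp :: "nat \<Rightarrow> 'a::field mat set monoid" where
  "PGSp n = GSp n Mod scalar_mats n"

definition GSp_diag :: "nat \<Rightarrow> 'a::field mat set" where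
  "GSp_diag n = {A \<in> carrier (GSp n). diagonal_mat A}"

definition PGSp_class :: "nat \<Rightarrow> 'a::field mat \<Rightarrow> 'a mat set" where
  "PGSp_class n A = scalar_mats n #>\<^bsub>GSp n\<^esub> A"

text \<open>
  A diagonal similitude with entries \<open>d_1, ..., d_2n\<close> and multiplier \<open>\<mu> = d_k d_(n+k)\<close> has the same
  image in the projective group as its multiple by \<open>\<mu>^(-1/2)\<close>, which is symplectic.  The value of
  \<open>\<lambda> = c_1 e_1 + ... + c_n e_n\<close> there is \<open>d_1^c_1 ... d_n^c_n \<mu>^(- (c_1 + ... + c_n) / 2)\<close>, and the
  sum \<open>c_1 + ... + c_n\<close> is even for every root.
\<close>

definition diag_char :: "nat \<Rightarrow> (nat \<Rightarrow> int) \<Rightarrow> 'a::field mat \<Rightarrow> 'a" where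
  "diag_char n \<alpha> A =
     (\<Prod>k = 1..n. A $$ (k - 1, k - 1) powi \<alpha> k)
     * (A $$ (0, 0) * A $$ (n, n)) powi (- ((\<Sum>k = 1..n. \<alpha> k) div 2))"

text \<open>
  The root subgroup of \<open>\<alpha>\<close> consists of the classes of \<open>1 + Y\<close> with \<open>Y\<close> in the \<open>\<alpha>\<close>-root space of the
  Lie algebra: in the standard representation all these \<open>Y\<close> satisfy \<open>Y * Y = 0\<close>, so that
  \<open>exp Y = 1 + Y\<close>.
\<close>

definition PGSp_root_subgroup :: "nat \<Rightarrow> (nat \<Rightarrow> int) \<Rightarrow> 'a::field mat set set" where
  "PGSp_root_subgroup n \<alpha> =
     {PGSp_class n (1\<^sub>m (2 * n) + Y) | Y.
        Y \<in> carrier_mat (2 * n) (2 * n) \<and> 1\<^sub>m (2 * n) + Y \<in> carrier (GSp n) \<and>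
        (\<forall>A \<in> GSp_diag n. A * Y = diag_char n \<alpha> A \<cdot>\<^sub>m (Y * A))}"


section \<open>Adjoint groups of type C with a maximal torus and a realization\<close>

text \<open>
  A group of points over the field \<open>'a\<close> together with a maximal torus, the roots as characters of
  this torus, the root subgroups, and candidates \<open>root_hom \<alpha>\<close> for the parametrizations \<open>u_\<alpha>\<close>.
\<close>

record ('g, 'a) rooted_group = "'g monoid" +
  torus :: "'g set"
  root_char :: "(nat \<Rightarrow> int) \<Rightarrow> 'g \<Rightarrow> 'a"
  root_subgroup :: "(nat \<Rightarrow> int) \<Rightarrow> 'g set"
  root_hom :: "(nat \<Rightarrow> int) \<Rightarrow> 'a \<Rightarrow> 'g"

text \<open>
  Over an algebraically closed field the adjoint group of type \<open>C_n\<close> is, up to isomorphism, the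
  group of projective symplectic similitudes, and all its maximal tori are conjugate.  The group
  and the torus are only required to be isomorphic to the standard ones; composing the
  isomorphism with inner automorphisms shows that every maximal torus and every choice of simple
  roots is covered.
\<close>

definition adjoint_type_C :: "nat \<Rightarrow> ('g, 'a::field) rooted_group \<Rightarrow> bool" where
  "adjoint_type_C n G \<longleftrightarrow>
     group G \<and>
     (\<exists>\<phi> \<in> iso G (PGSp n).
        torus G = {g \<in> carrier G. \<phi> g \<in> PGSp_class n ` GSp_diag n} \<and>
        (\<forall>\<alpha> \<in> roots_C n.
           root_subgroup G \<alpha> = {g \<in> carrier G. \<phi> g \<in> PGSp_root_subgroup n \<alpha>} \<and>
           (\<forall>t \<in> torus G. \<forall>A \<in> \<phi> t. root_char G \<alpha> t = diag_char n \<alpha> A)))"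

text \<open>
  Since the group is adjoint, an element of the torus is determined by its values under the
  simple roots, which may be prescribed arbitrarily.  Hence the coroots and the fundamental
  coweights (the basis dual to the simple roots) are described by their pairings with roots.
\<close>

definition coroot :: "nat \<Rightarrow> ('g, 'a::field) rooted_group \<Rightarrow> (nat \<Rightarrow> int) \<Rightarrow> 'a \<Rightarrow> 'g" where
  "coroot n G \<alpha> x =
     (THE t. t \<in> torus G \<and> (\<forall>\<beta> \<in> roots_C n. root_char G \<beta> t = x powi cartan_int n \<beta> \<alpha>))"

definition coweight :: "nat \<Rightarrow> ('g, 'a::field) rooted_group \<Rightarrow> nat \<Rightarrow> 'a \<Rightarrow> 'g" where
  "coweight n G i x =
     (THE t. t \<in> torus G \<and>
        (\<forall>j \<in> {1..n}. root_char G (simple_root n j) t = (if j = i then x else 1)))"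

definition word_prod :: "('m, 'more) monoid_scheme \<Rightarrow> 'm list \<Rightarrow> 'm" where
  "word_prod M xs = foldr (mult M) xs (one M)"

definition torus_point :: "nat \<Rightarrow> ('g, 'a::field) rooted_group \<Rightarrow> (nat \<Rightarrow> 'a) \<Rightarrow> 'g" where
  "torus_point n G x = word_prod G (map (\<lambda>j. coweight n G j (x j)) [1..<Suc n])"

definition torus_normalizer :: "('g, 'a) rooted_group \<Rightarrow> 'g set" where
  "torus_normalizer G = normalizer G (torus G)"

definition weyl_group :: "('g, 'a) rooted_group \<Rightarrow> 'g set monoid" where
  "weyl_group G = (G\<lparr>carrier := torus_normalizer G\<rparr>) Mod torus G"

definition weyl_proj :: "('g, 'a) rooted_group \<Rightarrow> 'g \<Rightarrow> 'g set" where
  "weyl_proj G m = torus G #>\<^bsub>G\<^esub> m"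

text \<open>
  The reflection \<open>s_\<alpha>\<close> acts on the torus by \<open>t \<mapsto> t \<alpha>\<^sup>\<or>(\<alpha>(t))\<^sup>-\<^sup>1\<close>.  As the torus is its own centralizer,
  the elements of the normalizer acting in this way form one coset of the torus.
\<close>

definition reflection :: "nat \<Rightarrow> ('g, 'a::field) rooted_group \<Rightarrow> (nat \<Rightarrow> int) \<Rightarrow> 'g set" where
  "reflection n G \<alpha> =
     {m \<in> torus_normalizer G. \<forall>t \<in> torus G.
        m \<otimes>\<^bsub>G\<^esub> t \<otimes>\<^bsub>G\<^esub> inv\<^bsub>G\<^esub> m = t \<otimes>\<^bsub>G\<^esub> inv\<^bsub>G\<^esub> (coroot n G \<alpha> (root_char G \<alpha> t))}"

definition simple_refl :: "nat \<Rightarrow> ('g, 'a::field) rooted_group \<Rightarrow> nat \<Rightarrow> 'g set" where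
  "simple_refl n G i = reflection n G (simple_root n i)"

definition sigma :: "('g, 'a::field) rooted_group \<Rightarrow> (nat \<Rightarrow> int) \<Rightarrow> 'g" where
  "sigma G \<alpha> =
     root_hom G \<alpha> 1 \<otimes>\<^bsub>G\<^esub> root_hom G (neg_root \<alpha>) (- 1) \<otimes>\<^bsub>G\<^esub> root_hom G \<alpha> 1"

text \<open>
  Additive bijections \<open>u_\<alpha>\<close> onto the root subgroups on which the torus acts through \<open>\<alpha>\<close> are
  automatically isomorphisms of algebraic groups: \<open>\<alpha>\<close> is surjective onto the nonzero scalars, so
  \<open>u_\<alpha>\<close> differs from a standard parametrization by a rescaling of the argument.
\<close>

definition realization :: "nat \<Rightarrow> ('g, 'a::field) rooted_group \<Rightarrow> bool" where
  "realization n G \<longleftrightarrow>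
     (\<forall>\<alpha> \<in> roots_C n.
        bij_betw (root_hom G \<alpha>) UNIV (root_subgroup G \<alpha>) \<and>
        (\<forall>x y. root_hom G \<alpha> (x + y) = root_hom G \<alpha> x \<otimes>\<^bsub>G\<^esub> root_hom G \<alpha> y) \<and>
        (\<forall>t \<in> torus G. \<forall>x.
           t \<otimes>\<^bsub>G\<^esub> root_hom G \<alpha> x \<otimes>\<^bsub>G\<^esub> inv\<^bsub>G\<^esub> t = root_hom G \<alpha> (root_char G \<alpha> t * x)) \<and>
        sigma G \<alpha> \<in> torus_normalizer G \<and>
        weyl_proj G (sigma G \<alpha>) = reflection n G \<alpha> \<and>
        (\<forall>x. x \<noteq> 0 \<longrightarrow>
           root_hom G \<alpha> x \<otimes>\<^bsub>G\<^esub> root_hom G (neg_root \<alpha>) (- inverse x) \<otimes>\<^bsub>G\<^esub> root_hom G \<alpha> x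
             = coroot n G \<alpha> x \<otimes>\<^bsub>G\<^esub> sigma G \<alpha>))"


section \<open>Sections of the Weyl group\<close>

definition simple_word :: "nat \<Rightarrow> ('g, 'a::field) rooted_group \<Rightarrow> nat list \<Rightarrow> 'g set" where
  "simple_word n G is = word_prod (weyl_group G) (map (simple_refl n G) is)"

definition reduced_word :: "nat \<Rightarrow> ('g, 'a::field) rooted_group \<Rightarrow> nat list \<Rightarrow> bool" where
  "reduced_word n G is \<longleftrightarrow>
     set is \<subseteq> {1..n} \<and>
     (\<forall>js. set js \<subseteq> {1..n} \<and> simple_word n G js = simple_word n G is
        \<longrightarrow> length is \<le> length js)"

text \<open>
  The braid relations between the \<open>S s_i\<close> alone leave the values of \<open>S\<close> at other elements free;
  what determines \<open>S\<close> by the \<open>S s_i\<close> is multiplicativity along all reduced expressions, which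
  contains these braid relations as the two reduced expressions of the longest elements of the
  dihedral subgroups.
\<close>

definition is_section :: "nat \<Rightarrow> ('g, 'a::field) rooted_group \<Rightarrow> ('g set \<Rightarrow> 'g) \<Rightarrow> bool" where
  "is_section n G S \<longleftrightarrow>
     S \<in> carrier (weyl_group G) \<rightarrow>\<^sub>E torus_normalizer G \<and>
     (\<forall>w \<in> carrier (weyl_group G). weyl_proj G (S w) = w) \<and>
     (\<forall>is. reduced_word n G is \<longrightarrow>
        S (simple_word n G is) = word_prod G (map (\<lambda>i. S (simple_refl n G i)) is))"

definition tits_section :: "nat \<Rightarrow> ('g, 'a::field) rooted_group \<Rightarrow> ('g set \<Rightarrow> 'g)" where
  "tits_section n G =
     (THE S. is_section n G S \<and>
        (\<forall>i \<in> {1..n}. S (simple_refl n G i) = sigma G (simple_root n i)))"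

definition T_conjugate ::
  "('g, 'a::field) rooted_group \<Rightarrow> ('g set \<Rightarrow> 'g) \<Rightarrow> ('g set \<Rightarrow> 'g) \<Rightarrow> bool" where
  "T_conjugate G S S' \<longleftrightarrow>
     (\<exists>t \<in> torus G. \<forall>w \<in> carrier (weyl_group G). t \<otimes>\<^bsub>G\<^esub> S w \<otimes>\<^bsub>G\<^esub> inv\<^bsub>G\<^esub> t = S' w)"


section \<open>Order profiles\<close>

text \<open>A labelling of the Dynkin diagram is a function on its set of nodes \<open>{1..n}\<close>.\<close>

definition order_profile ::
  "nat \<Rightarrow> ('g, 'a::field) rooted_group \<Rightarrow> ('g set \<Rightarrow> 'g) \<Rightarrow> (nat \<Rightarrow> nat)" where
  "order_profile n G S = (\<lambda>i \<in> {1..n}. group.ord G (S (simple_refl n G i)))"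

definition order_profiles :: "nat \<Rightarrow> ('g, 'a::field) rooted_group \<Rightarrow> (nat \<Rightarrow> nat) set" where
  "order_profiles n G = {order_profile n G S | S. is_section n G S}"

text \<open>
  Larger orders give smaller profiles.  The comparison is weak at each node and strict as a whole:
  two different profiles may agree at some nodes, and with a strict comparison at every node such
  profiles would never be comparable.
\<close>

definition profile_less :: "nat \<Rightarrow> (nat \<Rightarrow> nat) \<Rightarrow> (nat \<Rightarrow> nat) \<Rightarrow> bool" where
  "profile_less n P Q \<longleftrightarrow> (\<forall>i \<in> {1..n}. P i \<ge> Q i) \<and> (\<exists>i \<in> {1..n}. P i > Q i)"

definition maximal_profile :: "nat \<Rightarrow> ('g, 'a::field) rooted_group \<Rightarrow> (nat \<Rightarrow> nat) \<Rightarrow> bool" where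
  "maximal_profile n G P \<longleftrightarrow>
     P \<in> order_profiles n G \<and> \<not> (\<exists>Q \<in> order_profiles n G. profile_less n P Q)"

definition optimal_section :: "nat \<Rightarrow> ('g, 'a::field) rooted_group \<Rightarrow> ('g set \<Rightarrow> 'g) \<Rightarrow> bool" where
  "optimal_section n G S \<longleftrightarrow>
     is_section n G S \<and> maximal_profile n G (order_profile n G S) \<and>
     (\<forall>P. maximal_profile n G P \<longrightarrow> P = order_profile n G S)"


section \<open>Coordinates of sections\<close>

text \<open>The coordinate number \<open>j\<close> of the torus element \<open>t_i\<close> attached to parameters \<open>a\<close>.\<close>

definition t_coord :: "nat \<Rightarrow> (nat \<Rightarrow> nat \<Rightarrow> 'a::field) \<Rightarrow> nat \<Rightarrow> nat \<Rightarrow> 'a" where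
  "t_coord n a i j =
     (if i = 1 then
        (if j = 1 then a 1 1 else if j = 2 then a 1 2 else 1)
      else if i \<le> n - 2 then
        (if j = i - 1 then inverse (a i i) * inverse (a i (i + 1))
         else if j = i then a i i
         else if j = i + 1 then a i (i + 1) else 1)
      else if i = n - 1 then
        (if j = n - 2 then a (n - 1) (n - 2)
         else if j = n - 1 then a (n - 1) (n - 1)
         else if j = n then inverse ((a (n - 1) (n - 2))\<^sup>2) * inverse ((a (n - 1) (n - 1))\<^sup>2)
         else 1)
      else
        (if j = n - 1 then a n (n - 1)
         else if j = n then inverse ((a n (n - 1))\<^sup>2) else 1))"

text \<open>The members, for \<open>i = 1, ..., n - 1\<close>, of the chain of quantities required to be equal.\<close>

definition chain_val :: "nat \<Rightarrow> (nat \<Rightarrow> nat \<Rightarrow> 'a::field) \<Rightarrow> nat \<Rightarrow> 'a" where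
  "chain_val n a i =
     (if i = n - 1 then a (n - 1) (n - 1) * (a (n - 1) (n - 2))\<^sup>2
      else a i i * (a i (i + 1))\<^sup>2)"

definition section_params :: "nat \<Rightarrow> (nat \<Rightarrow> nat \<Rightarrow> 'a::field) \<Rightarrow> bool" where
  "section_params n a \<longleftrightarrow>
     (\<forall>i \<in> {1..n - 2}. a i i \<noteq> 0 \<and> a i (i + 1) \<noteq> 0) \<and>
     a (n - 1) (n - 2) \<noteq> 0 \<and> a (n - 1) (n - 1) \<noteq> 0 \<and> a n (n - 1) \<noteq> 0 \<and>
     (\<forall>i \<in> {1..n - 1}. chain_val n a i = chain_val n a 1) \<and>
     (chain_val n a (n - 1))\<^sup>2 = 1"

definition section_given_by ::
  "nat \<Rightarrow> ('g, 'a::field) rooted_group \<Rightarrow> (nat \<Rightarrow> nat \<Rightarrow> 'a) \<Rightarrow> ('g set \<Rightarrow> 'g) \<Rightarrow> bool" where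
  "section_given_by n G a S \<longleftrightarrow>
     is_section n G S \<and> section_params n a \<and>
     (\<forall>i \<in> {1..n}.
        S (simple_refl n G i) = torus_point n G (t_coord n a i) \<otimes>\<^bsub>G\<^esub> sigma G (simple_root n i))"

end

theory Submission
  imports Defs
begin

text \<open>
  The normalizer \<open>N\<close> of the torus consists of the classes of monomial similitudes.  In a basis
  ordered as \<open>e_1, ..., e_n, f_n, ..., f_1\<close>, with positions \<open>0, ..., 2 n - 1\<close>, the Weyl group is the
  group of permutations of the positions that commute with \<open>p \<mapsto> 2 n - 1 - p\<close>, the reflection \<open>s_i\<close>
  exchanges \<open>i - 1\<close> and \<open>i\<close> and, symmetrically, their mirror images, and \<open>w(\<alpha>_i)\<close> is positive if
  and only if \<open>w (i - 1) < w i\<close>.  The last statement holds for long and short simple roots alike,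
  so that one exchange argument (\<open>word_exchange\<close>) shows that a word is reduced exactly when each
  of its letters is an ascent.

  Existence of sections.  By this description of reduced words, a family of coefficients \<open>c(w, p)\<close>
  with \<open>c(w s_i, p) = c(w, s_i p) c(s_i, p)\<close> at all ascents defines a section (\<open>section_exists\<close>).
  There are two explicit families.  One counts inversions of the permutation of the \<open>2 n\<close> positions
  and gives the Tits section; in the other one the lifts of \<open>s_1, ..., s_(n - 1)\<close> generate a
  symmetric group of permutation matrices.

  Classification.  Write \<open>S(s_i) = t_i \<sigma>_i\<close>.  As the Tits section satisfies the braid relations, the
  braid relations of \<open>S\<close> turn into equations in \<open>T\<close> between the \<open>t_i\<close> and their images under
  reflections.  Elements of \<open>T\<close> are determined by the values of the simple roots, and in these
  coordinates the equations are solved in \<open>braid_values_params\<close>: the \<open>t_i\<close> have the asserted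
  shape, and the chain has a common value \<open>e\<close> with \<open>e\<^sup>2 = 1\<close>.  Conjugation by \<open>t \<in> T\<close> changes \<open>t_i\<close> only
  by \<open>\<alpha>_i\<^sup>\<or>(\<alpha>_i(t))\<close>.  This keeps \<open>e\<close>, and for two sections with the same \<open>e\<close> the required values
  \<open>\<alpha>_i(t)\<close> can be read off from one coordinate of each \<open>t_i\<close> and prescribed freely, because the group is
  adjoint (\<open>t_coord_rescale\<close>).  So there is one conjugacy class of sections for \<open>e = 1\<close> and one for
  \<open>e = -1\<close>.

  Orders are invariant under conjugation and are therefore computed on the two explicit sections.
  In the Tits section every \<open>S(s_i)\<close> has order \<open>4\<close>.  In the other section the lifts of
  \<open>s_1, ..., s_(n - 1)\<close> are involutions and the lift of \<open>s_n\<close> has order \<open>4\<close>; this section is hence not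
  conjugate to the Tits section and belongs to \<open>e = -1\<close>.

  What remains is to identify the \<open>\<sigma>_i\<close> of an arbitrary realization.  The root subgroups are found
  from the action of a sufficiently generic one-parameter family in the torus, and
  \<open>u(1) u'(-1) u(1)\<close> is monomial only if the parameters of \<open>u(1)\<close> and \<open>u'(-1)\<close> are negative
  inverses (\<open>sigma_product\<close>).  The one scalar left for each \<open>i\<close> is absorbed into a rescaling of the
  basis, after which \<open>\<sigma>_i\<close> has the signs of the Tits lift.
\<close>

section \<open>Signed permutations\<close>

text \<open>
  Position \<open>p < n\<close> stands for the basis vector \<open>e_(p + 1)\<close> and its mirror image \<open>2 n - 1 - p\<close> for the
  vector \<open>f_(p + 1)\<close> paired with it.  Mirror images are written as pairs with \<open>Suc (p + q) = 2 * n\<close>,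
  which avoids truncated subtraction.
\<close>
definition signed_perm :: "nat \<Rightarrow> (nat \<Rightarrow> nat) \<Rightarrow> bool" where
  "signed_perm n w \<longleftrightarrow>
     w permutes {..<2 * n} \<and> (\<forall>p q. Suc (p + q) = 2 * n \<longrightarrow> Suc (w p + w q) = 2 * n)"

definition srefl :: "nat \<Rightarrow> nat \<Rightarrow> nat \<Rightarrow> nat" where
  "srefl n i p =
     (if Suc p = i then i else if p = i then i - 1
      else if Suc (p + i) = 2 * n then Suc p
      else if p + i = 2 * n then p - 1 else p)"

definition word_perm :: "nat \<Rightarrow> nat list \<Rightarrow> nat \<Rightarrow> nat" where
  "word_perm n is = foldr (\<lambda>i w. srefl n i \<circ> w) is id"

lemma word_perm_Nil [simp]: "word_perm n [] = id"
  by (simp add: word_perm_def)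

lemma word_perm_Cons [simp]: "word_perm n (i # is) = srefl n i \<circ> word_perm n is"
  by (simp add: word_perm_def)

lemma word_perm_append: "word_perm n (is @ js) = word_perm n is \<circ> word_perm n js"
  by (induction "is") (simp_all add: o_assoc)

lemma odd_neq_double: "Suc (x + x) \<noteq> 2 * n" "Suc (Suc (Suc (x + x))) \<noteq> 2 * (n :: nat)"
  by presburger+

lemma srefl_fix:
  "Suc p \<noteq> i \<Longrightarrow> p \<noteq> i \<Longrightarrow> Suc (p + i) \<noteq> 2 * n \<Longrightarrow> p + i \<noteq> 2 * n \<Longrightarrow> srefl n i p = p"
  by (simp add: srefl_def)

lemma srefl_Suc [simp]: "srefl n (Suc j) j = Suc j" "srefl n (Suc j) (Suc j) = j"
  by (simp_all add: srefl_def)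

lemma srefl_involution: "i \<in> {1..n} \<Longrightarrow> srefl n i (srefl n i p) = p"
  by (auto simp: srefl_def; presburger)

lemma srefl_comp_self [simp]: "i \<in> {1..n} \<Longrightarrow> srefl n i \<circ> srefl n i = id"
  using srefl_involution by fastforce

lemma srefl_less: "i \<in> {1..n} \<Longrightarrow> p < 2 * n \<Longrightarrow> srefl n i p < 2 * n"
  by (auto simp: srefl_def)

lemma srefl_mirror: 
  assumes "i \<in> {1..n}" "Suc (p + q) = 2 * n" shows "Suc (srefl n i p + srefl n i q) = 2 * n"
proof -
  have q: "q = 2 * n - 1 - p" using assms by simp
  consider "Suc p = i" | "p = i" | "Suc (p + i) = 2 * n" | "p + i = 2 * n" |
    "Suc p \<noteq> i" "p \<noteq> i" "Suc (p + i) \<noteq> 2 * n" "p + i \<noteq> 2 * n" by blast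
  then show ?thesis
    using assms by cases (simp_all add: srefl_def; arith)+
qed

lemma signed_perm_srefl: 
  assumes "i \<in> {1..n}" shows "signed_perm n (srefl n i)"
proof -
  have "bij_betw (srefl n i) {..<2 * n} {..<2 * n}"
    by (rule bij_betw_byWitness[where f' = "srefl n i"])
      (use assms srefl_involution srefl_less in auto)
  moreover have "srefl n i p = p" if "p \<notin> {..<2 * n}" for p
    using that assms by (auto simp: srefl_def)
  ultimately have "srefl n i permutes {..<2 * n}" by (rule bij_imp_permutes)
  then show ?thesis
    using srefl_mirror[OF assms] by (simp add: signed_perm_def)
qed

lemma signed_perm_id: "signed_perm n id"
  by (simp add: signed_perm_def permutes_id)

lemma signed_perm_less: "signed_perm n w \<Longrightarrow> p < 2 * n \<Longrightarrow> w p < 2 * n"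
  using permutes_in_image[of w "{..<2 * n}" p] by (simp add: signed_perm_def)

lemma signed_perm_mirror: 
  "signed_perm n w \<Longrightarrow> Suc (p + q) = 2 * n \<Longrightarrow> Suc (w p + w q) = 2 * n"
  by (simp add: signed_perm_def)

lemma signed_perm_inj: "signed_perm n w \<Longrightarrow> w p = w q \<longleftrightarrow> p = q"
  using permutes_inj[of w "{..<2 * n}"] by (auto simp: signed_perm_def inj_eq)

lemma signed_perm_outside: "signed_perm n w \<Longrightarrow> \<not> p < 2 * n \<Longrightarrow> w p = p"
  using permutes_not_in[of w "{..<2 * n}" p] by (simp add: signed_perm_def)

lemma signed_perm_comp:
  assumes "signed_perm n w" "signed_perm n v" shows "signed_perm n (w \<circ> v)"
  using assms permutes_compose[of v "{..<2 * n}" w]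
  by (simp add: signed_perm_def)

lemma signed_perm_word: "set is \<subseteq> {1..n} \<Longrightarrow> signed_perm n (word_perm n is)"
  by (induction "is") (simp_all add: signed_perm_id signed_perm_comp signed_perm_srefl)

text \<open>
  Conjugation transports reflections: if \<open>u\<close> maps the pair of positions that defines \<open>s_i\<close> to the
  pair (or the mirrored pair) that defines \<open>s_k\<close>, then \<open>u\<close> maps the mirrored pairs to each other
  as well, and permutes the positions that are fixed.  All braid relations are instances.
\<close>
lemma srefl_conj:
  assumes u: "signed_perm n u" and i: "i \<in> {1..n}" and k: "k \<in> {1..n}"
    and img: "(Suc (u (i - 1)) = k \<and> u i = k) \<or> 
      (Suc (u (i - 1) + k) = 2 * n \<and> u i + k = 2 * n)"
  shows "srefl n k \<circ> u = u \<circ> srefl n i"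
proof
  fix x
  define j a where "j = i - 1" and "a = 2 * n - 1 - i"
  have j: "i = Suc j" and a: "Suc (i + a) = 2 * n" using i by (auto simp: j_def a_def)
  have ua: "Suc (u i + u a) = 2 * n" "Suc (u j + u (Suc a)) = 2 * n"
    using signed_perm_mirror[OF u] a j by auto
  have img': "(Suc (u j) = k \<and> u i = k) \<or> (Suc (u j + k) = 2 * n \<and> u i + k = 2 * n)"
    using img j by simp
  consider "x = j" | "x = i" | "x = a" | "x = Suc a" | "x \<notin> {j, i, a, Suc a}" by blast
  then show "(srefl n k \<circ> u) x = (u \<circ> srefl n i) x"
  proof cases
    case 1
    then have "srefl n i x = i" using j by (simp add: srefl_def)
    moreover have "srefl n k (u j) = u i" using odd_neq_double img' k by (auto simp: srefl_def; presburger)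
    ultimately show ?thesis using 1 by simp
  next
    case 2
    then have "srefl n i x = j" using j by (simp add: srefl_def)
    moreover have "srefl n k (u i) = u j" using odd_neq_double img' k by (auto simp: srefl_def; presburger)
    ultimately show ?thesis using 2 by simp
  next
    case 3
    then have "srefl n i x = Suc a" using j a by (auto simp: srefl_def odd_neq_double)
    moreover have "srefl n k (u a) = u (Suc a)" using odd_neq_double img' k ua by (auto simp: srefl_def odd_neq_double; presburger)
    ultimately show ?thesis using 3 by simp
  next
    case 4
    then have "srefl n i x = a" using j a by (auto simp: srefl_def odd_neq_double)
    moreover have "srefl n k (u (Suc a)) = u a" using odd_neq_double img' k ua by (auto simp: srefl_def odd_neq_double; presburger)
    ultimately show ?thesis using 4 by simp
  next
    case 5
    then have "srefl n i x = x" using j a by (auto simp: srefl_def odd_neq_double)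
    moreover have "u x \<noteq> u j" "u x \<noteq> u i" "u x \<noteq> u a" "u x \<noteq> u (Suc a)"
      using signed_perm_inj[OF u] 5 by auto
    then have "srefl n k (u x) = u x" using img' k ua by (auto simp: srefl_def odd_neq_double; presburger)
    ultimately show ?thesis by simp
  qed
qed

text \<open>
  The only positive root made negative by a simple reflection is its own root.
\<close>
lemma srefl_reverses:
  assumes "k \<in> {1..n}" "p < q" "srefl n k q < srefl n k p"
  shows "(Suc p = k \<and> q = k) \<or> (Suc (p + k) = 2 * n \<and> q + k = 2 * n)"
proof -
  have bound: "srefl n k p \<le> Suc p" "q \<le> Suc (srefl n k q)" by (auto simp: srefl_def)
  then have q: "q = Suc p" and up: "p < srefl n k p" using assms by simp_all
  have "Suc p = k \<or> Suc (p + k) = 2 * n"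
    using up by (auto simp: srefl_def split: if_splits)
  then show ?thesis using q by auto
qed

text \<open>
  The exchange condition.  The letters act from the right end of the word on the pair \<open>i - 1\<close>, \<open>i\<close>;
  as the order of the pair is reversed in the end, some letter \<open>k\<close> reverses it.  At that moment the
  pair is the one defining \<open>s_k\<close>, so that multiplication by \<open>s_i\<close> cancels this letter.
\<close>
lemma word_exchange:
  assumes "set is \<subseteq> {1..n}" "i \<in> {1..n}" "word_perm n is (i - 1) > word_perm n is i"
  shows "\<exists>js. set js \<subseteq> {1..n} \<and> Suc (length js) = length is \<and>
           word_perm n js = word_perm n is \<circ> srefl n i"
  using assms
proof (induction "is")
  case Nil
  then show ?case by simp
next
  case (Cons k ks)
  define u where "u = word_perm n ks"
  have u: "signed_perm n u" using Cons.prems signed_perm_word by (simp add: u_def)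
  have k: "k \<in> {1..n}" using Cons.prems by simp
  show ?case
  proof (cases "u (i - 1) > u i")
    case True
    then obtain js where "set js \<subseteq> {1..n}" "Suc (length js) = length ks"
        "word_perm n js = u \<circ> srefl n i"
      using Cons.IH[OF _ Cons.prems(2)] Cons.prems(1) unfolding u_def
      by (metis insert_subset list.simps(15))
    then show ?thesis using k by (intro exI[of _ "k # js"]) (simp add: u_def o_assoc)
  next
    case False
    have "u (i - 1) \<noteq> u i" using signed_perm_inj[OF u] Cons.prems by auto
    with False have "u (i - 1) < u i" by simp
    moreover have "srefl n k (u i) < srefl n k (u (i - 1))"
      using Cons.prems by (simp add: u_def)
    ultimately have
      "(Suc (u (i - 1)) = k \<and> u i = k) \<or> (Suc (u (i - 1) + k) = 2 * n \<and> u i + k = 2 * n)"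
      using k srefl_reverses by blast
    then have "srefl n k \<circ> u = u \<circ> srefl n i"
      using srefl_conj u k Cons.prems by blast
    then have "word_perm n (k # ks) \<circ> srefl n i = u"
      using Cons.prems by (simp add: u_def o_assoc[symmetric])
    then have "set ks \<subseteq> {1..n} \<and> Suc (length ks) = length (k # ks) \<and>
        word_perm n ks = word_perm n (k # ks) \<circ> srefl n i"
      using Cons.prems(1) unfolding u_def by (intro conjI) auto
    then show ?thesis by blast
  qed
qed

definition reduced :: "nat \<Rightarrow> nat list \<Rightarrow> bool" where
  "reduced n is \<longleftrightarrow> set is \<subseteq> {1..n} \<and>
     (\<forall>js. set js \<subseteq> {1..n} \<and> word_perm n js = word_perm n is \<longrightarrow> length is \<le> length js)"

text \<open>
  Together with \<open>reduced_snocI\<close>: a word is reduced if and only if each of its letters is an ascent of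
  the product of the letters before it.
\<close>
lemma reduced_snocD:
  assumes "reduced n (is @ [i])"
  shows "reduced n is" "i \<in> {1..n}" "word_perm n is (i - 1) < word_perm n is i"
proof -
  have set: "set is \<subseteq> {1..n}" and i: "i \<in> {1..n}" using assms by (auto simp: reduced_def)
  then show "i \<in> {1..n}" by simp
  have min: "Suc (length is) \<le> length js"
    if "set js \<subseteq> {1..n}" "word_perm n js = word_perm n is \<circ> srefl n i" for js
    using assms that by (auto simp: reduced_def word_perm_append)
  show "reduced n is"
    unfolding reduced_def
  proof (intro conjI allI impI set)
    fix js assume "set js \<subseteq> {1..n} \<and> word_perm n js = word_perm n is"
    then show "length is \<le> length js"
      using min[of "js @ [i]"] i by (simp add: word_perm_append)
  qed
  have "word_perm n is (i - 1) \<noteq> word_perm n is i"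
    using signed_perm_inj[OF signed_perm_word[OF set]] i by auto
  moreover have "\<not> word_perm n is i < word_perm n is (i - 1)"
  proof
    assume "word_perm n is i < word_perm n is (i - 1)"
    then obtain js where "set js \<subseteq> {1..n}" "Suc (length js) = length is"
        "word_perm n js = word_perm n is \<circ> srefl n i"
      using word_exchange[OF set i] by blast
    then show False using min[of js] by simp
  qed
  ultimately show "word_perm n is (i - 1) < word_perm n is i" by simp
qed

lemma reduced_exists:
  assumes "set is \<subseteq> {1..n}"
  obtains js where "reduced n js" "word_perm n js = word_perm n is"
proof -
  define P where "P = (\<lambda>js. set js \<subseteq> {1..n} \<and> word_perm n js = word_perm n is)"
  have "P (arg_min length P) \<and> (\<forall>js. P js \<longrightarrow> length (arg_min length P) \<le> length js)"
    by (rule arg_min_nat_lemma) (use assms in \<open>simp add: P_def\<close>)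
  then show thesis
    using that[of "arg_min length P"] unfolding reduced_def P_def by auto
qed

lemma reduced_snocI:
  assumes r: "reduced n is" and i: "i \<in> {1..n}"
    and a: "word_perm n is (i - 1) < word_perm n is i"
  shows "reduced n (is @ [i])"
  unfolding reduced_def
proof (intro conjI allI impI)
  show "set (is @ [i]) \<subseteq> {1..n}" using r i by (simp add: reduced_def)
  fix js assume js: "set js \<subseteq> {1..n} \<and> word_perm n js = word_perm n (is @ [i])"
  then have eq: "word_perm n js = word_perm n is \<circ> srefl n i" by (simp add: word_perm_append)
  then have "word_perm n js (i - 1) > word_perm n js i"
    using a i by (auto simp: srefl_def)
  then obtain ks where ks: "set ks \<subseteq> {1..n}" "Suc (length ks) = length js"
      "word_perm n ks = word_perm n js \<circ> srefl n i"
    using word_exchange js i by blast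
  have "word_perm n ks = word_perm n is"
    using ks(3) i by (simp add: eq o_assoc[symmetric])
  then show "length (is @ [i]) \<le> length js"
    using r ks by (auto simp: reduced_def)
qed

lemma reduced_Nil: "reduced n []"
  by (simp add: reduced_def)

text \<open>
  By mirror symmetry such a permutation increases on all positions, hence \<open>p \<le> w p\<close>; the same bound
  at the mirror image gives the opposite inequality.
\<close>
lemma signed_perm_no_descent:
  assumes w: "signed_perm n w" and asc: "\<And>i. i \<in> {1..n} \<Longrightarrow> w (i - 1) < w i"
  shows "w = id"
proof -
  have step: "w p < w (Suc p)" if "Suc p < 2 * n" for p
  proof (cases "Suc p \<le> n")
    case True
    then show ?thesis using asc[of "Suc p"] by simp
  next
    case False
    define j where "j = 2 * n - 2 - p"
    have j: "Suc j \<in> {1..n}" "Suc (p + Suc j) = 2 * n" 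
      using False that by (auto simp: j_def)
    then have "Suc (w p + w (Suc j)) = 2 * n" "Suc (w (Suc p) + w j) = 2 * n"
      using signed_perm_mirror[OF w] by auto
    moreover have "w j < w (Suc j)" using asc[OF j(1)] by simp
    ultimately show ?thesis by simp
  qed
  have lower: "p < 2 * n \<Longrightarrow> p \<le> w p" for p
  proof (induction p)
    case (Suc p)
    then show ?case using step[of p] by simp
  qed simp
  show ?thesis
  proof
    fix p
    show "w p = id p"
    proof (cases "p < 2 * n")
      case True
      define q where "q = 2 * n - 1 - p"
      have q: "Suc (p + q) = 2 * n" using True by (simp add: q_def)
      then show ?thesis
        using lower[of p] lower[of q] signed_perm_mirror[OF w q] by simp
    next
      case False
      then show ?thesis using signed_perm_outside[OF w] by simp
    qed
  qed
qed

text \<open>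
  Simple reflections generate the group, by sorting.
\<close>
lemma signed_perm_is_word:
  assumes "signed_perm n w"
  shows "\<exists>is. set is \<subseteq> {1..n} \<and> word_perm n is = w"
proof -
  \<comment> \<open>by the rearrangement inequality, undoing a descent decreases this weight\<close>
  define f where "f w = (\<Sum>p<2 * n. p * (2 * n - w p))" for w :: "nat \<Rightarrow> nat"
  show ?thesis
    using assms
  proof (induction "f w" arbitrary: w rule: less_induct)
    case less
    show ?case
    proof (cases "\<forall>i \<in> {1..n}. w (i - 1) < w i")
      case True
      then have "w = id" using signed_perm_no_descent less.prems by blast
      then show ?thesis by (intro exI[of _ "[]"]) simp
    next
      case False
      then obtain i where i: "i \<in> {1..n}" "\<not> w (i - 1) < w i" by blast
      define j a where "j = i - 1" and "a = 2 * n - 1 - i"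
      have j: "i = Suc j" and a: "Suc (i + a) = 2 * n" using i by (auto simp: j_def a_def)
      have wa: "Suc (w i + w a) = 2 * n" "Suc (w j + w (Suc a)) = 2 * n"
        using signed_perm_mirror[OF less.prems] a j by auto
      have "w j \<noteq> w i" using signed_perm_inj[OF less.prems] j by auto
      with i have desc: "w i < w j" by (simp add: j_def)
      let ?s = "srefl n i"
      have ws: "signed_perm n (w \<circ> ?s)"
        using signed_perm_comp[OF less.prems signed_perm_srefl[OF i(1)]] .
      have s: "?s j = i" "?s i = j" "?s a = Suc a" "?s (Suc a) = a"
        using i a j odd_neq_double[of j n] by (auto simp: srefl_def)
      have fix': "?s p = p" if "p \<notin> {j, i, a, Suc a}" for p
        using that j a by (auto simp: srefl_def)
      have "int (f (w \<circ> ?s)) = (\<Sum>p<2 * n. int p * (2 * int n - int (w (?s p))))"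
        using signed_perm_less[OF ws] by (simp add: f_def of_nat_diff less_imp_le)
      also have "\<dots> = (\<Sum>p<2 * n. int (?s p) * (2 * int n - int (w p)))"
        by (rule sum.reindex_bij_witness[where i = ?s and j = ?s])
          (use i srefl_less srefl_involution in auto)
      also have "\<dots> < (\<Sum>p<2 * n. int p * (2 * int n - int (w p)))"
      proof -
        define g where "g p = (int (?s p) - int p) * (2 * int n - int (w p))" for p
        have pair: "g j + g i < 0" "g a + g (Suc a) < 0"
          using desc wa s j by (simp_all add: g_def)
        have "sum g {..<2 * n} = sum g {j, i, a, Suc a}"
          by (rule sum.mono_neutral_right) (use i a j fix' odd_neq_double[of j n] in \<open>auto simp: g_def\<close>)
        also have "\<dots> < 0"
        proof (cases "i = n")
          case True
          then have "{j, i, a, Suc a} = {j, i}" using a j by auto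
          then show ?thesis using pair j by simp
        next
          case ne: False
          then have "sum g {j, i, a, Suc a} = (g j + g i) + (g a + g (Suc a))"
          proof -
            have "i \<noteq> a" "j \<noteq> Suc a" using a j by presburger+
            then show ?thesis using ne a j by auto
          qed
          then show ?thesis using pair by linarith
        qed
        finally have "sum g {..<2 * n} < 0" .
        moreover have "sum g {..<2 * n} = (\<Sum>p<2 * n. int (?s p) * (2 * int n - int (w p))) -
            (\<Sum>p<2 * n. int p * (2 * int n - int (w p)))"
          by (simp add: g_def left_diff_distrib sum_subtractf)
        ultimately show ?thesis by simp
      qed
      also have "\<dots> = int (f w)"
        using signed_perm_less[OF less.prems] by (simp add: f_def of_nat_diff less_imp_le)
      finally have "f (w \<circ> ?s) < f w" by simp
      then obtain js where js: "set js \<subseteq> {1..n}" "word_perm n js = w \<circ> ?s"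
        using less.hyps ws by blast
      have "word_perm n (js @ [i]) = w"
        using js i by (simp add: word_perm_append o_assoc[symmetric])
      then show ?thesis using js i by (intro exI[of _ "js @ [i]"]) simp
    qed
  qed
qed

lemma reduced_single: "i \<in> {1..n} \<Longrightarrow> reduced n [i]"
  using reduced_snocI[OF reduced_Nil, of i n] by simp

lemma reduced_two:
  assumes i: "i \<in> {1..n}" and j: "j \<in> {1..n}" and "i \<noteq> j" shows "reduced n [i, j]"
proof -
  have "srefl n i (j - 1) < srefl n i j"
  proof (rule ccontr)
    assume "\<not> srefl n i (j - 1) < srefl n i j"
    moreover have "srefl n i (j - 1) \<noteq> srefl n i j"
      using signed_perm_inj[OF signed_perm_srefl[OF i]] j by (cases j) auto
    ultimately show False using srefl_reverses[OF i, of "j - 1" j] assms by auto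
  qed
  then show ?thesis using reduced_snocI[OF reduced_single[OF i] j] by simp
qed

lemma reduced_three:
  assumes i: "i \<in> {1..n}" and j: "j \<in> {1..n}" and "i = Suc j \<or> j = Suc i"
  shows "reduced n [i, j, i]"
proof -
  have "srefl n i (srefl n j (i - 1)) < srefl n i (srefl n j i)"
    using assms(3)
  proof
    assume a: "i = Suc j"
    then obtain b where b: "j = Suc b" using j by (cases j) auto
    have "srefl n j (i - 1) = b" "srefl n i b = b" using a b i by (simp_all add: srefl_def)
    moreover have "srefl n j i \<ge> i" using a b i by (simp add: srefl_def)
    moreover have "srefl n i p \<ge> j" if "p \<ge> i" for p using a b i that by (auto simp: srefl_def)
    ultimately show ?thesis using b by (metis less_eq_Suc_le)
  next
    assume a: "j = Suc i"
    then obtain b where b: "i = Suc b" using i by (cases i) auto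
    have "srefl n j (i - 1) = b" "srefl n i b = i" "srefl n j i = j" 
      using a b j odd_neq_double[of b n] by (simp_all add: srefl_def)
    moreover have "srefl n i j \<ge> j" using a b j by (simp add: srefl_def)
    ultimately show ?thesis using a by simp
  qed
  then show ?thesis using reduced_snocI[OF reduced_two[of i n j] i] assms by auto
qed

lemma reduced_four:
  assumes "(i = n \<and> n = Suc j) \<or> (j = n \<and> n = Suc i)" "i \<in> {1..n}" "j \<in> {1..n}"
  shows "reduced n [i, j, i, j]"
proof -
  have "word_perm n [i, j, i] (j - 1) < word_perm n [i, j, i] j"
    using assms(1)
  proof
    assume a: "i = n \<and> n = Suc j"
    then obtain b where b: "j = Suc b" using assms by (cases j) auto
    then show ?thesis using a by (simp add: srefl_def)
  next
    assume a: "j = n \<and> n = Suc i"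
    then obtain b where b: "i = Suc b" using assms by (cases i) auto
    then show ?thesis using a by (simp add: srefl_def)
  qed
  then show ?thesis
    using reduced_snocI[OF reduced_three[of i n j] assms(3)] assms by auto
qed

lemma braid_two:
  assumes "i \<in> {1..n}" "j \<in> {1..n}" "Suc i < j"
  shows "word_perm n [i, j] = word_perm n [j, i]"
proof -
  have "srefl n i (j - 1) = j - 1" "srefl n i j = j"
    by (rule srefl_fix; use assms in simp)+
  then have "srefl n j \<circ> srefl n i = srefl n i \<circ> srefl n j"
    using assms by (intro srefl_conj signed_perm_srefl) simp_all
  then show ?thesis by simp
qed

lemma braid_three:
  assumes "i \<in> {1..n}" "Suc i < n"
  shows "word_perm n [i, Suc i, i] = word_perm n [Suc i, i, Suc i]"
proof -
  obtain b where b: "i = Suc b" using assms by (cases i) auto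
  have "word_perm n [i, Suc i] (i - 1) = i" "word_perm n [i, Suc i] i = Suc i"
    using assms b odd_neq_double[of b n] by (simp_all add: srefl_def)
  then have "srefl n (Suc i) \<circ> word_perm n [i, Suc i] = word_perm n [i, Suc i] \<circ> srefl n i"
    using assms by (intro srefl_conj signed_perm_word) simp_all
  then show ?thesis by (simp add: o_assoc)
qed

lemma braid_four:
  assumes "n \<ge> 2"
  shows "word_perm n [n - 1, n, n - 1, n] = word_perm n [n, n - 1, n, n - 1]"
proof -
  obtain b where b: "n = Suc (Suc b)" using assms by (metis add_2_eq_Suc le_Suc_ex)
  have "word_perm n [n - 1, n, n - 1] (n - 1) = n - 1" "word_perm n [n - 1, n, n - 1] n = n"
    using b by (simp_all add: srefl_def)
  then have "srefl n n \<circ> word_perm n [n - 1, n, n - 1] = word_perm n [n - 1, n, n - 1] \<circ> srefl n n"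
    using assms by (intro srefl_conj signed_perm_word) simp_all
  then show ?thesis by (simp add: o_assoc)
qed

section \<open>Length-multiplicative cocycles\<close>

text \<open>
  The lift of \<open>w\<close> with coefficients \<open>c w\<close> maps the basis vector at \<open>p\<close> to \<open>c w p\<close> times the one at
  \<open>w p\<close>.  The condition says that lifts are multiplied whenever the length increases by one.
\<close>
definition length_cocycle :: "nat \<Rightarrow> ((nat \<Rightarrow> nat) \<Rightarrow> nat \<Rightarrow> 'a::field) \<Rightarrow> bool" where
  "length_cocycle n c \<longleftrightarrow>
     (\<forall>p. c id p = 1) \<and>
     (\<forall>w i p. signed_perm n w \<and> i \<in> {1..n} \<and> w (i - 1) < w i \<and> p < 2 * n \<longrightarrow>
        c (w \<circ> srefl n i) p = c w (srefl n i p) * c (srefl n i) p)"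

text \<open>
  The sign \<open>(- 1) ^ inversions_below w p\<close> is the coefficient of the Tits lift of \<open>w\<close> in the general
  linear group on all \<open>2 n\<close> positions.
\<close>
definition inversions_below :: "(nat \<Rightarrow> nat) \<Rightarrow> nat \<Rightarrow> nat" where
  "inversions_below w p = card {q. q < p \<and> w p < w q}"

definition tits_sign :: "(nat \<Rightarrow> nat) \<Rightarrow> nat \<Rightarrow> 'a::field" where
  "tits_sign w p = (- 1) ^ inversions_below w p"

text \<open>
  Rescaling by these signs turns the standard alternating form into the one that pairs the
  position \<open>p\<close> with its mirror image with the sign \<open>(- 1) ^ p\<close> up to a common factor, and
  for this form the Tits lifts of the general linear group are symplectic.
\<close>
definition half_sign :: "nat \<Rightarrow> nat \<Rightarrow> 'a::field" where
  "half_sign n p = (if n \<le> p then (- 1) ^ p else 1)"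

text \<open>
  Up to the rescaling, the signed permutation matrix in which only a step from some \<open>f\<close> to some \<open>e\<close>
  carries a sign.  Permutations of the \<open>e\<close> among themselves become permutation matrices.
\<close>
definition split_sign :: "nat \<Rightarrow> (nat \<Rightarrow> nat) \<Rightarrow> nat \<Rightarrow> 'a::field" where
  "split_sign n w p =
     half_sign n p * half_sign n (w p) * (if n \<le> p \<and> w p < n then - 1 else 1)"

lemma inversions_below_transpose:
  assumes "w k < w (Suc k)"
  shows "inversions_below (w \<circ> transpose k (Suc k)) p =
     inversions_below w (transpose k (Suc k) p) + (if p = Suc k then 1 else 0)"
proof -
  let ?t = "transpose k (Suc k)"
  consider "p < k" | "p = k" | "p = Suc k" | "p > Suc k" by linarith
  then show ?thesis
  proof cases
    case 1
    then have "{q. q < p \<and> (w \<circ> ?t) p < (w \<circ> ?t) q} = {q. q < p \<and> w p < w q}"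
      by (auto simp: transpose_def)
    then show ?thesis using 1 by (simp add: inversions_below_def)
  next
    case 2
    have "{q. q < k \<and> (w \<circ> ?t) k < (w \<circ> ?t) q} = {q. q < Suc k \<and> w (Suc k) < w q}"
      using assms by (auto simp: transpose_def less_Suc_eq)
    then show ?thesis using 2 by (simp add: inversions_below_def)
  next
    case 3
    have "{q. q < Suc k \<and> (w \<circ> ?t) (Suc k) < (w \<circ> ?t) q} = insert k {q. q < k \<and> w k < w q}"
      using assms by (auto simp: transpose_def less_Suc_eq)
    then show ?thesis using 3 by (simp add: inversions_below_def)
  next
    case 4
    have "bij_betw ?t {q. q < p \<and> (w \<circ> ?t) p < (w \<circ> ?t) q} {q. q < p \<and> w p < w q}"
      by (rule bij_betw_byWitness[where f' = ?t]) (use 4 in \<open>auto simp: transpose_def\<close>)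
    then have "inversions_below (w \<circ> ?t) p = inversions_below w p"
      unfolding inversions_below_def by (rule bij_betw_same_card)
    then show ?thesis using 4 by simp
  qed
qed

lemma tits_sign_transpose:
  assumes "w k < w (Suc k)"
  shows "tits_sign (w \<circ> transpose k (Suc k)) p =
     tits_sign w (transpose k (Suc k) p) * (if p = Suc k then - 1 else 1)"
  unfolding tits_sign_def inversions_below_transpose[of w k p, OF assms] by simp

lemma tits_sign_id: "tits_sign id p = 1"
proof -
  have "{q. q < p \<and> p < q} = {}" by auto
  then show ?thesis unfolding tits_sign_def inversions_below_def id_apply by (simp only: card.empty power_0)
qed

text \<open>
  A simple reflection of type C is a product of one or two commuting adjacent transpositions.  If
  it is an ascent of a signed permutation, both transpositions are ascents, so that the rule for
  one transposition applies twice.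
\<close>
lemma tits_sign_comp_srefl:
  assumes w: "signed_perm n w" and i: "i \<in> {1..n}" and desc: "w (i - 1) < w i"
  shows "tits_sign (w \<circ> srefl n i) p =
     (tits_sign w (srefl n i p) :: 'a::field) * (if p = i \<or> p + i = 2 * n then - 1 else 1)"
proof -
  define j a where "j = i - 1" and "a = 2 * n - 1 - i"
  have j: "i = Suc j" and a: "Suc (i + a) = 2 * n" using i by (auto simp: j_def a_def)
  have wa: "Suc (w i + w a) = 2 * n" "Suc (w j + w (Suc a)) = 2 * n"
    using signed_perm_mirror[OF w] a j by auto
  have asc: "w j < w (Suc j)" "w a < w (Suc a)" using desc wa j by auto
  have pa: "p + i = 2 * n \<longleftrightarrow> p = Suc a" using a by auto
  let ?t = "transpose j (Suc j)" and ?t' = "transpose a (Suc a)"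
  show ?thesis
  proof (cases "i = n")
    case True
    then have "srefl n i = ?t" "a = j" using a j by (auto simp: fun_eq_iff srefl_def transpose_def)
    then show ?thesis
      using tits_sign_transpose[of w j p] asc j pa by simp
  next
    case False
    have s: "srefl n i = ?t \<circ> ?t'"
      using False a j i by (auto simp: fun_eq_iff srefl_def transpose_def)
    have "(w \<circ> ?t) a < (w \<circ> ?t) (Suc a)"
      using i False asc a j by (auto simp: transpose_def)
    then have "tits_sign (w \<circ> ?t \<circ> ?t') p = tits_sign (w \<circ> ?t) (?t' p) * (if p = Suc a then - 1 else 1)"
      by (rule tits_sign_transpose)
    also have "tits_sign (w \<circ> ?t) (?t' p) = tits_sign w (?t (?t' p)) * (if ?t' p = Suc j then - 1 else 1)"
      by (rule tits_sign_transpose[OF asc(1)])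
    also have "?t' p = Suc j \<longleftrightarrow> p = i" using i False a j by (auto simp: transpose_def)
    also have "tits_sign w (?t (?t' p)) * (if p = i then - 1 else 1) * (if p = Suc a then - 1 else 1) =
        tits_sign w (?t (?t' p)) * (if p = i \<or> p = Suc a then - 1 else (1 :: 'a))"
      using False a j by auto
    finally have eq: "tits_sign (w \<circ> ?t \<circ> ?t') p =
        (tits_sign w (?t (?t' p)) * (if p = i \<or> p = Suc a then - 1 else 1) :: 'a)" .
    have "w \<circ> srefl n i = w \<circ> ?t \<circ> ?t'" "srefl n i p = ?t (?t' p)"
      unfolding s by (rule o_assoc) (rule comp_apply)
    with eq show ?thesis unfolding pa by metis
  qed
qed

lemma tits_sign_srefl:
  assumes "i \<in> {1..n}" 
  shows "tits_sign (srefl n i) p = (if p = i \<or> p + i = 2 * n then - 1 else 1)"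
  using tits_sign_comp_srefl[OF signed_perm_id assms, of p] assms by (auto simp: tits_sign_id)

lemma length_cocycle_tits_sign: "length_cocycle n tits_sign"
  unfolding length_cocycle_def
  by (auto simp: tits_sign_id tits_sign_comp_srefl tits_sign_srefl)

lemma half_sign_cancel: "half_sign n q * (half_sign n q * x) = x"
  by (simp add: half_sign_def flip: power_mult_distrib mult.assoc)

text \<open>
  The rescaling is a coboundary.  The remaining sign is multiplicative as long as the reflection
  preserves the two halves; only \<open>s_n\<close> mixes them, and there the ascent \<open>w (n - 1) < w n\<close> means that
  \<open>w\<close> keeps both positions \<open>n - 1\<close> and \<open>n\<close> in their halves.
\<close>
lemma length_cocycle_split_sign: "length_cocycle n (split_sign n)"
  unfolding length_cocycle_def
proof (intro conjI allI impI)
  fix p show "split_sign n id p = (1 :: 'a)"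
    using half_sign_cancel[of n p 1] by (auto simp: split_sign_def)
next
  fix w i p
  assume "signed_perm n w \<and> i \<in> {1..n} \<and> w (i - 1) < w i \<and> p < 2 * n"
  then have w: "signed_perm n w" and i: "i \<in> {1..n}" and asc: "w (i - 1) < w i" 
    and p: "p < 2 * n" by auto
  define q where "q = srefl n i p"
  have sign: "(if n \<le> p \<and> w q < n then - 1 else (1 :: 'a)) =
      (if n \<le> q \<and> w q < n then - 1 else 1) * (if n \<le> p \<and> q < n then - 1 else 1)"
  proof (cases "i = n \<and> (Suc p = n \<or> p = n)")
    case False
    then have "n \<le> q \<longleftrightarrow> n \<le> p" using i p by (auto simp: srefl_def q_def)
    then show ?thesis by auto
  next
    case True
    have "Suc (w (n - 1) + w n) = 2 * n"
      using signed_perm_mirror[OF w, of "n - 1" n] i by auto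
    then have "w (n - 1) < n" "n \<le> w n" using asc True by auto
    moreover have "(p = n - 1 \<and> q = n) \<or> (p = n \<and> q = n - 1)"
      using True i by (auto simp: srefl_def q_def)
    ultimately show ?thesis using i by auto
  qed
  show "split_sign n (w \<circ> srefl n i) p = split_sign n w (srefl n i p) * (split_sign n (srefl n i) p :: 'a)"
    unfolding split_sign_def comp_apply q_def[symmetric] sign
    using half_sign_cancel[of n q 1] by (simp only: mult_ac mult_1_right mult_1_left) (simp add: half_sign_cancel mult_ac)
qed

section \<open>Matrices in the ordered symplectic basis\<close>

text \<open>
  The row number that belongs to a position.  The map is its own inverse, hence it also translates
  row numbers into positions.
\<close>
definition mat_index :: "nat \<Rightarrow> nat \<Rightarrow> nat" where
  "mat_index n p = (if p < n then p else 3 * n - 1 - p)"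

text \<open>
  Matrices are handled as functions of two positions; in these terms the form pairs mirror images
  and the simple roots are quotients of consecutive entries.
\<close>
definition pos_mat :: "nat \<Rightarrow> (nat \<Rightarrow> nat \<Rightarrow> 'a::field) \<Rightarrow> 'a mat" where
  "pos_mat n f = mat (2 * n) (2 * n) (\<lambda>(r, s). f (mat_index n r) (mat_index n s))"

definition pos_mult :: "nat \<Rightarrow> (nat \<Rightarrow> nat \<Rightarrow> 'a::field) \<Rightarrow> (nat \<Rightarrow> nat \<Rightarrow> 'a) \<Rightarrow> nat \<Rightarrow> nat \<Rightarrow> 'a" where
  "pos_mult n f g r p = (\<Sum>s<2 * n. f r s * g s p)"

text \<open>
  The value of the standard form on the basis vector at \<open>p\<close> and the one at the mirror image of \<open>p\<close>.
\<close>
definition pos_sign :: "nat \<Rightarrow> nat \<Rightarrow> 'a::field" where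
  "pos_sign n p = (if p < n then 1 else - 1)"

definition similitude :: "nat \<Rightarrow> (nat \<Rightarrow> nat \<Rightarrow> 'a::field) \<Rightarrow> 'a \<Rightarrow> bool" where
  "similitude n f \<mu> \<longleftrightarrow> \<mu> \<noteq> 0 \<and>
     (\<forall>p < 2 * n. \<forall>q < 2 * n.
        (\<Sum>r<2 * n. pos_sign n r * f r p * f (2 * n - 1 - r) q) =
          (if Suc (p + q) = 2 * n then \<mu> * pos_sign n p else 0))"

abbreviation pos_one :: "nat \<Rightarrow> nat \<Rightarrow> 'a::field" where
  "pos_one r p \<equiv> (if r = p then 1 else 0)"

lemma mat_index_less: "p < 2 * n \<Longrightarrow> mat_index n p < 2 * n"
  by (auto simp: mat_index_def)

lemma mat_index_idem: "p < 2 * n \<Longrightarrow> mat_index n (mat_index n p) = p"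
  by (auto simp: mat_index_def)

lemma mat_index_eq_iff: 
  "p < 2 * n \<Longrightarrow> q < 2 * n \<Longrightarrow> mat_index n p = mat_index n q \<longleftrightarrow> p = q"
  using mat_index_idem by metis

lemma sum_mat_index: "(\<Sum>s<2 * n. h (mat_index n s)) = (\<Sum>s<2 * n. h s)"
  by (rule sum.reindex_bij_witness[where i = "mat_index n" and j = "mat_index n"])
    (auto simp: mat_index_idem mat_index_less)

lemma pos_mat_carrier [simp]: "pos_mat n f \<in> carrier_mat (2 * n) (2 * n)"
  by (simp add: pos_mat_def)

lemma pos_mat_dim [simp]: "dim_row (pos_mat n f) = 2 * n" "dim_col (pos_mat n f) = 2 * n"
  by (simp_all add: pos_mat_def)

lemma pos_mat_entry [simp]:
  "r < 2 * n \<Longrightarrow> s < 2 * n \<Longrightarrow> pos_mat n f $$ (r, s) = f (mat_index n r) (mat_index n s)"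
  by (simp add: pos_mat_def)

lemma pos_mat_cong_iff:
  "pos_mat n f = pos_mat n g \<longleftrightarrow> (\<forall>r < 2 * n. \<forall>p < 2 * n. f r p = g r p)"
proof
  assume eq: "pos_mat n f = pos_mat n g"
  show "\<forall>r < 2 * n. \<forall>p < 2 * n. f r p = g r p"
  proof (intro allI impI)
    fix r p assume "r < 2 * n" "p < 2 * n"
    then show "f r p = g r p"
      using arg_cong[OF eq, of "\<lambda>A. A $$ (mat_index n r, mat_index n p)"]
      by (simp add: mat_index_less mat_index_idem)
  qed
next
  assume "\<forall>r < 2 * n. \<forall>p < 2 * n. f r p = g r p"
  then show "pos_mat n f = pos_mat n g"
    by (intro eq_matI) (simp_all add: mat_index_less)
qed

lemma pos_mat_surj:
  assumes "A \<in> carrier_mat (2 * n) (2 * n)"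
  obtains f where "A = pos_mat n f"
proof
  show "A = pos_mat n (\<lambda>r p. A $$ (mat_index n r, mat_index n p))"
    using assms by (intro eq_matI) (auto simp: mat_index_idem mat_index_less)
qed

lemma pos_mat_mult: "pos_mat n f * pos_mat n g = pos_mat n (pos_mult n f g)"
proof (rule eq_matI)
  fix r s assume "r < dim_row (pos_mat n (pos_mult n f g))" "s < dim_col (pos_mat n (pos_mult n f g))"
  then have rs: "r < 2 * n" "s < 2 * n" by simp_all
  have "(pos_mat n f * pos_mat n g) $$ (r, s) = 
      (\<Sum>k<2 * n. f (mat_index n r) (mat_index n k) * g (mat_index n k) (mat_index n s))"
    using rs by (simp add: scalar_prod_def atLeast0LessThan)
  also have "\<dots> = pos_mult n f g (mat_index n r) (mat_index n s)"
    unfolding pos_mult_def by (rule sum_mat_index)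
  finally show "(pos_mat n f * pos_mat n g) $$ (r, s) = pos_mat n (pos_mult n f g) $$ (r, s)"
    using rs by simp
qed simp_all

lemma pos_mat_one: "1\<^sub>m (2 * n) = pos_mat n pos_one"
  by (intro eq_matI) (auto simp: mat_index_eq_iff)

lemma pos_mat_add: "pos_mat n f + pos_mat n g = pos_mat n (\<lambda>r p. f r p + g r p)"
  by (intro eq_matI) auto

lemma pos_mat_smult: "k \<cdot>\<^sub>m pos_mat n f = pos_mat n (\<lambda>r p. k * f r p)"
  by (intro eq_matI) auto

lemma pos_mat_transpose: "transpose_mat (pos_mat n f) = pos_mat n (\<lambda>r p. f p r)"
  by (intro eq_matI) auto

lemma pos_mat_symp_form:
  "symp_form n = pos_mat n (\<lambda>r s. if Suc (r + s) = 2 * n then pos_sign n r else 0)"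
  by (intro eq_matI) (auto simp: symp_form_def mat_index_def pos_sign_def)

lemma sum_mirror:
  fixes h :: "nat \<Rightarrow> 'a::comm_monoid_add"
  assumes "q < 2 * n"
  shows "(\<Sum>s<2 * n. if Suc (q + s) = 2 * n then h s else 0) = h (2 * n - 1 - q)"
proof -
  have "(\<Sum>s<2 * n. if Suc (q + s) = 2 * n then h s else 0) =
      (\<Sum>s<2 * n. if s = 2 * n - 1 - q then h s else 0)"
    using assms by (intro sum.cong) auto
  also have "\<dots> = h (2 * n - 1 - q)" using assms by (subst sum.delta) auto
  finally show ?thesis .
qed

lemma GSp_pos_mat: 
  "pos_mat n f \<in> carrier (GSp n) \<longleftrightarrow> (\<exists>\<mu>. similitude n f \<mu>)"
proof -
  let ?J = "\<lambda>r s. if Suc (r + s) = 2 * n then pos_sign n r else (0 :: 'a)"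
  have "pos_mult n (\<lambda>r p. f p r) (pos_mult n ?J f) p q = 
      (\<Sum>r<2 * n. pos_sign n r * f r p * f (2 * n - 1 - r) q)" for p q
  proof -
    have "pos_mult n ?J f r q = pos_sign n r * f (2 * n - 1 - r) q" if "r < 2 * n" for r
    proof -
      have "pos_mult n ?J f r q = (\<Sum>s<2 * n. if Suc (r + s) = 2 * n then pos_sign n r * f s q else 0)"
        unfolding pos_mult_def by (intro sum.cong) auto
      then show ?thesis using sum_mirror[OF that, of "\<lambda>s. pos_sign n r * f s q"] by simp
    qed
    then show ?thesis
      unfolding pos_mult_def[of n "\<lambda>r p. f p r"] by (intro sum.cong) (auto simp: mult_ac)
  qed
  then have "transpose_mat (pos_mat n f) * symp_form n * pos_mat n f = \<mu> \<cdot>\<^sub>m symp_form n \<longleftrightarrow>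
      (\<forall>p < 2 * n. \<forall>q < 2 * n.
        (\<Sum>r<2 * n. pos_sign n r * f r p * f (2 * n - 1 - r) q) =
          (if Suc (p + q) = 2 * n then \<mu> * pos_sign n p else 0))" for \<mu>
    unfolding pos_mat_symp_form pos_mat_transpose pos_mat_smult
    apply (subst assoc_mult_mat[of _ "2 * n" "2 * n" _ "2 * n" _ "2 * n"])
       apply simp_all
    unfolding pos_mat_mult pos_mat_cong_iff
    by (intro all_cong1 imp_cong refl) auto
  then show ?thesis
    by (auto simp: GSp_def similitude_def)
qed

section \<open>Classes modulo scalars\<close>

definition pos_class :: "nat \<Rightarrow> (nat \<Rightarrow> nat \<Rightarrow> 'a::field) \<Rightarrow> 'a mat set" where
  "pos_class n f = PGSp_class n (pos_mat n f)"

lemma PGSp_class_eq: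
  assumes "A \<in> carrier_mat (2 * n) (2 * n)"
  shows "PGSp_class n A = {c \<cdot>\<^sub>m A | c. c \<noteq> 0}"
proof -
  have "(c \<cdot>\<^sub>m 1\<^sub>m (2 * n)) * A = c \<cdot>\<^sub>m A" for c
    using assms by (subst mult_smult_assoc_mat) auto
  then show ?thesis
    by (auto simp: PGSp_class_def r_coset_def GSp_def scalar_mats_def)
qed

lemma pos_class_eq: "pos_class n f = {pos_mat n (\<lambda>r p. c * f r p) | c. c \<noteq> 0}"
  by (simp add: pos_class_def PGSp_class_eq pos_mat_smult)

lemma pos_mat_in_class: "pos_mat n f \<in> pos_class n f"
  unfolding pos_class_eq by (auto intro: exI[of _ 1])

lemma pos_class_eq_iff:
  "pos_class n f = pos_class n g \<longleftrightarrow> (\<exists>c. c \<noteq> 0 \<and> (\<forall>r < 2 * n. \<forall>p < 2 * n. g r p = c * f r p))"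
proof
  assume "pos_class n f = pos_class n g"
  then have "pos_mat n g \<in> pos_class n f" using pos_mat_in_class by metis
  then show "\<exists>c. c \<noteq> 0 \<and> (\<forall>r < 2 * n. \<forall>p < 2 * n. g r p = c * f r p)"
    by (auto simp: pos_class_eq pos_mat_cong_iff)
next
  assume "\<exists>c. c \<noteq> 0 \<and> (\<forall>r < 2 * n. \<forall>p < 2 * n. g r p = c * f r p)"
  then obtain c where c: "c \<noteq> 0" "\<forall>r < 2 * n. \<forall>p < 2 * n. g r p = c * f r p" by blast
  have "pos_mat n (\<lambda>r p. k * g r p) = pos_mat n (\<lambda>r p. (k * c) * f r p)" 
    "pos_mat n (\<lambda>r p. k * f r p) = pos_mat n (\<lambda>r p. (k / c) * g r p)" for k
    using c by (auto simp: pos_mat_cong_iff)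
  then show "pos_class n f = pos_class n g"
    unfolding pos_class_eq using c(1)
    by (auto; metis divide_eq_0_iff mult_eq_0_iff)
qed

lemma pos_class_mult:
  "pos_class n f \<otimes>\<^bsub>PGSp n\<^esub> pos_class n g = pos_class n (pos_mult n f g)"
proof -
  have mult: "pos_mat n (\<lambda>r p. c * f r p) * pos_mat n (\<lambda>r p. d * g r p) = 
      pos_mat n (\<lambda>r p. (c * d) * pos_mult n f g r p)" for c d
    unfolding pos_mat_mult pos_mat_cong_iff pos_mult_def by (simp add: sum_distrib_left mult_ac)
  have eq: "pos_class n f \<otimes>\<^bsub>PGSp n\<^esub> pos_class n g =
      {A * B | A B. A \<in> pos_class n f \<and> B \<in> pos_class n g}"
    by (auto simp: PGSp_def FactGroup_def set_mult_def GSp_def)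
  show ?thesis
  proof (intro subset_antisym subsetI)
    fix M assume "M \<in> pos_class n f \<otimes>\<^bsub>PGSp n\<^esub> pos_class n g"
    then obtain A B where AB: "M = A * B" "A \<in> pos_class n f" "B \<in> pos_class n g"
      unfolding eq by blast
    then obtain c d where cd: "A = pos_mat n (\<lambda>r p. c * f r p)" "c \<noteq> 0"
        "B = pos_mat n (\<lambda>r p. d * g r p)" "d \<noteq> 0"
      unfolding pos_class_eq by blast
    show "M \<in> pos_class n (pos_mult n f g)"
      unfolding pos_class_eq AB(1) cd mult using cd by (intro CollectI exI[of _ "c * d"]) simp
  next
    fix M assume "M \<in> pos_class n (pos_mult n f g)"
    then obtain k where k: "M = pos_mat n (\<lambda>r p. k * pos_mult n f g r p)" "k \<noteq> 0"
      unfolding pos_class_eq by blast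
    then have "M = pos_mat n (\<lambda>r p. k * f r p) * pos_mat n g"
      using mult[of k 1] by simp
    moreover have "pos_mat n (\<lambda>r p. k * f r p) \<in> pos_class n f"
      using k unfolding pos_class_eq by blast
    ultimately show "M \<in> pos_class n f \<otimes>\<^bsub>PGSp n\<^esub> pos_class n g"
      unfolding eq using pos_mat_in_class by blast
  qed
qed

lemma PGSp_carrier:
  "carrier (PGSp n :: 'a::field mat set monoid) = {pos_class n f | f. \<exists>\<mu>. similitude n f \<mu>}"
proof -
  have "carrier (PGSp n :: 'a mat set monoid) = PGSp_class n ` carrier (GSp n)"
    by (auto simp: PGSp_def FactGroup_def RCOSETS_def PGSp_class_def)
  also have "\<dots> = {pos_class n f | f. pos_mat n f \<in> carrier (GSp n)}"
  proof (intro subset_antisym subsetI)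
    fix M assume "M \<in> PGSp_class n ` carrier (GSp n :: 'a mat monoid)"
    then obtain A where A: "M = PGSp_class n A" "A \<in> carrier (GSp n)" by blast
    then have "A \<in> carrier_mat (2 * n) (2 * n)" by (simp add: GSp_def)
    then obtain f where "A = pos_mat n f" using pos_mat_surj by blast
    then show "M \<in> {pos_class n f | f. pos_mat n f \<in> carrier (GSp n)}"
      using A by (auto simp: pos_class_def)
  qed (auto simp: pos_class_def)
  finally show ?thesis by (simp add: GSp_pos_mat)
qed

section \<open>Monomial matrices\<close>

definition monomial :: "(nat \<Rightarrow> nat) \<Rightarrow> (nat \<Rightarrow> 'a::field) \<Rightarrow> nat \<Rightarrow> nat \<Rightarrow> 'a" where
  "monomial w m r p = (if r = w p then m p else 0)"

lemma monomial_mult: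
  assumes "signed_perm n v" "p < 2 * n"
  shows "pos_mult n (monomial w m) (monomial v k) r p = monomial (w \<circ> v) (\<lambda>p. k p * m (v p)) r p"
proof -
  have "pos_mult n (monomial w m) (monomial v k) r p =
      (\<Sum>s<2 * n. if s = v p then monomial w m r s * k p else 0)"
    unfolding pos_mult_def by (intro sum.cong) (auto simp: monomial_def)
  also have "\<dots> = monomial w m r (v p) * k p"
    using signed_perm_less[OF assms] by (subst sum.delta) auto
  finally show ?thesis by (simp add: monomial_def)
qed

lemma similitude_monomial_sum:
  assumes "signed_perm n w" "p < 2 * n" "q < 2 * n"
  shows "(\<Sum>r<2 * n. pos_sign n r * monomial w m r p * monomial w m (2 * n - 1 - r) q) =
    (if Suc (p + q) = 2 * n then pos_sign n (w p) * m p * m q else 0)"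
proof -
  have wp: "w p < 2 * n" "w q < 2 * n" using assms signed_perm_less by auto
  have "(\<Sum>r<2 * n. pos_sign n r * monomial w m r p * monomial w m (2 * n - 1 - r) q) =
     (\<Sum>r<2 * n. if r = w p then pos_sign n r * m p * monomial w m (2 * n - 1 - r) q else 0)"
    by (intro sum.cong) (auto simp: monomial_def)
  also have "\<dots> = pos_sign n (w p) * m p * monomial w m (2 * n - 1 - w p) q"
    using wp by (subst sum.delta) auto
  also have "2 * n - 1 - w p = w q \<longleftrightarrow> Suc (p + q) = 2 * n"
  proof
    assume "2 * n - 1 - w p = w q"
    moreover have "Suc (w p + w (2 * n - 1 - p)) = 2 * n"
      using assms by (intro signed_perm_mirror[OF assms(1)]) auto
    ultimately have "w (2 * n - 1 - p) = w q" by simp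
    then show "Suc (p + q) = 2 * n" using assms signed_perm_inj[OF assms(1)] by auto
  next
    assume "Suc (p + q) = 2 * n"
    then show "2 * n - 1 - w p = w q" using signed_perm_mirror[OF assms(1)] by fastforce
  qed
  then have "pos_sign n (w p) * m p * monomial w m (2 * n - 1 - w p) q = 
     (if Suc (p + q) = 2 * n then pos_sign n (w p) * m p * m q else 0)"
    by (simp add: monomial_def)
  finally show ?thesis .
qed

lemma similitude_monomial:
  assumes "signed_perm n w"
  shows "similitude n (monomial w m) \<mu> \<longleftrightarrow> \<mu> \<noteq> 0 \<and>
    (\<forall>p q. Suc (p + q) = 2 * n \<longrightarrow> pos_sign n (w p) * m p * m q = \<mu> * pos_sign n p)"
proof -
  have "similitude n (monomial w m) \<mu> \<longleftrightarrow> \<mu> \<noteq> 0 \<and> (\<forall>p < 2 * n. \<forall>q < 2 * n.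
      (if Suc (p + q) = 2 * n then pos_sign n (w p) * m p * m q else 0) =
      (if Suc (p + q) = 2 * n then \<mu> * pos_sign n p else 0))"
    unfolding similitude_def using similitude_monomial_sum[OF assms, of _ _ m]
    by (intro conj_cong refl all_cong1 imp_cong) (simp only:)
  then show ?thesis by auto
qed

lemma similitude_column_nonzero:
  assumes "similitude n f \<mu>" "p < 2 * n"
  obtains r where "r < 2 * n" "f r p \<noteq> 0"
proof -
  have "(\<Sum>r<2 * n. pos_sign n r * f r p * f (2 * n - 1 - r) (2 * n - 1 - p)) = \<mu> * pos_sign n p"
    using assms by (auto simp: similitude_def)
  moreover have "\<mu> * pos_sign n p \<noteq> 0" using assms by (simp add: similitude_def pos_sign_def)
  ultimately obtain r where "r < 2 * n" "pos_sign n r * f r p * f (2 * n - 1 - r) (2 * n - 1 - p) \<noteq> 0"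
    by (metis (no_types, lifting) lessThan_iff sum.neutral)
  then show ?thesis using that by auto
qed

text \<open>
  The form pairs every column nontrivially with its mirror column.  Hence no column vanishes, the
  nonzero entries of mirror columns lie in mirror rows, and two columns cannot share a row.
\<close>
lemma similitude_monomialI:
  assumes f: "similitude n f \<mu>"
    and one: "\<And>p r s. p < 2 * n \<Longrightarrow> r < 2 * n \<Longrightarrow> s < 2 * n \<Longrightarrow> f r p \<noteq> 0 \<Longrightarrow> f s p \<noteq> 0 \<Longrightarrow> r = s"
  obtains w m where "signed_perm n w" "\<And>r p. r < 2 * n \<Longrightarrow> p < 2 * n \<Longrightarrow> f r p = monomial w m r p"
proof -
  define w where "w p = (if p < 2 * n then (THE r. r < 2 * n \<and> f r p \<noteq> 0) else p)" for p
  have ex: "\<exists>!r. r < 2 * n \<and> f r p \<noteq> 0" if "p < 2 * n" for p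
    using similitude_column_nonzero[OF f that] one that by metis
  have w: "w p < 2 * n" "f (w p) p \<noteq> 0" if "p < 2 * n" for p
    using theI'[OF ex[OF that]] that by (auto simp: w_def)
  have uniq: "r = w p" if "p < 2 * n" "r < 2 * n" "f r p \<noteq> 0" for r p
    using one[of p r "w p"] w that by auto
  have sum: "(\<Sum>r<2 * n. pos_sign n r * f r p * f (2 * n - 1 - r) q) =
     pos_sign n (w p) * f (w p) p * f (2 * n - 1 - w p) q" if "p < 2 * n" "q < 2 * n" for p q
  proof -
    have "(\<Sum>r<2 * n. pos_sign n r * f r p * f (2 * n - 1 - r) q) =
       (\<Sum>r<2 * n. if r = w p then pos_sign n r * f r p * f (2 * n - 1 - r) q else 0)"
      using uniq that by (intro sum.cong) auto
    also have "\<dots> = pos_sign n (w p) * f (w p) p * f (2 * n - 1 - w p) q"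
      using w that by (subst sum.delta) auto
    finally show ?thesis .
  qed
  have sgn: "pos_sign n r \<noteq> (0 :: 'a)" for r by (simp add: pos_sign_def)
  have mirror: "w q = 2 * n - 1 - w p" if "p < 2 * n" "q < 2 * n" "Suc (p + q) = 2 * n" for p q
  proof -
    have "pos_sign n (w p) * f (w p) p * f (2 * n - 1 - w p) q = \<mu> * pos_sign n p"
      using f that sum[OF that(1,2)] by (simp add: similitude_def)
    then have "f (2 * n - 1 - w p) q \<noteq> 0" 
      using f sgn[of p] by (auto simp: similitude_def)
    then show ?thesis using uniq[of q "2 * n - 1 - w p"] that w by auto
  qed
  have inj: "p = p'" if "p < 2 * n" "p' < 2 * n" "w p = w p'" for p p'
  proof -
    define q where "q = 2 * n - 1 - p'"
    have q: "q < 2 * n" "Suc (p' + q) = 2 * n" using that by (auto simp: q_def)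
    have "w q = 2 * n - 1 - w p" using mirror[OF that(2) q] that by simp
    then have "f (2 * n - 1 - w p) q \<noteq> 0" using w(2)[OF q(1)] by simp
    then have "pos_sign n (w p) * f (w p) p * f (2 * n - 1 - w p) q \<noteq> 0"
      using w(2)[OF that(1)] sgn by simp
    then have "(if Suc (p + q) = 2 * n then \<mu> * pos_sign n p else 0) \<noteq> (0 :: 'a)"
      using f that(1) q(1) unfolding similitude_def sum[OF that(1) q(1), symmetric] by simp
    then have "Suc (p + q) = 2 * n" by presburger
    then show "p = p'" using q by simp
  qed
  have "w ` {..<2 * n} \<subseteq> {..<2 * n}" using w by auto
  moreover have inj_on: "inj_on w {..<2 * n}" using inj by (auto intro: inj_onI)
  ultimately have "w ` {..<2 * n} = {..<2 * n}" by (simp add: endo_inj_surj)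
  then have "w permutes {..<2 * n}"
    using inj_on by (intro bij_imp_permutes) (auto simp: bij_betw_def w_def)
  moreover have "Suc (w p + w q) = 2 * n" if "Suc (p + q) = 2 * n" for p q
    using mirror[of p q] w[of p] that by auto
  ultimately have "signed_perm n w" by (simp add: signed_perm_def)
  moreover have "f r p = monomial w (\<lambda>p. f (w p) p) r p" if "r < 2 * n" "p < 2 * n" for r p
    using uniq that by (auto simp: monomial_def)
  ultimately show thesis using that by blast
qed

section \<open>Root subgroups and the elements sigma\<close>

text \<open>
  Any root of \<open>X \<Prod> (X ^ d - 1) + 1\<close> will do, since it is a zero of none of the factors.
\<close>
lemma alg_closed_exists_no_small_order:
  obtains x :: "'a::alg_closed_field" where "x \<noteq> 0" "\<And>d. d \<in> {1..N} \<Longrightarrow> x ^ d \<noteq> 1"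
proof -
  define q :: "'a poly" where "q = [:0, 1:] * (\<Prod>d\<in>{1..N}. Polynomial.monom 1 d - 1)"
  have nz: "Polynomial.monom 1 d - 1 \<noteq> (0 :: 'a poly)" if "d \<in> {1..N}" for d
  proof -
    have "Polynomial.coeff (Polynomial.monom 1 d - 1 :: 'a poly) d = 1" using that by simp
    then show ?thesis by (metis coeff_0 zero_neq_one)
  qed
  then have "(\<Prod>d\<in>{1..N}. Polynomial.monom 1 d - 1) \<noteq> (0 :: 'a poly)" by (simp add: prod_zero_iff)
  then have "Polynomial.degree q > 0" unfolding q_def by (subst degree_mult_eq) auto
  then have "Polynomial.degree (q + 1) > 0" by (simp add: degree_add_eq_left)
  then obtain x where "poly (q + 1) x = 0" using alg_closed_imp_poly_has_root by blast
  then have x: "x * (\<Prod>d\<in>{1..N}. x ^ d - 1) = - 1"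
    by (simp add: q_def poly_prod poly_monom eq_neg_iff_add_eq_0)
  then have "x \<noteq> 0" "(\<Prod>d\<in>{1..N}. x ^ d - 1) \<noteq> 0" 
    by (metis mult_zero_left mult_zero_right neg_equal_0_iff_equal one_neq_zero)+
  then show thesis using that[of x] by (simp add: prod_zero_iff)
qed

lemma power_eq_no_small_order:
  fixes x :: "'a::field"
  assumes "x \<noteq> 0" "\<And>d. d \<in> {1..N} \<Longrightarrow> x ^ d \<noteq> 1" "a \<le> N" "b \<le> N" "x ^ a = x ^ b"
  shows "a = b"
proof -
  have "a = b" if "a \<le> b" "b \<le> N" "x ^ a = x ^ b" for a b
  proof (rule ccontr)
    assume "a \<noteq> b"
    then have "b - a \<in> {1..N}" using that by auto
    moreover have "x ^ b = x ^ a * x ^ (b - a)" using that(1) by (metis le_add_diff_inverse power_add)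
    then have "x ^ (b - a) = 1" using that assms(1) by simp
    ultimately show False using assms(2) by blast
  qed
  from this[of a b] this[of b a] show ?thesis using assms by (cases "a \<le> b") auto
qed

text \<open>
  The coefficients \<open>c\<close> and the permutation \<open>w\<close> describe a similitude of the form that pairs \<open>p\<close> with
  its mirror image with the sign \<open>(- 1) ^ p\<close>.
\<close>
definition monomial_data :: "nat \<Rightarrow> (nat \<Rightarrow> nat) \<Rightarrow> (nat \<Rightarrow> 'a::field) \<Rightarrow> bool" where
  "monomial_data n w c \<longleftrightarrow> signed_perm n w \<and> (\<forall>p < 2 * n. c p \<noteq> 0) \<and>
     (\<exists>\<mu>. \<forall>p q. Suc (p + q) = 2 * n \<longrightarrow> c p * c q * (- 1) ^ (p + w p) = \<mu>)"

lemma monomial_data_id: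
  "monomial_data n id c \<longleftrightarrow> (\<forall>p < 2 * n. c p \<noteq> 0) \<and> (\<exists>\<mu>. \<forall>p q. Suc (p + q) = 2 * n \<longrightarrow> c p * c q = \<mu>)"
  by (simp add: monomial_data_def signed_perm_id)

lemma similitude_diag:
  assumes "n \<ge> 1"
  shows "(\<exists>\<mu>. similitude n (monomial id c) \<mu>) \<longleftrightarrow> monomial_data n id c"
proof -
  have sgn: "pos_sign n p \<noteq> (0 :: 'a)" for p by (simp add: pos_sign_def)
  have "similitude n (monomial id c) \<mu> \<longleftrightarrow> \<mu> \<noteq> 0 \<and> (\<forall>p q. Suc (p + q) = 2 * n \<longrightarrow> c p * c q = \<mu>)" for \<mu>
    unfolding similitude_monomial[OF signed_perm_id] using sgn by (simp add: mult.commute[of \<mu>] mult.assoc)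
  moreover have "(\<exists>\<mu>. \<mu> \<noteq> 0 \<and> (\<forall>p q. Suc (p + q) = 2 * n \<longrightarrow> c p * c q = \<mu>)) \<longleftrightarrow> monomial_data n id c"
    unfolding monomial_data_id
  proof safe
    fix \<mu> p assume "\<mu> \<noteq> 0" "\<forall>p q. Suc (p + q) = 2 * n \<longrightarrow> c p * c q = \<mu>" "p < 2 * n" "c p = 0"
    moreover have "Suc (p + (2 * n - 1 - p)) = 2 * n" using \<open>p < 2 * n\<close> by simp
    ultimately show False by (metis mult_zero_left)
  next
    fix \<mu> assume c: "\<forall>p < 2 * n. c p \<noteq> 0" and m: "\<forall>p q. Suc (p + q) = 2 * n \<longrightarrow> c p * c q = \<mu>"
    have "Suc (0 + (2 * n - 1)) = 2 * n" using assms by simp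
    then have "c 0 * c (2 * n - 1) = \<mu>" using m by blast
    moreover have "c 0 * c (2 * n - 1) \<noteq> 0" using c assms by simp
    ultimately show "\<exists>\<mu>. \<mu> \<noteq> 0 \<and> (\<forall>p q. Suc (p + q) = 2 * n \<longrightarrow> c p * c q = \<mu>)" using m by auto
  qed auto
  ultimately show ?thesis by simp
qed

lemma GSp_diag_eq:
  assumes "n \<ge> 1"
  shows "GSp_diag n = {pos_mat n (monomial id c) | c. monomial_data n id c}"
proof (intro subset_antisym subsetI)
  fix A :: "'a mat" assume A: "A \<in> GSp_diag n"
  then have "A \<in> carrier_mat (2 * n) (2 * n)" by (simp add: GSp_diag_def GSp_def)
  then obtain f where f: "A = pos_mat n f" using pos_mat_surj by blast
  have "f r p = 0" if "r < 2 * n" "p < 2 * n" "r \<noteq> p" for r p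
  proof -
    have "A $$ (mat_index n r, mat_index n p) = 0"
      using A that by (simp add: GSp_diag_def diagonal_mat_def f mat_index_less mat_index_eq_iff)
    then show ?thesis using that by (simp add: f mat_index_less mat_index_idem)
  qed
  then have "A = pos_mat n (monomial id (\<lambda>p. f p p))"
    unfolding f pos_mat_cong_iff by (auto simp: monomial_def)
  moreover from this have "monomial_data n id (\<lambda>p. f p p)"
    using A by (simp add: GSp_diag_def GSp_pos_mat similitude_diag[OF assms])
  ultimately show "A \<in> {pos_mat n (monomial id c) | c. monomial_data n id c}" by blast
next
  fix A :: "'a mat" assume "A \<in> {pos_mat n (monomial id c) | c. monomial_data n id c}"
  then obtain c where "A = pos_mat n (monomial id c)" "monomial_data n id c" by blast
  then show "A \<in> GSp_diag n"
    using similitude_diag[OF assms, of c]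
    by (simp add: GSp_diag_def diagonal_mat_def GSp_pos_mat monomial_def mat_index_eq_iff)
qed

text \<open>
  In the ordered basis every simple root, long or short, is the quotient of two consecutive diagonal
  entries.  For the long root this uses \<open>c (n - 1) * c n = \<mu>\<close>.
\<close>
lemma diag_char_simple_root:
  assumes "i \<in> {1..n}" "monomial_data n id c" "k \<noteq> 0"
  shows "diag_char n (simple_root n i) (pos_mat n (\<lambda>r p. k * monomial id c r p)) = c (i - 1) / c i"
proof -
  let ?A = "pos_mat n (\<lambda>r p. k * monomial id c r p)"
  have c: "p < 2 * n \<Longrightarrow> c p \<noteq> 0" for p using assms by (simp add: monomial_data_id)
  obtain \<mu> where \<mu>: "\<And>p q. Suc (p + q) = 2 * n \<Longrightarrow> c p * c q = \<mu>"
    using assms by (auto simp: monomial_data_id)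
  have A: "?A $$ (j - 1, j - 1) = k * c (j - 1)" if "j \<in> {1..n}" for j
  proof -
    have "j - 1 < 2 * n" "mat_index n (j - 1) = j - 1" using that by (auto simp: mat_index_def)
    then show ?thesis by (simp only: pos_mat_entry) (simp add: monomial_def)
  qed
  have pr: "(\<Prod>j = 1..n. ?A $$ (j - 1, j - 1) powi \<alpha> j) = (\<Prod>j = 1..n. (k * c (j - 1)) powi \<alpha> j)" for \<alpha>
    by (intro prod.cong refl) (simp only: A)
  show ?thesis
  proof (cases "i = n")
    case True
    have "(\<Prod>j = 1..n. (k * c (j - 1)) powi simple_root n i j) =
        (\<Prod>j = 1..n. if j = n then (k * c (n - 1)) powi 2 else 1)"
      by (intro prod.cong) (auto simp: True simple_root_def eps_def)
    also have "\<dots> = (k * c (n - 1)) powi 2" using assms by (subst prod.delta) auto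
    finally have p: "(\<Prod>j = 1..n. (k * c (j - 1)) powi simple_root n i j) = (k * c (n - 1))\<^sup>2"
      by (simp add: power_int_def)
    have "(\<Sum>j = 1..n. simple_root n i j) = (\<Sum>j = 1..n. if j = n then 2 else 0)"
      by (intro sum.cong) (auto simp: True simple_root_def eps_def)
    then have s: "(\<Sum>j = 1..n. simple_root n i j) = 2" using assms by simp
    have "?A $$ (0, 0) * ?A $$ (n, n) = k\<^sup>2 * (c 0 * c (2 * n - 1))"
    proof -
      have "?A $$ (0, 0) = k * c 0" "?A $$ (n, n) = k * c (2 * n - 1)"
        using assms by (auto simp: monomial_def mat_index_def)
      then show ?thesis by (simp add: power2_eq_square)
    qed
    also have "c 0 * c (2 * n - 1) = c (n - 1) * c n" 
      using \<mu>[of 0 "2 * n - 1"] \<mu>[of "n - 1" n] assms by auto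
    finally have m: "?A $$ (0, 0) * ?A $$ (n, n) = k\<^sup>2 * (c (n - 1) * c n)" .
    show ?thesis
      unfolding diag_char_def pr p s m using True assms c[of n] c[of "n - 1"]
      by (simp add: power_int_minus field_simps power2_eq_square)
  next
    case False
    have e: "simple_root n i j = (if j = i then 1 else if j = Suc i then - 1 else 0)" for j
      using False by (auto simp: simple_root_def eps_def)
    have "(\<Prod>j = 1..n. (k * c (j - 1)) powi simple_root n i j) =
        (\<Prod>j\<in>{i, Suc i}. (k * c (j - 1)) powi simple_root n i j)"
      using assms False by (intro prod.mono_neutral_right) (auto simp: e)
    then have p: "(\<Prod>j = 1..n. (k * c (j - 1)) powi simple_root n i j) = c (i - 1) / c i"
      using assms by (simp add: e power_int_minus divide_inverse)
    have "(\<Sum>j = 1..n. simple_root n i j) = (\<Sum>j\<in>{i, Suc i}. simple_root n i j)"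
      using assms False by (intro sum.mono_neutral_right) (auto simp: e)
    then have s: "(\<Sum>j = 1..n. simple_root n i j) = 0" by (simp add: e)
    show ?thesis unfolding diag_char_def pr p s by simp
  qed
qed

lemma diag_char_neg_root:
  assumes "even (\<Sum>j = 1..n. \<alpha> j)"
  shows "diag_char n (neg_root \<alpha>) A = inverse (diag_char n \<alpha> A)"
proof -
  have "(\<Sum>j = 1..n. neg_root \<alpha> j) div 2 = - ((\<Sum>j = 1..n. \<alpha> j) div 2)"
    using assms by (simp add: neg_root_def sum_negf dvd_neg_div)
  then show ?thesis
    unfolding diag_char_def by (simp add: neg_root_def power_int_minus prod_inversef[symmetric])
qed

lemma even_sum_simple_root: "i \<in> {1..n} \<Longrightarrow> even (\<Sum>j = 1..n. simple_root n i j)"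
proof -
  assume i: "i \<in> {1..n}"
  show ?thesis
  proof (cases "i = n")
    case True
    then show ?thesis by (simp add: simple_root_def dvd_sum)
  next
    case False
    have "(\<Sum>j = 1..n. simple_root n i j) = (\<Sum>j\<in>{i, Suc i}. simple_root n i j)"
      using i False by (intro sum.mono_neutral_right) (auto simp: simple_root_def eps_def)
    then show ?thesis using False by (simp add: simple_root_def eps_def)
  qed
qed

lemma simple_root_in_roots: 
  assumes "i \<in> {1..n}" shows "simple_root n i \<in> roots_C n" "neg_root (simple_root n i) \<in> roots_C n"
proof -
  have "\<exists>a b k l. simple_root n i = (\<lambda>j. a * eps k j + b * eps l j) \<and>
       a \<in> {1, -1} \<and> b \<in> {1, -1} \<and> k \<in> {1..n} \<and> l \<in> {1..n} \<and> k < l" if "i \<noteq> n"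
    using that assms by (intro exI[of _ 1] exI[of _ "-1"] exI[of _ i] exI[of _ "Suc i"]) 
      (simp add: simple_root_def)
  moreover have "\<exists>a b k l. neg_root (simple_root n i) = (\<lambda>j. a * eps k j + b * eps l j) \<and>
       a \<in> {1, -1} \<and> b \<in> {1, -1} \<and> k \<in> {1..n} \<and> l \<in> {1..n} \<and> k < l" if "i \<noteq> n"
    using that assms by (intro exI[of _ "-1"] exI[of _ "1"] exI[of _ i] exI[of _ "Suc i"]) 
      (simp add: simple_root_def neg_root_def)
  moreover have "\<exists>a k. simple_root n i = (\<lambda>j. a * 2 * eps k j) \<and> a \<in> {1, -1} \<and> k \<in> {1..n}" if "i = n"
    using that assms by (intro exI[of _ 1] exI[of _ n]) (simp add: simple_root_def)
  moreover have "\<exists>a k. neg_root (simple_root n i) = (\<lambda>j. a * 2 * eps k j) \<and> a \<in> {1, -1} \<and> k \<in> {1..n}" if "i = n"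
    using that assms by (intro exI[of _ "-1"] exI[of _ n]) (simp add: simple_root_def neg_root_def)
  ultimately show "simple_root n i \<in> roots_C n" "neg_root (simple_root n i) \<in> roots_C n"
    unfolding roots_C_def by (cases "i = n"; blast)+
qed

text \<open>
  The diagonal matrix with entries \<open>x ^ generic_weight n i p\<close> is a similitude, because the weights of
  mirror positions have a constant sum.  The weights are chosen such that the difference
  attained by the \<open>i\<close>-th simple root is attained by no other pair of positions than those of the
  root space.
\<close>
definition generic_weight :: "nat \<Rightarrow> nat \<Rightarrow> nat \<Rightarrow> nat" where
  "generic_weight n i p =
     (if i = n then (if Suc p = n then 2 else if p = n then 0 else 1)
      else if Suc p = i then 4 else if p = i then 1
      else if Suc (p + i) = 2 * n then 3 else if p + i = 2 * n then 0 else 2)"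

definition root_position :: "nat \<Rightarrow> nat \<Rightarrow> nat \<Rightarrow> nat \<Rightarrow> nat \<Rightarrow> bool" where
  "root_position n s t r p \<longleftrightarrow> (r = s \<and> p = t) \<or> (Suc (r + t) = 2 * n \<and> Suc (p + s) = 2 * n)"

text \<open>
  Conjugation by the generic diagonal matrix multiplies the entry at \<open>(r, p)\<close> by \<open>x\<close> to the difference
  of the weights of \<open>r\<close> and \<open>p\<close>, and no two exponents that occur give the same power of \<open>x\<close>.
\<close>
lemma root_space_support:
  fixes y :: "nat \<Rightarrow> nat \<Rightarrow> 'a::alg_closed_field"
  assumes i: "i \<in> {1..n}" 
    and Y: "\<And>A. A \<in> GSp_diag n \<Longrightarrow> A * pos_mat n y = diag_char n \<alpha> A \<cdot>\<^sub>m (pos_mat n y * A)"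
    and rp: "r < 2 * n" "p < 2 * n" "y r p \<noteq> 0"
  shows "\<alpha> = simple_root n i \<Longrightarrow> root_position n (i - 1) i r p"
    and "\<alpha> = neg_root (simple_root n i) \<Longrightarrow> root_position n i (i - 1) r p"
proof -
  obtain x :: 'a where x: "x \<noteq> 0" "\<And>d. d \<in> {1..8} \<Longrightarrow> x ^ d \<noteq> 1"
    by (rule alg_closed_exists_no_small_order) blast
  define c where "c p = x ^ generic_weight n i p" for p
  have mirror: "generic_weight n i p + generic_weight n i q = (if i = n then 2 else 4)" 
    if "Suc (p + q) = 2 * n" for p q
    using that i unfolding generic_weight_def by (auto split: if_splits)
  have "c p * c q = x ^ (if i = n then 2 else 4)" if "Suc (p + q) = 2 * n" for p q
    unfolding c_def power_add[symmetric] mirror[OF that] ..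
  then have c: "monomial_data n id c"
    unfolding monomial_data_id using x(1) by (auto simp: c_def)
  let ?A = "pos_mat n (monomial id c)"
  have A: "?A \<in> GSp_diag n" using GSp_diag_eq[of n] i c by auto
  have "?A * pos_mat n y = pos_mat n (\<lambda>r p. c r * y r p)"
    unfolding pos_mat_mult pos_mat_cong_iff pos_mult_def monomial_def
    by (auto simp: if_distrib[of "\<lambda>z. z * _"] cong: if_cong)
  moreover have "pos_mat n y * ?A = pos_mat n (\<lambda>r p. y r p * c p)"
    unfolding pos_mat_mult pos_mat_cong_iff pos_mult_def monomial_def
    by (auto simp: if_distrib[of "\<lambda>z. _ * z"] cong: if_cong)
  ultimately have "pos_mat n (\<lambda>r p. c r * y r p) = pos_mat n (\<lambda>r p. diag_char n \<alpha> ?A * (y r p * c p))"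
    using Y[OF A] by (simp only: pos_mat_smult)
  then have "c r * y r p = diag_char n \<alpha> ?A * (y r p * c p)"
    using rp unfolding pos_mat_cong_iff by blast
  then have eq: "c r = diag_char n \<alpha> ?A * c p" using rp by simp
  define h where "h = (if i = n then 2 else (3 :: nat))"
  have w: "generic_weight n i (i - 1) = generic_weight n i i + h"
    using i by (auto simp: generic_weight_def h_def)
  have root: "diag_char n (simple_root n i) ?A = x ^ h"
    using diag_char_simple_root[OF i c, of 1] x(1) unfolding c_def w power_add by simp
  have small: "generic_weight n i q + h \<le> 8" for q by (simp add: generic_weight_def h_def)
  have pos: "root_position n (i - 1) i s q" "root_position n i (i - 1) q s" 
    if "generic_weight n i s = generic_weight n i q + h" for s q
    using that i by (auto simp: generic_weight_def root_position_def h_def split: if_splits)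
  show "root_position n (i - 1) i r p" if "\<alpha> = simple_root n i"
  proof -
    have "x ^ generic_weight n i r = x ^ (generic_weight n i p + h)"
      using eq root that by (simp add: c_def power_add)
    then have "generic_weight n i r = generic_weight n i p + h"
      using power_eq_no_small_order[OF x, of 8] small[of r] small[of p] by simp
    then show ?thesis by (rule pos(1))
  qed
  show "root_position n i (i - 1) r p" if "\<alpha> = neg_root (simple_root n i)"
  proof -
    have "x ^ generic_weight n i p = x ^ (generic_weight n i r + h)"
      using eq root that even_sum_simple_root[OF i] x(1)
      by (simp add: c_def power_add diag_char_neg_root field_simps)
    then have "generic_weight n i p = generic_weight n i r + h"
      using power_eq_no_small_order[OF x, of 8] small[of r] small[of p] by simp
    then show ?thesis by (rule pos(2))
  qed
qed

text \<open>
  The element \<open>1 + Y\<close> of a root subgroup.  A short root occupies two mirrored entries with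
  opposite values, a long root only one entry.
\<close>
definition root_elem :: "nat \<Rightarrow> nat \<Rightarrow> nat \<Rightarrow> 'a::field \<Rightarrow> nat \<Rightarrow> nat \<Rightarrow> 'a" where
  "root_elem n s t y r p = (if r = p then 1 else 0) + (if r = s \<and> p = t then y else 0) +
     (if s < n \<and> t < n \<and> Suc (r + t) = 2 * n \<and> Suc (p + s) = 2 * n then - y else 0)"

text \<open>
  For a short root, evaluating the form on the column \<open>t\<close> and the mirror image of the column \<open>s\<close> gives
  the sum of the two entries of \<open>Y\<close>, which therefore vanishes.
\<close>
lemma similitude_root_elem:
  fixes y :: "nat \<Rightarrow> nat \<Rightarrow> 'a::field"
  assumes st: "(s < n \<and> t < n \<and> s \<noteq> t) \<or> Suc (s + t) = 2 * n"
    and supp: "\<And>r p. r < 2 * n \<Longrightarrow> p < 2 * n \<Longrightarrow> y r p \<noteq> 0 \<Longrightarrow> root_position n s t r p"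
    and sim: "similitude n (\<lambda>r p. pos_one r p + y r p) \<mu>"
    and rp: "r < 2 * n" "p < 2 * n"
  shows "pos_one r p + y r p = root_elem n s t (y s t) r p"
  using st
proof
  have supp0: "y r p = 0" if "r < 2 * n" "p < 2 * n" "\<not> root_position n s t r p" for r p
    using supp that by blast
  {
    assume st: "Suc (s + t) = 2 * n"
    then have "root_position n s t r p \<longleftrightarrow> r = s \<and> p = t" by (auto simp: root_position_def)
    then show ?thesis
      using supp0[OF rp] st by (auto simp: root_elem_def)
  next
    assume lt: "s < n \<and> t < n \<and> s \<noteq> t"
    define s' t' where "s' = 2 * n - 1 - s" and "t' = 2 * n - 1 - t"
    have s': "Suc (q + s) = 2 * n \<longleftrightarrow> q = s'" and t': "Suc (q + t) = 2 * n \<longleftrightarrow> q = t'" for q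
      using lt by (auto simp: s'_def t'_def)
    have ord: "n \<le> s'" "n \<le> t'" "s' < 2 * n" "t' < 2 * n" "s' \<noteq> t'" "s < n" "t < n" "s \<noteq> t"
      using lt by (auto simp: s'_def t'_def)
    have pos: "root_position n s t r p \<longleftrightarrow> (r = s \<and> p = t) \<or> (r = t' \<and> p = s')" for r p
      unfolding root_position_def s' t' ..
    let ?f = "\<lambda>r p. pos_one r p + y r p"
    have col: "?f r t = (if r = t then 1 else if r = s then y s t else 0)" if "r < 2 * n" for r
      using supp0[of r t] that ord by (auto simp: pos)
    have col': "?f r s' = (if r = s' then 1 else if r = t' then y t' s' else 0)" if "r < 2 * n" for r
      using supp0[of r s'] that ord by (auto simp: pos)
    have "(\<Sum>r<2 * n. pos_sign n r * ?f r t * ?f (2 * n - 1 - r) s') =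
        (\<Sum>r\<in>{t, s}. pos_sign n r * ?f r t * ?f (2 * n - 1 - r) s')"
    proof (intro sum.mono_neutral_right ballI)
      fix r assume "r \<in> {..<2 * n} - {t, s}"
      then have "?f r t = 0" using col[of r] by simp
      then show "pos_sign n r * ?f r t * ?f (2 * n - 1 - r) s' = 0" by (simp only: mult_zero_right mult_zero_left)
    qed (use ord in auto)
    also have "\<dots> = y t' s' + y s t"
    proof -
      have "2 * n - 1 - t = t'" "2 * n - 1 - s = s'" by (simp_all add: s'_def t'_def)
      moreover have "?f t t = 1" "?f s t = y s t" "?f t' s' = y t' s'" "?f s' s' = 1"
        using col[of t] col[of s] col'[of t'] col'[of s'] ord by simp_all
      moreover have "(\<Sum>r\<in>{t, s}. g r) = g t + g s" for g :: "nat \<Rightarrow> 'a" using ord by simp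
      moreover have "pos_sign n t = (1 :: 'a)" "pos_sign n s = (1 :: 'a)" using ord by (simp_all add: pos_sign_def)
      ultimately show ?thesis by (simp only: mult_1_left mult_1_right)
    qed
    finally have sum: "(\<Sum>r<2 * n. pos_sign n r * ?f r t * ?f (2 * n - 1 - r) s') = y t' s' + y s t" .
    have "t < 2 * n" "Suc (t + s') \<noteq> 2 * n" using ord s'[of t] s'[of s'] by (auto simp: s'_def)
    then have "y t' s' + y s t = 0"
      using sim ord(3) unfolding similitude_def sum[symmetric] by presburger
    then have y': "y t' s' = - y s t" by (simp add: eq_neg_iff_add_eq_0)
    have "y r p = (if r = s \<and> p = t then y s t else if r = t' \<and> p = s' then - y s t else 0)"
      using supp0[OF rp] y' ord unfolding pos by auto
    then show ?thesis
      using ord unfolding root_elem_def s' t' by auto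
  }
qed

lemma root_elem_mult:
  assumes "r < 2 * n" "s < 2 * n" "t < 2 * n"
  shows "pos_mult n (root_elem n s t y) f r p = f r p + (if r = s then y * f t p else 0) +
     (if s < n \<and> t < n \<and> Suc (r + t) = 2 * n then - y * f (2 * n - 1 - s) p else 0)"
proof -
  have "root_elem n s t y r q * f q p = (if q = r then f r p else 0) +
      (if q = t then (if r = s then y * f t p else 0) else 0) +
      (if q = 2 * n - 1 - s then (if s < n \<and> t < n \<and> Suc (r + t) = 2 * n then - y * f (2 * n - 1 - s) p else 0) else 0)"
     if "q < 2 * n" for q
  proof -
    have "Suc (q + s) = 2 * n \<longleftrightarrow> q = 2 * n - 1 - s" using that assms by auto
    then have "(if s < n \<and> t < n \<and> Suc (r + t) = 2 * n \<and> Suc (q + s) = 2 * n then - y else 0) * f q p =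
        (if q = 2 * n - 1 - s then (if s < n \<and> t < n \<and> Suc (r + t) = 2 * n then - y * f (2 * n - 1 - s) p else 0) else 0)"
      by auto
    moreover have "(if r = q then 1 else 0) * f q p = (if q = r then f r p else 0)"
      "(if r = s \<and> q = t then y else 0) * f q p = (if q = t then (if r = s then y * f t p else 0) else 0)"
      by auto
    ultimately show ?thesis unfolding root_elem_def distrib_right by (simp only:)
  qed
  then have "pos_mult n (root_elem n s t y) f r p = (\<Sum>q<2 * n. (if q = r then f r p else 0) +
      (if q = t then (if r = s then y * f t p else 0) else 0) +
      (if q = 2 * n - 1 - s then (if s < n \<and> t < n \<and> Suc (r + t) = 2 * n then - y * f (2 * n - 1 - s) p else 0) else 0))"
    unfolding pos_mult_def by (intro sum.cong) auto
  also have "\<dots> = f r p + (if r = s then y * f t p else 0) +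
     (if s < n \<and> t < n \<and> Suc (r + t) = 2 * n then - y * f (2 * n - 1 - s) p else 0)"
    unfolding sum.distrib using assms by (simp only: sum.delta finite_lessThan lessThan_iff) auto
  finally show ?thesis .
qed

definition sigma_coeff :: "nat \<Rightarrow> nat \<Rightarrow> 'a::field \<Rightarrow> nat \<Rightarrow> 'a" where
  "sigma_coeff n i y p =
     (if Suc p = i then - inverse y else if p = i then y
      else if Suc (p + i) = 2 * n then inverse y else if p + i = 2 * n then - y else 1)"

text \<open>
  This is the computation with the matrices \<open>[1, y; 0, 1]\<close> and \<open>[1, 0; z, 1]\<close>: in the product
  \<open>[1 + y z, y (2 + y z); z, 1 + y z]\<close> with \<open>z \<noteq> 0\<close> the first column has a single nonzero entry
  only if \<open>1 + y z = 0\<close>.  For a short root the mirrored pair of positions carries the same computation with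
  \<open>- y\<close> and \<open>- z\<close>.
\<close>
lemma sigma_product:
  fixes y z :: "'a::field"
  assumes i: "i \<in> {1..n}" and z: "z \<noteq> 0"
    and R: "R = pos_mult n (root_elem n (i - 1) i y) (pos_mult n (root_elem n i (i - 1) z) (root_elem n (i - 1) i y))"
    and mono: "\<And>p r s. p < 2 * n \<Longrightarrow> r < 2 * n \<Longrightarrow> s < 2 * n \<Longrightarrow> R r p \<noteq> 0 \<Longrightarrow> R s p \<noteq> 0 \<Longrightarrow> r = s"
  shows "y \<noteq> 0" "\<And>r p. r < 2 * n \<Longrightarrow> p < 2 * n \<Longrightarrow> R r p = monomial (srefl n i) (sigma_coeff n i y) r p"
proof -
  define j a where "j = i - 1" and "a = 2 * n - 1 - i"
  have j: "i = Suc j" and a: "Suc (i + a) = 2 * n" using i by (auto simp: j_def a_def)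
  have lt: "i < 2 * n" "j < 2 * n" "a < 2 * n" "j < n" using i a j by auto
  have mir: "Suc (r + i) = 2 * n \<longleftrightarrow> r = a" "Suc (r + j) = 2 * n \<longleftrightarrow> r = Suc a"
     "r + i = 2 * n \<longleftrightarrow> r = Suc a" "2 * n - 1 - i = a" "2 * n - 1 - j = Suc a" for r
    using a j by auto
  let ?E = "root_elem n j i y"
  have E: "?E r p = (if r = p then 1 else 0) + (if r = j \<and> p = i then y else 0) +
     (if i < n \<and> r = a \<and> p = Suc a then - y else 0)" for r p
    unfolding root_elem_def mir using lt by auto
  define F where "F = pos_mult n (root_elem n i j z) ?E"
  have F: "F r p = ?E r p + (if r = i then z * ?E j p else 0) + (if i < n \<and> r = Suc a then - z * ?E a p else 0)"
    if "r < 2 * n" for r p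
    unfolding F_def using root_elem_mult[OF that lt(1,2), of z ?E p] lt unfolding mir by auto
  have R': "R r p = F r p + (if r = j then y * F i p else 0) + (if i < n \<and> r = a then - y * F (Suc a) p else 0)"
    if "r < 2 * n" for r p
    unfolding R j_def[symmetric] F_def[symmetric] 
    using root_elem_mult[OF that lt(2,1), of y F p] lt unfolding mir by auto
  have dist: "i \<noteq> j" "j \<noteq> Suc a" "i \<noteq> a" using a j by presburger+
  have dist': "j \<noteq> a" "i \<noteq> Suc a" "Suc a < 2 * n" if "i < n" using a j that by auto
  have "R i j = z" "R j j = 1 + y * z"
    using lt dist dist' by (auto simp: R' F E)
  then have yz: "1 + y * z = 0" using mono[of j i j] z lt dist by auto
  then show y: "y \<noteq> 0" by auto
  have z': "z = - inverse y"
    using yz y by (metis add.commute add.inverse_inverse add_eq_0_iff inverse_unique minus_equation_iff mult_minus_right)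
  fix r p assume rp: "r < 2 * n" "p < 2 * n"
  have mon: "monomial (srefl n i) (sigma_coeff n i y) r p = 
    (if r = srefl n i p then (if p = j then z else if p = i then y else if p = a then - z else if p = Suc a then - y else 1) else 0)"
    unfolding monomial_def sigma_coeff_def mir using j z' by auto
  have srefl: "srefl n i p = (if p = j then i else if p = i then j else if p = a then Suc a else if p = Suc a then a else p)"
    unfolding srefl_def mir using j by auto
  have yz': "y * z = - 1" "z * y = - 1" using yz by (simp_all add: eq_neg_iff_add_eq_0 add.commute mult.commute)
  show "R r p = monomial (srefl n i) (sigma_coeff n i y) r p"
  proof (cases "i < n")
    case True
    note d = dist dist'[OF True]
    consider "r = j" | "r = i" | "r = a" | "r = Suc a" | "r \<notin> {j, i, a, Suc a}" by blast
    then show ?thesis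
    proof cases
      case 1
      have "R j p = ?E j p + y * (?E i p + z * ?E j p)" using d lt True by (simp add: R' F)
      also have "\<dots> = (1 + y * z) * ?E j p + y * ?E i p" by (simp add: algebra_simps)
      also have "\<dots> = (if p = i then y else 0)" unfolding E yz using d by auto
      finally show ?thesis unfolding mon srefl using 1 d by auto
    next
      case 2
      have "R i p = ?E i p + z * ?E j p" using d lt True by (simp add: R' F)
      also have "\<dots> = (if p = j then z else 0)" unfolding E using d yz' by auto
      finally show ?thesis unfolding mon srefl using 2 d by auto
    next
      case 3
      have "R a p = ?E a p - y * (?E (Suc a) p - z * ?E a p)" using d lt True by (simp add: R' F)
      also have "\<dots> = (1 + y * z) * ?E a p - y * ?E (Suc a) p" by (simp add: algebra_simps)
      also have "\<dots> = (if p = Suc a then - y else 0)" unfolding E yz using d by auto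
      finally show ?thesis unfolding mon srefl using 3 d by auto
    next
      case 4
      have "R (Suc a) p = ?E (Suc a) p - z * ?E a p" using d lt True by (simp add: R' F)
      also have "\<dots> = (if p = a then - z else 0)" unfolding E using d yz' True by auto
      finally show ?thesis unfolding mon srefl using 4 d by auto
    next
      case 5
      then have "R r p = ?E r p" using rp by (simp add: R' F)
      also have "\<dots> = (if p = r then 1 else 0)" unfolding E using 5 by auto
      also have "\<dots> = monomial (srefl n i) (sigma_coeff n i y) r p"
      proof (cases "p = r")
        case True
        then show ?thesis unfolding mon srefl using 5 by simp
      next
        case False
        then have "r \<noteq> srefl n i p" unfolding srefl using 5 by auto
        then show ?thesis using False by (simp add: monomial_def)
      qed
      finally show ?thesis .
    qed
  next
    case False
    then have n: "i = n" "a = j" using i a j by auto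
    consider "r = j" | "r = i" | "r \<notin> {j, i}" by blast
    then show ?thesis
    proof cases
      case 1
      have "R j p = ?E j p + y * (?E i p + z * ?E j p)" using dist lt False by (simp add: R' F)
      also have "\<dots> = (1 + y * z) * ?E j p + y * ?E i p" by (simp add: algebra_simps)
      also have "\<dots> = (if p = i then y else 0)" unfolding E yz using dist False by auto
      finally show ?thesis unfolding mon srefl using 1 dist n(2) j by auto
    next
      case 2
      have "R i p = ?E i p + z * ?E j p" using dist lt False by (simp add: R' F)
      also have "\<dots> = (if p = j then z else 0)" unfolding E using dist False yz' by auto
      finally show ?thesis unfolding mon srefl using 2 dist n(2) by auto
    next
      case 3
      then have "R r p = ?E r p" using rp False by (simp add: R' F)
      also have "\<dots> = (if p = r then 1 else 0)" unfolding E using 3 False by auto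
      finally show ?thesis unfolding mon srefl using 3 dist n(2) j a i by auto
    qed
  qed
qed

section \<open>Monomial coordinates on the normalizer of the torus\<close>

lemma monomial_data_comp:
  assumes "monomial_data n w c" "monomial_data n v d"
  shows "monomial_data n (w \<circ> v) (\<lambda>p. d p * c (v p))"
proof -
  have w: "signed_perm n w" and v: "signed_perm n v" using assms by (simp_all add: monomial_data_def)
  obtain \<mu> \<mu>' where \<mu>: "\<forall>p q. Suc (p + q) = 2 * n \<longrightarrow> c p * c q * (- 1) ^ (p + w p) = \<mu>"
     "\<forall>p q. Suc (p + q) = 2 * n \<longrightarrow> d p * d q * (- 1) ^ (p + v p) = \<mu>'"
    using assms unfolding monomial_data_def by metis
  show ?thesis
    unfolding monomial_data_def
  proof (intro conjI exI[of _ "\<mu> * \<mu>'"] allI impI signed_perm_comp w v)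
    fix p assume "p < 2 * n"
    then show "d p * c (v p) \<noteq> 0" using assms signed_perm_less[OF v] by (simp add: monomial_data_def)
  next
    fix p q assume pq: "Suc (p + q) = 2 * n"
    have "(- 1 :: 'a) ^ (p + (w \<circ> v) p) = (- 1) ^ (v p + w (v p)) * (- 1) ^ (p + v p)"
      by (simp add: power_add flip: power_mult_distrib mult.assoc)
    moreover have "c (v p) * c (v q) * (- 1) ^ (v p + w (v p)) = \<mu>"
      using \<mu>(1) signed_perm_mirror[OF v pq] by simp
    moreover have "d p * d q * (- 1) ^ (p + v p) = \<mu>'" using \<mu>(2) pq by simp
    ultimately show "d p * c (v p) * (d q * c (v q)) * (- 1) ^ (p + (w \<circ> v) p) = \<mu> * \<mu>'"
      by (simp add: mult_ac)
  qed
qed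

lemma monomial_data_tits_sign:
  assumes i: "i \<in> {1..n}"
  shows "monomial_data n (srefl n i) (tits_sign (srefl n i) :: nat \<Rightarrow> 'a::field)"
proof -
  obtain j where j: "i = Suc j" using i by (cases i) auto
  have "tits_sign (srefl n i) p * tits_sign (srefl n i) q * (- 1) ^ (p + srefl n i p) = (1 :: 'a)"
    if pq: "Suc (p + q) = 2 * n" for p q
  proof -
    have q: "q = i \<longleftrightarrow> Suc (p + i) = 2 * n" "q + i = 2 * n \<longleftrightarrow> Suc p = i" using pq by auto
    have "(- 1) ^ (p + srefl n i p) = (if Suc p = i \<or> p = i \<or> Suc (p + i) = 2 * n \<or> p + i = 2 * n then - 1 else (1 :: 'a))"
      using i by (auto simp: srefl_def simp flip: mult_2)
    then show ?thesis
      unfolding tits_sign_srefl[OF i] q using odd_neq_double[of j n] j by auto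
  qed
  then show ?thesis
    unfolding monomial_data_def using signed_perm_srefl[OF i]
    by (intro conjI exI[of _ 1]) (auto simp: tits_sign_srefl[OF i])
qed

text \<open>
  The product over mirror positions of the rescaling signs is \<open>(- 1) ^ p\<close> up to a sign that depends on
  the half of \<open>p\<close>; the factor \<open>- 1\<close> for steps between the halves compensates its change.
\<close>
lemma monomial_data_split_sign:
  assumes i: "i \<in> {1..n}"
  shows "monomial_data n (srefl n i) (split_sign n (srefl n i) :: nat \<Rightarrow> 'a::field)"
proof -
  have half: "half_sign n p * half_sign n q = ((- 1) ^ p * (if p < n then - 1 else 1) :: 'a)" 
    if "Suc (p + q) = 2 * n" for p q
  proof -
    have "even p \<longleftrightarrow> odd q" using that by presburger
    then have "(- 1 :: 'a) ^ q = - ((- 1) ^ p)" by (cases "even p") auto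
    moreover have "n \<le> q \<longleftrightarrow> p < n" using that by auto
    ultimately show ?thesis by (simp add: half_sign_def)
  qed
  have "split_sign n (srefl n i) p * split_sign n (srefl n i) q * (- 1) ^ (p + srefl n i p) = (1 :: 'a)"
    if pq: "Suc (p + q) = 2 * n" for p q
  proof -
    let ?s = "srefl n i"
    let ?e = "\<lambda>p. if n \<le> p \<and> ?s p < n then - 1 else (1 :: 'a)"
    have sq: "Suc (?s p + ?s q) = 2 * n" using srefl_mirror[OF i pq] .
    have one: "(- 1) ^ k * (- 1) ^ k = (1 :: 'a)" for k by (simp flip: power_mult_distrib)
    have "split_sign n ?s p * split_sign n ?s q * (- 1) ^ (p + ?s p) =
        (half_sign n p * half_sign n q) * (half_sign n (?s p) * half_sign n (?s q)) *
        (?e p * ?e q) * ((- 1) ^ p * (- 1) ^ ?s p)"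
      by (simp add: split_sign_def power_add mult_ac)
    also have "\<dots> = ((- 1) ^ p * (- 1) ^ p) * ((- 1) ^ ?s p * (- 1) ^ ?s p) * 
        ((if p < n then - 1 else 1) * (if ?s p < n then - 1 else 1) * (?e p * ?e q))"
      unfolding half[OF pq] half[OF sq] by (simp only: mult_ac)
    also have "\<dots> = (if p < n then - 1 else 1) * (if ?s p < n then - 1 else 1) * (?e p * ?e q)"
      by (simp only: one mult_1_left)
    also have "\<dots> = 1"
    proof -
      have "n \<le> q \<longleftrightarrow> p < n" "?s q < n \<longleftrightarrow> n \<le> ?s p" using pq sq by auto
      then show ?thesis by auto
    qed
    finally show ?thesis .
  qed
  moreover have "split_sign n (srefl n i) p \<noteq> (0 :: 'a)" for p
    by (simp add: split_sign_def half_sign_def)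
  ultimately show ?thesis
    unfolding monomial_data_def using signed_perm_srefl[OF i] by (intro conjI exI[of _ 1]) auto
qed

text \<open>
  All that is used about the group from here on: its normalizer consists of classes \<open>\<psi> w c\<close> of
  monomial matrices modulo scalars, the torus of those with \<open>w = id\<close>, and the elements \<open>\<sigma>_i\<close> carry the
  Tits signs.
\<close>
locale monomial_model = group G
  for G :: "('g, 'a::field) rooted_group" (structure) +
  fixes n :: nat and \<psi> :: "(nat \<Rightarrow> nat) \<Rightarrow> (nat \<Rightarrow> 'a) \<Rightarrow> 'g"
  assumes n_ge: "n \<ge> 6" and two_nz: "(2 :: 'a) \<noteq> 0"
    and psi_closed: "monomial_data n w c \<Longrightarrow> \<psi> w c \<in> carrier G"
    and psi_mult: "monomial_data n w c \<Longrightarrow> monomial_data n v d \<Longrightarrow>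
      \<psi> w c \<otimes> \<psi> v d = \<psi> (w \<circ> v) (\<lambda>p. d p * c (v p))"
    and psi_eq_iff: "monomial_data n w c \<Longrightarrow> monomial_data n v d \<Longrightarrow>
      \<psi> w c = \<psi> v d \<longleftrightarrow> w = v \<and> (\<exists>k. k \<noteq> 0 \<and> (\<forall>p < 2 * n. d p = k * c p))"
    and torus_eq: "torus G = {\<psi> id c | c. monomial_data n id c}"
    and normalizer_sub: "torus_normalizer G \<subseteq> {\<psi> w c | w c. monomial_data n w c}"
    and sigma_eq: "i \<in> {1..n} \<Longrightarrow> sigma G (simple_root n i) = \<psi> (srefl n i) (tits_sign (srefl n i))"
    and sigma_normalizer: "i \<in> {1..n} \<Longrightarrow> sigma G (simple_root n i) \<in> torus_normalizer G"
    and refl_eq: "i \<in> {1..n} \<Longrightarrow> simple_refl n G i = weyl_proj G (sigma G (simple_root n i))"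
    and root_char_eq: "i \<in> {1..n} \<Longrightarrow> monomial_data n id c \<Longrightarrow>
      root_char G (simple_root n i) (\<psi> id c) = c (i - 1) / c i"

locale adjoint_C = group G
  for G :: "('g, 'a::alg_closed_field) rooted_group" (structure) +
  fixes n :: nat and \<phi> :: "'g \<Rightarrow> 'a mat set"
  assumes n_ge: "n \<ge> 6" and two_nz: "(2 :: 'a) \<noteq> 0"
    and phi_iso: "\<phi> \<in> iso G (PGSp n)"
    and torus_phi: "torus G = {g \<in> carrier G. \<phi> g \<in> PGSp_class n ` GSp_diag n}"
    and root_subgroup_phi: "\<alpha> \<in> roots_C n \<Longrightarrow>
      root_subgroup G \<alpha> = {g \<in> carrier G. \<phi> g \<in> PGSp_root_subgroup n \<alpha>}"
    and root_char_phi: "\<alpha> \<in> roots_C n \<Longrightarrow> t \<in> torus G \<Longrightarrow> A \<in> \<phi> t \<Longrightarrow> root_char G \<alpha> t = diag_char n \<alpha> A"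
    and realized: "realization n G"
begin

lemma phi_mult: "g \<in> carrier G \<Longrightarrow> h \<in> carrier G \<Longrightarrow> \<phi> (g \<otimes> h) = \<phi> g \<otimes>\<^bsub>PGSp n\<^esub> \<phi> h"
  using phi_iso by (simp add: iso_def hom_def)

lemma phi_bij: "bij_betw \<phi> (carrier G) (carrier (PGSp n))"
  using phi_iso by (simp add: iso_def)

lemma phi_inj: "g \<in> carrier G \<Longrightarrow> h \<in> carrier G \<Longrightarrow> \<phi> g = \<phi> h \<Longrightarrow> g = h"
  using phi_bij by (auto simp: bij_betw_def inj_on_def)

lemma phi_pos_class:
  assumes "g \<in> carrier G" obtains f \<mu> where "similitude n f \<mu>" "\<phi> g = pos_class n f"
proof -
  have "\<phi> g \<in> carrier (PGSp n)" using phi_bij assms by (auto simp: bij_betw_def)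
  then show thesis using that by (auto simp: PGSp_carrier)
qed

definition lift :: "(nat \<Rightarrow> nat \<Rightarrow> 'a) \<Rightarrow> 'g" where
  "lift f = inv_into (carrier G) \<phi> (pos_class n f)"

lemma lift:
  assumes "similitude n f \<mu>"
  shows lift_closed: "lift f \<in> carrier G" and phi_lift: "\<phi> (lift f) = pos_class n f"
proof -
  have "pos_class n f \<in> \<phi> ` carrier G"
    using phi_bij assms by (auto simp: bij_betw_def PGSp_carrier)
  then show "lift f \<in> carrier G" "\<phi> (lift f) = pos_class n f"
    unfolding lift_def by (rule inv_into_into, rule f_inv_into_f)
qed

lemma diag_classes: 
  "PGSp_class n ` GSp_diag n = {pos_class n (monomial id c) | c. monomial_data n id (c :: nat \<Rightarrow> 'a)}"
  using GSp_diag_eq[of n] n_ge by (auto simp: pos_class_def)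

lemma torus_iff: 
  "g \<in> torus G \<longleftrightarrow> g \<in> carrier G \<and> (\<exists>c. monomial_data n id c \<and> \<phi> g = pos_class n (monomial id c))"
  unfolding torus_phi diag_classes by auto

lemma diag_mult_left: "r < 2 * n \<Longrightarrow> pos_mult n (monomial id c) f r p = c r * f r p"
proof -
  assume r: "r < 2 * n"
  have "pos_mult n (monomial id c) f r p = (\<Sum>s<2 * n. if s = r then c r * f r p else 0)"
    unfolding pos_mult_def by (intro sum.cong) (auto simp: monomial_def)
  then show ?thesis using r by simp
qed

lemma diag_mult_right: "p < 2 * n \<Longrightarrow> pos_mult n f (monomial id c) r p = f r p * c p"
proof -
  assume p: "p < 2 * n"
  have "pos_mult n f (monomial id c) r p = (\<Sum>s<2 * n. if s = p then f r p * c p else 0)"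
    unfolding pos_mult_def by (intro sum.cong) (auto simp: monomial_def)
  then show ?thesis using p by simp
qed

text \<open>
  Entries \<open>\<plusminus>1\<close> suffice, as \<open>1 \<noteq> - 1\<close>: for mirror positions the element that is \<open>1\<close> on the first half
  and \<open>- 1\<close> on the second half, otherwise the one that is \<open>- 1\<close> exactly at \<open>r\<close> and its mirror image.
\<close>
lemma torus_separates:
  assumes "r < 2 * n" "s < 2 * n" "r \<noteq> s"
  obtains d :: "nat \<Rightarrow> 'a" where "monomial_data n id d" "d r \<noteq> d s"
proof (cases "Suc (r + s) = 2 * n")
  case True
  have "monomial_data n id (\<lambda>p. if p < n then 1 else - 1 :: 'a)"
    unfolding monomial_data_id by (auto intro!: exI[of _ "- 1"])
  moreover have "(if r < n then 1 else - 1) \<noteq> (if s < n then 1 else - 1 :: 'a)"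
  proof -
    have "(1 :: 'a) \<noteq> - 1" using two_nz by (metis add.right_inverse one_add_one)
    then show ?thesis using True by auto
  qed
  ultimately show thesis by (rule that)
next
  case False
  let ?d = "\<lambda>p. if p = r \<or> Suc (p + r) = 2 * n then - 1 else (1 :: 'a)"
  have "?d p * ?d q = 1" if "Suc (p + q) = 2 * n" for p q
  proof -
    have "p = r \<or> Suc (p + r) = 2 * n \<longleftrightarrow> q = r \<or> Suc (q + r) = 2 * n" using that by auto
    then show ?thesis by simp
  qed
  then have "monomial_data n id ?d"
    unfolding monomial_data_id by (intro conjI exI[of _ 1]) auto
  moreover have "?d r \<noteq> ?d s"
  proof -
    have "(- 1 :: 'a) \<noteq> 1" using two_nz by (metis add.left_inverse one_add_one)
    then show ?thesis using False assms by (auto simp: add.commute)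
  qed
  ultimately show thesis by (rule that)
qed

text \<open>
  For every diagonal \<open>d\<close> there is a diagonal \<open>d'\<close> with \<open>f d' = d f\<close> up to a scalar, that is, \<open>d r\<close>
  depends only on the column \<open>p\<close> as long as \<open>f r p \<noteq> 0\<close>.
\<close>
lemma normalizer_monomial:
  assumes g: "g \<in> torus_normalizer G" and f: "\<phi> g = pos_class n f"
    and rsp: "r < 2 * n" "s < 2 * n" "p < 2 * n" "f r p \<noteq> 0" "f s p \<noteq> 0"
  shows "r = s"
proof (rule ccontr)
  assume "r \<noteq> s"
  obtain d :: "nat \<Rightarrow> 'a" where d: "monomial_data n id d" "d r \<noteq> d s"
    using torus_separates[OF rsp(1,2) \<open>r \<noteq> s\<close>] by blast
  have gc: "g \<in> carrier G" and norm: "g <# torus G #> inv g = torus G"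
    using g torus_phi by (auto simp: torus_normalizer_def normalizer_def stabilizer_def)
  obtain \<mu> where sim: "similitude n (monomial id d) \<mu>" 
    using similitude_diag[of n d] n_ge d by auto
  define t where "t = lift (monomial id d)"
  have t: "t \<in> torus G" "t \<in> carrier G" "\<phi> t = pos_class n (monomial id d)"
    using lift[OF sim] d by (auto simp: torus_iff t_def)
  then have "t \<in> g <# torus G #> inv g" using norm by simp
  then obtain t' where t': "t' \<in> torus G" "t = g \<otimes> t' \<otimes> inv g"
    by (auto simp: l_coset_def r_coset_def)
  then have "t' \<in> carrier G" by (simp add: torus_iff)
  with t' gc have "g \<otimes> t' = t \<otimes> g" by (simp add: m_assoc)
  moreover obtain d' where d': "\<phi> t' = pos_class n (monomial id d')" using t' torus_iff by auto
  ultimately have "pos_class n (pos_mult n f (monomial id d')) = pos_class n (pos_mult n (monomial id d) f)"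
    using phi_mult gc t \<open>t' \<in> carrier G\<close> f by (metis pos_class_mult)
  then obtain k where k: "\<forall>r < 2 * n. \<forall>p < 2 * n. pos_mult n (monomial id d) f r p = k * pos_mult n f (monomial id d') r p"
    unfolding pos_class_eq_iff by blast
  have key: "d q * f q p = k * (f q p * d' p)" if "q < 2 * n" for q
    using k that rsp by (simp add: diag_mult_left diag_mult_right)
  then have "d q = k * d' p" if "q < 2 * n" "f q p \<noteq> 0" for q
    using key[OF that(1)] that(2) by simp
  then show False using d(2) rsp by metis
qed

lemma normalizer_pos_class:
  assumes "g \<in> torus_normalizer G"
  obtains w m \<mu> where "signed_perm n w" "similitude n (monomial w m) \<mu>" "\<phi> g = pos_class n (monomial w m)"
proof -
  have "g \<in> carrier G" using assms by (simp add: torus_normalizer_def normalizer_def stabilizer_def)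
  then obtain f \<mu> where f: "similitude n f \<mu>" "\<phi> g = pos_class n f" by (rule phi_pos_class)
  then obtain w m where w: "signed_perm n w" "\<And>r p. r < 2 * n \<Longrightarrow> p < 2 * n \<Longrightarrow> f r p = monomial w m r p"
    using similitude_monomialI[OF f(1)] normalizer_monomial[OF assms f(2)] by metis
  have "pos_class n f = pos_class n (monomial w m)"
    unfolding pos_class_eq_iff using w by (intro exI[of _ 1]) simp
  moreover have "pos_mat n f = pos_mat n (monomial w m)" using w by (simp add: pos_mat_cong_iff)
  then have "\<exists>\<mu>. similitude n (monomial w m) \<mu>" using f GSp_pos_mat by metis
  ultimately show thesis using that w f by metis
qed

lemma root_subgroup_elem:
  assumes i: "i \<in> {1..n}"
  shows "u \<in> root_subgroup G (simple_root n i) \<Longrightarrow> \<exists>y. \<phi> u = pos_class n (root_elem n (i - 1) i y)"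
    and "u \<in> root_subgroup G (neg_root (simple_root n i)) \<Longrightarrow> \<exists>y. \<phi> u = pos_class n (root_elem n i (i - 1) y)"
proof -
  have *: "\<exists>y. \<phi> u = pos_class n (root_elem n s t y)"
    if u: "u \<in> root_subgroup G \<alpha>" and \<alpha>: "\<alpha> \<in> roots_C n"
      and st: "(s < n \<and> t < n \<and> s \<noteq> t) \<or> Suc (s + t) = 2 * n"
      and supp: "\<And>r p (y :: nat \<Rightarrow> nat \<Rightarrow> 'a). (\<And>A. A \<in> GSp_diag n \<Longrightarrow> A * pos_mat n y = diag_char n \<alpha> A \<cdot>\<^sub>m (pos_mat n y * A)) \<Longrightarrow>
         r < 2 * n \<Longrightarrow> p < 2 * n \<Longrightarrow> y r p \<noteq> 0 \<Longrightarrow> root_position n s t r p" for u \<alpha> s t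
  proof -
    obtain Y where Y: "\<phi> u = PGSp_class n (1\<^sub>m (2 * n) + Y)" "Y \<in> carrier_mat (2 * n) (2 * n)"
       "1\<^sub>m (2 * n) + Y \<in> carrier (GSp n)" "\<forall>A \<in> GSp_diag n. A * Y = diag_char n \<alpha> A \<cdot>\<^sub>m (Y * A)"
      using u root_subgroup_phi[OF \<alpha>] by (auto simp: PGSp_root_subgroup_def)
    obtain y where y: "Y = pos_mat n y" using Y(2) pos_mat_surj by blast
    let ?f = "\<lambda>r p. pos_one r p + y r p"
    have f: "1\<^sub>m (2 * n) + Y = pos_mat n ?f"
      unfolding y pos_mat_one pos_mat_add ..
    obtain \<mu> where sim: "similitude n ?f \<mu>" using Y(3) unfolding f GSp_pos_mat by blast
    have "?f r p = root_elem n s t (y s t) r p" if "r < 2 * n" "p < 2 * n" for r p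
      using similitude_root_elem[OF st _ sim that] supp Y(4) unfolding y by blast
    then have "pos_mat n ?f = pos_mat n (root_elem n s t (y s t))" by (simp add: pos_mat_cong_iff)
    then show ?thesis using Y(1) unfolding f by (auto simp: pos_class_def)
  qed
  show "u \<in> root_subgroup G (simple_root n i) \<Longrightarrow> \<exists>y. \<phi> u = pos_class n (root_elem n (i - 1) i y)"
    using i by (intro *[of u "simple_root n i"] simple_root_in_roots(1) root_space_support(1)[OF i]) auto
  show "u \<in> root_subgroup G (neg_root (simple_root n i)) \<Longrightarrow> \<exists>y. \<phi> u = pos_class n (root_elem n i (i - 1) y)"
    using i by (intro *[of u "neg_root (simple_root n i)"] simple_root_in_roots(2) root_space_support(2)[OF i]) auto
qed

lemma realizationD:
  assumes "\<alpha> \<in> roots_C n"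
  shows "bij_betw (root_hom G \<alpha>) UNIV (root_subgroup G \<alpha>)"
    "root_hom G \<alpha> (x + y) = root_hom G \<alpha> x \<otimes> root_hom G \<alpha> y"
    "sigma G \<alpha> \<in> torus_normalizer G" "weyl_proj G (sigma G \<alpha>) = reflection n G \<alpha>"
  using realized assms by (simp_all add: realization_def)

text \<open>
  The parameter \<open>z\<close> of \<open>u'(- 1)\<close> is nonzero, because \<open>u'\<close> is injective and additive.
\<close>
lemma sigma_pos_class:
  assumes i: "i \<in> {1..n}"
  shows "\<exists>y. y \<noteq> 0 \<and> \<phi> (sigma G (simple_root n i)) = pos_class n (monomial (srefl n i) (sigma_coeff n i y))"
proof -
  let ?\<alpha> = "simple_root n i"
  note rp = realizationD[OF simple_root_in_roots(1)[OF i]] 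
  note rn = realizationD[OF simple_root_in_roots(2)[OF i]]
  have up: "root_hom G ?\<alpha> x \<in> root_subgroup G ?\<alpha>" for x using rp(1) by (auto simp: bij_betw_def)
  have un: "root_hom G (neg_root ?\<alpha>) x \<in> root_subgroup G (neg_root ?\<alpha>)" for x using rn(1) by (auto simp: bij_betw_def)
  have cp: "root_hom G ?\<alpha> x \<in> carrier G" for x
    using up root_subgroup_phi[OF simple_root_in_roots(1)[OF i]] by blast
  have cn: "root_hom G (neg_root ?\<alpha>) x \<in> carrier G" for x
    using un root_subgroup_phi[OF simple_root_in_roots(2)[OF i]] by blast
  obtain y where y: "\<phi> (root_hom G ?\<alpha> 1) = pos_class n (root_elem n (i - 1) i y)"
    using root_subgroup_elem(1)[OF i up] by blast
  obtain z where z: "\<phi> (root_hom G (neg_root ?\<alpha>) (- 1)) = pos_class n (root_elem n i (i - 1) z)"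
    using root_subgroup_elem(2)[OF i un] by blast
  have z_nz: "z \<noteq> 0"
  proof
    assume "z = 0"
    let ?u = "root_hom G (neg_root ?\<alpha>) (- 1)"
    have one: "root_elem n s t 0 = (pos_one :: nat \<Rightarrow> nat \<Rightarrow> 'a)" for s t
      by (auto simp: root_elem_def fun_eq_iff)
    have "pos_mult n pos_one pos_one r p = (pos_one r p :: 'a)" if "r < 2 * n" for r p
      using diag_mult_left[OF that, of "\<lambda>_. 1" pos_one p] by (simp add: monomial_def[abs_def])
    then have "pos_class n (pos_mult n pos_one pos_one) = pos_class n (pos_one :: nat \<Rightarrow> nat \<Rightarrow> 'a)"
      unfolding pos_class_eq_iff by (intro exI[of _ 1]) auto
    then have "\<phi> (?u \<otimes> ?u) = \<phi> ?u"
      using z \<open>z = 0\<close> by (simp add: phi_mult cn pos_class_mult one)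
    then have "?u \<otimes> ?u = ?u" using cn by (intro phi_inj) auto
    moreover have "root_hom G (neg_root ?\<alpha>) 0 \<otimes> root_hom G (neg_root ?\<alpha>) 0 = root_hom G (neg_root ?\<alpha>) 0"
      using rn(2)[of 0 0] by simp
    ultimately have "root_hom G (neg_root ?\<alpha>) (- 1) = root_hom G (neg_root ?\<alpha>) 0"
      using cn by (metis l_cancel_one')
    then show False using rn(1) by (metis bij_betw_imp_inj_on injD neg_equal_0_iff_equal one_neq_zero)
  qed
  define R where "R = pos_mult n (root_elem n (i - 1) i y) (pos_mult n (root_elem n i (i - 1) z) (root_elem n (i - 1) i y))"
  have phi_R: "\<phi> (sigma G ?\<alpha>) = pos_class n R"
    unfolding sigma_def R_def using cp cn y z
    by (simp add: m_assoc phi_mult pos_class_mult)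
  have mono: "r = s" if "p < 2 * n" "r < 2 * n" "s < 2 * n" "R r p \<noteq> 0" "R s p \<noteq> 0" for p r s
    using normalizer_monomial[OF rp(3) phi_R that(2,3,1,4,5)] .
  have y_nz: "y \<noteq> 0"
    by (rule sigma_product(1)[OF i z_nz R_def]) (rule mono)
  have "R r p = monomial (srefl n i) (sigma_coeff n i y) r p" if "r < 2 * n" "p < 2 * n" for r p
    by (rule sigma_product(2)[OF i z_nz R_def _ that]) (rule mono)
  then have "pos_class n R = pos_class n (monomial (srefl n i) (sigma_coeff n i y))"
    unfolding pos_class_eq_iff by (intro exI[of _ 1]) simp
  then show ?thesis using y_nz phi_R by auto
qed

definition sigma_scale :: "nat \<Rightarrow> 'a" where
  "sigma_scale = (SOME y. \<forall>i \<in> {1..n}. y i \<noteq> 0 \<and>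
     \<phi> (sigma G (simple_root n i)) = pos_class n (monomial (srefl n i) (sigma_coeff n i (y i))))"

lemma sigma_scale:
  assumes "i \<in> {1..n}"
  shows "sigma_scale i \<noteq> 0"
    "\<phi> (sigma G (simple_root n i)) = pos_class n (monomial (srefl n i) (sigma_coeff n i (sigma_scale i)))"
proof -
  have "\<exists>y. \<forall>i \<in> {1..n}. y i \<noteq> 0 \<and>
     \<phi> (sigma G (simple_root n i)) = pos_class n (monomial (srefl n i) (sigma_coeff n i (y i)))"
    using sigma_pos_class by (intro bchoice) blast
  from someI_ex[OF this] show "sigma_scale i \<noteq> 0"
    "\<phi> (sigma G (simple_root n i)) = pos_class n (monomial (srefl n i) (sigma_coeff n i (sigma_scale i)))"
    using assms unfolding sigma_scale_def by blast+
qed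

text \<open>
  With the basis vectors scaled by these factors, the coefficients \<open>1 / y\<close> and \<open>y\<close> of all \<open>\<sigma>_i\<close> become
  the signs of the Tits lifts.  Each step along the positions prescribes one quotient, so that
  the factors are determined by the first one.
\<close>
fun basis_scale :: "nat \<Rightarrow> 'a" where
  "basis_scale 0 = 1"
| "basis_scale (Suc p) =
     (if Suc p \<le> n then - basis_scale p / sigma_scale (Suc p)
      else basis_scale p / sigma_scale (2 * n - Suc p))"

lemma basis_scale_nonzero: "p < 2 * n \<Longrightarrow> basis_scale p \<noteq> 0"
proof (induction p)
  case (Suc p)
  have "sigma_scale (2 * n - Suc p) \<noteq> 0" if "\<not> Suc p \<le> n"
    using that Suc.prems by (intro sigma_scale(1)) auto
  moreover have "sigma_scale (Suc p) \<noteq> 0" if "Suc p \<le> n"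
    using that by (intro sigma_scale(1)) auto
  ultimately show ?case using Suc by auto
qed simp

lemma basis_scale_low: "i \<in> {1..n} \<Longrightarrow> basis_scale i = - basis_scale (i - 1) / sigma_scale i"
  by (cases i) auto

lemma basis_scale_high: 
  "i \<in> {1..n} \<Longrightarrow> i \<noteq> n \<Longrightarrow> Suc (p + i) = 2 * n \<Longrightarrow> basis_scale (Suc p) = basis_scale p / sigma_scale i"
proof -
  assume "i \<in> {1..n}" "i \<noteq> n" "Suc (p + i) = 2 * n"
  then have "\<not> Suc p \<le> n" "2 * n - Suc p = i" by auto
  then show ?thesis by simp
qed

declare basis_scale.simps [simp del]

text \<open>
  When \<open>p\<close> moves up and \<open>q\<close> down by one, the two steps contribute the factors \<open>- 1 / y\<close> and \<open>y\<close>, so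
  that the product of the scaling factors changes its sign.  Hence the rescaling turns the standard
  form into a multiple of the form with the signs \<open>(- 1) ^ p\<close>.
\<close>
lemma basis_scale_mirror:
  "\<exists>\<nu>. \<nu> \<noteq> 0 \<and> (\<forall>p q. Suc (p + q) = 2 * n \<longrightarrow> basis_scale p * basis_scale q * pos_sign n p = \<nu> * (- 1) ^ p)"
proof -
  define \<nu> where "\<nu> = basis_scale 0 * basis_scale (2 * n - 1)"
  have nz: "\<nu> \<noteq> 0" using basis_scale_nonzero n_ge by (simp add: \<nu>_def)
  have low: "basis_scale p * basis_scale q = \<nu> * (- 1) ^ p" if "p < n" "Suc (p + q) = 2 * n" for p q
    using that
  proof (induction p arbitrary: q)
    case 0
    then have "q = 2 * n - 1" by simp
    then show ?case by (simp add: \<nu>_def)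
  next
    case (Suc p)
    have y: "sigma_scale (Suc p) \<noteq> 0" using Suc.prems sigma_scale(1)[of "Suc p"] by simp
    have "basis_scale p * basis_scale (Suc q) = \<nu> * (- 1) ^ p"
      using Suc.prems by (intro Suc.IH) auto
    moreover have "basis_scale (Suc p) = - basis_scale p / sigma_scale (Suc p)"
      using basis_scale_low[of "Suc p"] Suc.prems by simp
    moreover have "basis_scale (Suc q) = basis_scale q / sigma_scale (Suc p)"
      using Suc.prems by (intro basis_scale_high) auto
    ultimately show ?case by simp
  qed
  have "basis_scale p * basis_scale q * pos_sign n p = \<nu> * (- 1) ^ p" if "Suc (p + q) = 2 * n" for p q
  proof (cases "p < n")
    case True
    then show ?thesis using low[OF _ that] by (simp add: pos_sign_def)
  next
    case False
    then have "basis_scale q * basis_scale p = \<nu> * (- 1) ^ q" using low[of q p] that by auto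
    moreover have "(- 1 :: 'a) ^ q = - ((- 1) ^ p)"
    proof -
      have "even p \<longleftrightarrow> odd q" using that by presburger
      then show ?thesis by (cases "even p") auto
    qed
    ultimately show ?thesis using False by (simp add: pos_sign_def mult.commute)
  qed
  then show ?thesis using nz by blast
qed

definition scaled :: "(nat \<Rightarrow> nat) \<Rightarrow> (nat \<Rightarrow> 'a) \<Rightarrow> nat \<Rightarrow> 'a" where
  "scaled w c p = c p * basis_scale (w p) / basis_scale p"

lemma similitude_scaled:
  assumes w: "signed_perm n w"
  shows "(\<exists>\<mu>. similitude n (monomial w (scaled w c)) \<mu>) \<longleftrightarrow> monomial_data n w c"
proof -
  obtain \<nu> where \<nu>: "\<nu> \<noteq> 0" 
    "\<And>p q. Suc (p + q) = 2 * n \<Longrightarrow> basis_scale p * basis_scale q * pos_sign n p = \<nu> * (- 1) ^ p"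
    using basis_scale_mirror by blast
  have sgn: "pos_sign n p * pos_sign n p = (1 :: 'a)" "pos_sign n p \<noteq> (0 :: 'a)" for p
    by (auto simp: pos_sign_def)
  have key: "pos_sign n (w p) * scaled w c p * scaled w c q = (c p * c q * (- 1) ^ (p + w p)) * pos_sign n p"
    if pq: "Suc (p + q) = 2 * n" for p q
  proof -
    have bp: "basis_scale p * basis_scale q = \<nu> * (- 1) ^ p * pos_sign n p"
      using \<nu>(2)[OF pq] sgn(1)[of p] by (metis mult.assoc mult.right_neutral)
    have bw: "basis_scale (w p) * basis_scale (w q) * pos_sign n (w p) = \<nu> * (- 1) ^ w p"
      using \<nu>(2) signed_perm_mirror[OF w pq] by simp
    have nz: "basis_scale p * basis_scale q \<noteq> 0" using basis_scale_nonzero pq by simp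
    have "pos_sign n (w p) * scaled w c p * scaled w c q =
       c p * c q * (basis_scale (w p) * basis_scale (w q) * pos_sign n (w p)) / (basis_scale p * basis_scale q)"
      by (simp add: scaled_def field_simps)
    also have "\<dots> = c p * c q * (\<nu> * (- 1) ^ w p) / (\<nu> * (- 1) ^ p * pos_sign n p)"
      unfolding bp bw ..
    also have "\<dots> = (c p * c q * (- 1) ^ (p + w p)) * pos_sign n p"
    proof -
      have "(- 1 :: 'a) ^ p * (- 1) ^ p = 1" by (simp flip: power_mult_distrib)
      then have "inverse ((- 1 :: 'a) ^ p) = (- 1) ^ p" "inverse (pos_sign n p) = (pos_sign n p :: 'a)"
        using sgn(1)[of p] by (auto intro: inverse_unique)
      then show ?thesis using \<nu>(1) by (simp add: divide_inverse power_add mult_ac)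
    qed
    finally show ?thesis .
  qed
  have "(\<exists>\<mu>. similitude n (monomial w (scaled w c)) \<mu>) \<longleftrightarrow>
     (\<exists>\<mu>. \<mu> \<noteq> 0 \<and> (\<forall>p q. Suc (p + q) = 2 * n \<longrightarrow> c p * c q * (- 1) ^ (p + w p) = \<mu>))"
    unfolding similitude_monomial[OF w] using key sgn by (simp cong: conj_cong imp_cong)
  also have "\<dots> \<longleftrightarrow> monomial_data n w c"
    unfolding monomial_data_def
  proof safe
    fix \<mu> p assume \<mu>: "\<mu> \<noteq> 0" "\<forall>p q. Suc (p + q) = 2 * n \<longrightarrow> c p * c q * (- 1) ^ (p + w p) = \<mu>" "p < 2 * n" "c p = 0"
    moreover have "Suc (p + (2 * n - 1 - p)) = 2 * n" using \<mu>(3) by simp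
    ultimately show False by (metis mult_zero_left)
  next
    fix \<mu> assume c: "\<forall>p < 2 * n. c p \<noteq> 0" 
      and m: "\<forall>p q. Suc (p + q) = 2 * n \<longrightarrow> c p * c q * (- 1) ^ (p + w p) = \<mu>"
    have "Suc (0 + (2 * n - 1)) = 2 * n" using n_ge by simp
    then have "c 0 * c (2 * n - 1) * (- 1) ^ (0 + w 0) = \<mu>" using m by blast
    moreover have "c 0 * c (2 * n - 1) \<noteq> 0" using c n_ge by simp
    ultimately have "\<mu> \<noteq> 0" by auto
    then show "\<exists>\<mu>. \<mu> \<noteq> 0 \<and> (\<forall>p q. Suc (p + q) = 2 * n \<longrightarrow> c p * c q * (- 1) ^ (p + w p) = \<mu>)" using m by blast
  qed (use w in auto)
  finally show ?thesis .
qed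

definition coord :: "(nat \<Rightarrow> nat) \<Rightarrow> (nat \<Rightarrow> 'a) \<Rightarrow> 'g" where
  "coord w c = lift (monomial w (scaled w c))"

lemma coord:
  assumes "monomial_data n w c"
  shows coord_closed: "coord w c \<in> carrier G"
    and phi_coord: "\<phi> (coord w c) = pos_class n (monomial w (scaled w c))"
proof -
  have "signed_perm n w" using assms by (simp add: monomial_data_def)
  then obtain \<mu> where "similitude n (monomial w (scaled w c)) \<mu>" using similitude_scaled assms by blast
  then show "coord w c \<in> carrier G" "\<phi> (coord w c) = pos_class n (monomial w (scaled w c))"
    unfolding coord_def by (rule lift)+
qed

lemma scaled_id: "p < 2 * n \<Longrightarrow> scaled id c p = c p"
  using basis_scale_nonzero by (simp add: scaled_def)

lemma phi_coord_id:
  assumes "monomial_data n id c" shows "\<phi> (coord id c) = pos_class n (monomial id c)"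
  unfolding phi_coord[OF assms] pos_class_eq_iff
  by (intro exI[of _ 1]) (auto simp: monomial_def scaled_id)

lemma coord_mult:
  assumes wc: "monomial_data n w c" and vd: "monomial_data n v d"
  shows "coord w c \<otimes> coord v d = coord (w \<circ> v) (\<lambda>p. d p * c (v p))"
proof -
  have w: "signed_perm n w" and v: "signed_perm n v" using assms by (simp_all add: monomial_data_def)
  have lt: "v p < 2 * n" if "p < 2 * n" for p using signed_perm_less[OF v that] .
  have eq: "pos_mult n (monomial w (scaled w c)) (monomial v (scaled v d)) r p =
      monomial (w \<circ> v) (scaled (w \<circ> v) (\<lambda>p. d p * c (v p))) r p" if "p < 2 * n" for r p
    unfolding monomial_mult[OF v that] using basis_scale_nonzero lt[OF that] that
    by (simp add: monomial_def scaled_def)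
  note wv = coord[OF monomial_data_comp[OF wc vd]]
  have "\<phi> (coord w c \<otimes> coord v d) = \<phi> (coord (w \<circ> v) (\<lambda>p. d p * c (v p)))"
    unfolding phi_mult[OF coord_closed[OF wc] coord_closed[OF vd]] wv(2)
      phi_coord[OF wc] phi_coord[OF vd] pos_class_mult pos_class_eq_iff
    by (intro exI[of _ 1]) (simp add: eq)
  then show ?thesis using coord_closed[OF wc] coord_closed[OF vd] wv(1) by (intro phi_inj) auto
qed

lemma coord_eq_iff:
  assumes wc: "monomial_data n w c" and vd: "monomial_data n v d"
  shows "coord w c = coord v d \<longleftrightarrow> w = v \<and> (\<exists>k. k \<noteq> 0 \<and> (\<forall>p < 2 * n. d p = k * c p))"
proof -
  have w: "signed_perm n w" and v: "signed_perm n v" using assms by (simp_all add: monomial_data_def)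
  have cd: "c p \<noteq> 0" "d p \<noteq> 0" "basis_scale p \<noteq> 0" if "p < 2 * n" for p 
    using assms that basis_scale_nonzero by (simp_all add: monomial_data_def)
  have ratio: "scaled w d p = k * scaled w c p \<longleftrightarrow> d p = k * c p" if "p < 2 * n" for k p
    using cd[OF that] cd(3)[OF signed_perm_less[OF w that]] by (simp add: scaled_def)
  have "coord w c = coord v d \<longleftrightarrow> \<phi> (coord w c) = \<phi> (coord v d)"
    using phi_inj coord_closed assms by metis
  also have "\<dots> \<longleftrightarrow> (\<exists>k. k \<noteq> 0 \<and> (\<forall>r < 2 * n. \<forall>p < 2 * n. monomial v (scaled v d) r p = k * monomial w (scaled w c) r p))"
    unfolding phi_coord[OF wc] phi_coord[OF vd] pos_class_eq_iff ..
  also have "\<dots> \<longleftrightarrow> w = v \<and> (\<exists>k. k \<noteq> 0 \<and> (\<forall>p < 2 * n. d p = k * c p))"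
  proof
    assume "\<exists>k. k \<noteq> 0 \<and> (\<forall>r < 2 * n. \<forall>p < 2 * n. monomial v (scaled v d) r p = k * monomial w (scaled w c) r p)"
    then obtain k where k: "k \<noteq> 0" 
      "\<And>r p. r < 2 * n \<Longrightarrow> p < 2 * n \<Longrightarrow> monomial v (scaled v d) r p = k * monomial w (scaled w c) r p"
      by blast
    have "w p = v p" for p
    proof (cases "p < 2 * n")
      case True
      have "scaled v d p \<noteq> 0"
        using cd[OF True] cd(3)[OF signed_perm_less[OF v True]] by (simp add: scaled_def)
      then have "monomial w (scaled w c) (v p) p \<noteq> 0"
        using k(2)[OF signed_perm_less[OF v True] True] by (auto simp: monomial_def)
      then show ?thesis by (auto simp: monomial_def split: if_splits)
    next
      case False
      then show ?thesis using signed_perm_outside[OF w, of p] signed_perm_outside[OF v, of p] by simp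
    qed
    then have wv: "w = v" by blast
    have "d p = k * c p" if "p < 2 * n" for p
      using k(2)[OF signed_perm_less[OF w that] that] ratio[OF that] unfolding wv[symmetric] by (simp add: monomial_def)
    then show "w = v \<and> (\<exists>k. k \<noteq> 0 \<and> (\<forall>p < 2 * n. d p = k * c p))" using wv k by blast
  next
    assume "w = v \<and> (\<exists>k. k \<noteq> 0 \<and> (\<forall>p < 2 * n. d p = k * c p))"
    then show "\<exists>k. k \<noteq> 0 \<and> (\<forall>r < 2 * n. \<forall>p < 2 * n. monomial v (scaled v d) r p = k * monomial w (scaled w c) r p)"
      using ratio by (auto simp: monomial_def)
  qed
  finally show ?thesis .
qed

lemma sigma_coeff_scaled:
  assumes i: "i \<in> {1..n}" and p: "p < 2 * n"
  shows "sigma_coeff n i (sigma_scale i) p = scaled (srefl n i) (tits_sign (srefl n i)) p"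
proof -
  obtain j where j: "i = Suc j" using i by (cases i) auto
  have y: "sigma_scale i \<noteq> 0" using sigma_scale(1)[OF i] .
  have bi: "basis_scale i = - basis_scale j / sigma_scale i" using basis_scale_low[OF i] j by simp
  have ts: "tits_sign (srefl n i) p = (if p = i \<or> p + i = 2 * n then - 1 else 1 :: 'a)"
    by (rule tits_sign_srefl[OF i])
  have nz: "basis_scale q \<noteq> 0" if "q < 2 * n" for q using basis_scale_nonzero[OF that] .
  consider "p = j" | "p = i" | "Suc (p + i) = 2 * n" "p \<noteq> i" "p \<noteq> j" | "p + i = 2 * n" "p \<noteq> i" "p \<noteq> j" 
    | "p \<noteq> j" "p \<noteq> i" "Suc (p + i) \<noteq> 2 * n" "p + i \<noteq> 2 * n" by blast
  then show ?thesis
  proof cases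
    case 1
    then have "tits_sign (srefl n i) p = (1 :: 'a)" "srefl n i p = i"
      unfolding ts using j i odd_neq_double[of j n] by auto
    then show ?thesis using 1 j y nz[OF p] bi by (simp add: sigma_coeff_def scaled_def field_simps)
  next
    case 2
    then have "tits_sign (srefl n i) p = (- 1 :: 'a)" "srefl n i p = j"
      unfolding ts using j by auto
    then show ?thesis using 2 j y nz[of j] nz[OF p] p bi by (simp add: sigma_coeff_def scaled_def field_simps)
  next
    case 3
    then have s: "tits_sign (srefl n i) p = (1 :: 'a)" "srefl n i p = Suc p"
      unfolding ts using j by (auto simp: srefl_def)
    have "i \<noteq> n" using 3 j by auto
    then have "basis_scale (Suc p) = basis_scale p / sigma_scale i" using i 3 by (intro basis_scale_high)
    then show ?thesis using 3 s j y nz[OF p] by (simp add: sigma_coeff_def scaled_def field_simps)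
  next
    case 4
    then obtain q where q: "p = Suc q" using p i by (cases p) auto
    have s: "tits_sign (srefl n i) p = (- 1 :: 'a)" "srefl n i p = q"
      unfolding ts using 4 j q by (auto simp: srefl_def)
    have "i \<noteq> n" using 4 by auto
    then have "basis_scale p = basis_scale q / sigma_scale i" unfolding q using i 4 q by (intro basis_scale_high) auto
    then have "basis_scale q = sigma_scale i * basis_scale p" using y by simp
    then show ?thesis using 4 s j nz[OF p] by (simp add: sigma_coeff_def scaled_def)
  next
    case 5
    then have "tits_sign (srefl n i) p = (1 :: 'a)" "srefl n i p = p"
      unfolding ts using j by (auto simp: srefl_def)
    then show ?thesis using 5 j nz[OF p] by (simp add: sigma_coeff_def scaled_def)
  qed
qed

lemma monomial_model: "monomial_model G n coord"
proof (unfold_locales)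
  show "6 \<le> n" "(2 :: 'a) \<noteq> 0" by (rule n_ge, rule two_nz)
  show "monomial_data n w c \<Longrightarrow> coord w c \<in> carrier G" for w c by (rule coord_closed)
  show "monomial_data n w c \<Longrightarrow> monomial_data n v d \<Longrightarrow>
      coord w c \<otimes> coord v d = coord (w \<circ> v) (\<lambda>p. d p * c (v p))" for w c v d by (rule coord_mult)
  show "monomial_data n w c \<Longrightarrow> monomial_data n v d \<Longrightarrow>
      coord w c = coord v d \<longleftrightarrow> w = v \<and> (\<exists>k. k \<noteq> 0 \<and> (\<forall>p < 2 * n. d p = k * c p))" for w c v d
    by (rule coord_eq_iff)
  show "torus G = {coord id c | c. monomial_data n id c}"
  proof (intro subset_antisym subsetI)
    fix g assume g: "g \<in> torus G"
    then obtain c where c: "monomial_data n id c" "\<phi> g = pos_class n (monomial id c)" "g \<in> carrier G"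
      using torus_iff by blast
    then have "g = coord id c" using phi_inj coord_closed phi_coord_id by metis
    then show "g \<in> {coord id c | c. monomial_data n id c}" using c by blast
  next
    fix g assume "g \<in> {coord id c | c. monomial_data n id c}"
    then show "g \<in> torus G" using torus_iff coord_closed phi_coord_id by blast
  qed
  show "torus_normalizer G \<subseteq> {coord w c | w c. monomial_data n w c}"
  proof
    fix g assume g: "g \<in> torus_normalizer G"
    then obtain w m \<mu> where wm: "signed_perm n w" "similitude n (monomial w m) \<mu>" "\<phi> g = pos_class n (monomial w m)"
      by (rule normalizer_pos_class)
    define c where "c p = m p * basis_scale p / basis_scale (w p)" for p
    have m: "scaled w c p = m p" if "p < 2 * n" for p
      using basis_scale_nonzero that signed_perm_less[OF wm(1) that] by (simp add: scaled_def c_def)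
    have "pos_mat n (monomial w (scaled w c)) = pos_mat n (monomial w m)"
      unfolding pos_mat_cong_iff by (simp add: monomial_def m)
    then have "\<exists>\<mu>. similitude n (monomial w (scaled w c)) \<mu>" using wm(2) GSp_pos_mat by metis
    then have c: "monomial_data n w c" using similitude_scaled[OF wm(1)] by blast
    have "\<phi> (coord w c) = \<phi> g"
      unfolding phi_coord[OF c] wm(3) pos_class_eq_iff by (intro exI[of _ 1]) (simp add: monomial_def m)
    moreover have "g \<in> carrier G" using g by (simp add: torus_normalizer_def normalizer_def stabilizer_def)
    ultimately have "g = coord w c" using phi_inj coord_closed[OF c] by metis
    then show "g \<in> {coord w c | w c. monomial_data n w c}" using c by blast
  qed
  fix i assume i: "i \<in> {1..n}"
  note r = realizationD[OF simple_root_in_roots(1)[OF i]]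
  show "sigma G (simple_root n i) \<in> torus_normalizer G" by (rule r(3))
  then have "sigma G (simple_root n i) \<in> carrier G" by (simp add: torus_normalizer_def normalizer_def stabilizer_def)
  moreover have "\<phi> (sigma G (simple_root n i)) = \<phi> (coord (srefl n i) (tits_sign (srefl n i)))"
    unfolding sigma_scale(2)[OF i] phi_coord[OF monomial_data_tits_sign[OF i]] pos_class_eq_iff
    by (intro exI[of _ 1]) (simp add: monomial_def sigma_coeff_scaled[OF i])
  ultimately show "sigma G (simple_root n i) = coord (srefl n i) (tits_sign (srefl n i))"
    using coord_closed[OF monomial_data_tits_sign[OF i]] by (intro phi_inj)
  show "simple_refl n G i = weyl_proj G (sigma G (simple_root n i))"
    unfolding simple_refl_def using r(4) by simp
  fix c :: "nat \<Rightarrow> 'a" assume c: "monomial_data n id c"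
  have t: "coord id c \<in> torus G" using torus_iff coord_closed phi_coord_id c by blast
  have "pos_mat n (\<lambda>r p. 1 * monomial id c r p) \<in> \<phi> (coord id c)"
    unfolding phi_coord_id[OF c] using pos_mat_in_class[of n "monomial id c"] by simp
  then have "root_char G (simple_root n i) (coord id c) = diag_char n (simple_root n i) (pos_mat n (\<lambda>r p. 1 * monomial id c r p))"
    by (rule root_char_phi[OF simple_root_in_roots(1)[OF i] t])
  then show "root_char G (simple_root n i) (coord id c) = c (i - 1) / c i"
    using diag_char_simple_root[OF i c, of 1] by simp
qed

end

lemma monomial_model_exists:
  fixes G :: "('g, 'a::alg_closed_field) rooted_group"
  assumes "n \<ge> 6" "(2 :: 'a) \<noteq> 0" "adjoint_type_C n G" "realization n G"
  obtains \<psi> where "monomial_model G n \<psi>"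
proof -
  from assms(3) obtain \<phi> where "group G" "\<phi> \<in> iso G (PGSp n)"
    "torus G = {g \<in> carrier G. \<phi> g \<in> PGSp_class n ` GSp_diag n}"
    "\<And>\<alpha>. \<alpha> \<in> roots_C n \<Longrightarrow> root_subgroup G \<alpha> = {g \<in> carrier G. \<phi> g \<in> PGSp_root_subgroup n \<alpha>}"
    "\<And>\<alpha> t A. \<alpha> \<in> roots_C n \<Longrightarrow> t \<in> torus G \<Longrightarrow> A \<in> \<phi> t \<Longrightarrow> root_char G \<alpha> t = diag_char n \<alpha> A"
    unfolding adjoint_type_C_def by blast
  then interpret adjoint_C G n \<phi>
    using assms by (auto simp: adjoint_C_def adjoint_C_axioms_def)
  show thesis using that monomial_model .
qed

context monomial_model
begin

section \<open>The Weyl group and its reduced words\<close>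

abbreviation (input) T where "T \<equiv> torus G"
abbreviation (input) N where "N \<equiv> torus_normalizer G"

definition \<sigma> :: "nat \<Rightarrow> 'g" where "\<sigma> i = sigma G (simple_root n i)"

lemma monomial_data_one: "monomial_data n id (\<lambda>_. 1)"
  by (simp add: monomial_data_id)

lemma monomial_data_cong:
  assumes "monomial_data n w c" "\<And>p. p < 2 * n \<Longrightarrow> d p = c p"
  shows "monomial_data n w d"
proof -
  obtain \<mu> where "\<forall>p q. Suc (p + q) = 2 * n \<longrightarrow> c p * c q * (- 1) ^ (p + w p) = \<mu>"
    using assms(1) unfolding monomial_data_def by blast
  then have "d p * d q * (- 1) ^ (p + w p) = \<mu>" if "Suc (p + q) = 2 * n" for p q
    using that assms(2)[of p] assms(2)[of q] by simp
  then show ?thesis using assms unfolding monomial_data_def by auto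
qed

lemma monomial_dataD: "monomial_data n w c \<Longrightarrow> signed_perm n w" 
  "monomial_data n w c \<Longrightarrow> p < 2 * n \<Longrightarrow> c p \<noteq> 0"
  by (simp_all add: monomial_data_def)

lemma psi_one: "\<psi> id (\<lambda>_. 1) = \<one>"
proof -
  have "\<psi> id (\<lambda>_. 1) \<otimes> \<psi> id (\<lambda>_. 1) = \<psi> id (\<lambda>_. 1)"
    using psi_mult[OF monomial_data_one monomial_data_one] by simp
  then show ?thesis using psi_closed[OF monomial_data_one] by (simp add: l_cancel_one')
qed

lemma psi_cong: 
  "monomial_data n w c \<Longrightarrow> monomial_data n w d \<Longrightarrow> (\<And>p. p < 2 * n \<Longrightarrow> c p = d p) \<Longrightarrow> \<psi> w c = \<psi> w d"
  by (subst psi_eq_iff) (auto intro!: exI[of _ 1])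

lemma psi_torus: "monomial_data n id c \<Longrightarrow> \<psi> id c \<in> T"
  using torus_eq by blast

lemma torusE: 
  assumes "t \<in> T" obtains c where "monomial_data n id c" "t = \<psi> id c"
  using assms torus_eq by blast

lemma monomial_data_divide:
  assumes "monomial_data n w c" "monomial_data n w d"
  shows "monomial_data n id (\<lambda>p. c p / d p)"
proof -
  obtain \<mu> \<mu>' where \<mu>: "\<forall>p q. Suc (p + q) = 2 * n \<longrightarrow> c p * c q * (- 1) ^ (p + w p) = \<mu>"
     "\<forall>p q. Suc (p + q) = 2 * n \<longrightarrow> d p * d q * (- 1) ^ (p + w p) = \<mu>'"
    using assms unfolding monomial_data_def by metis
  have "c p / d p * (c q / d q) = \<mu> / \<mu>'" if "Suc (p + q) = 2 * n" for p q
  proof -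
    have "\<mu> / \<mu>' = (c p * c q * (- 1) ^ (p + w p)) / (d p * d q * (- 1) ^ (p + w p))"
      using \<mu> that by simp
    then show ?thesis by simp
  qed
  then show ?thesis using assms unfolding monomial_data_id by (auto simp: monomial_data_def)
qed

lemma psi_torus_right:
  assumes "monomial_data n w c" "monomial_data n w d"
  shows "\<psi> w c = \<psi> w d \<otimes> \<psi> id (\<lambda>p. c p / d p)"
proof -
  note q = monomial_data_divide[OF assms]
  have "\<psi> w d \<otimes> \<psi> id (\<lambda>p. c p / d p) = \<psi> w (\<lambda>p. c p / d p * d p)"
    using psi_mult[OF assms(2) q] by simp
  also have "\<dots> = \<psi> w c"
    using monomial_data_comp[OF assms(2) q] assms by (intro psi_cong) (auto dest: monomial_dataD)
  finally show ?thesis by simp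
qed

lemma torus_subgroup: "subgroup T G"
proof (rule subgroupI)
  show "T \<subseteq> carrier G" using torus_eq psi_closed by auto
  show "T \<noteq> {}" using psi_torus[OF monomial_data_one] by blast
next
  fix a assume "a \<in> T"
  then obtain c where c: "monomial_data n id c" "a = \<psi> id c" by (rule torusE)
  have d: "monomial_data n id (\<lambda>p. 1 / c p)" by (rule monomial_data_divide[OF monomial_data_one c(1)])
  have "\<psi> id (\<lambda>p. 1 / c p) \<otimes> a = \<psi> id (\<lambda>p. c p * (1 / c p))"
    using psi_mult[OF d c(1)] c(2) by simp
  also have "\<dots> = \<psi> id (\<lambda>_. 1)"
  proof (rule psi_cong[OF _ monomial_data_one])
    show "monomial_data n id (\<lambda>p. c p * (1 / c p))"
      using monomial_data_comp[OF d c(1)] unfolding comp_id id_apply .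
  qed (use monomial_dataD(2)[OF c(1)] in simp)
  finally have "\<psi> id (\<lambda>p. 1 / c p) \<otimes> a = \<one>" by (simp only: psi_one)
  then have "inv a = \<psi> id (\<lambda>p. 1 / c p)"
    using inv_equality psi_closed[OF c(1)] psi_closed[OF d] unfolding c(2) by blast
  then show "inv a \<in> T" using psi_torus[OF d] by simp
next
  fix a b assume "a \<in> T" "b \<in> T"
  then obtain c d where "monomial_data n id c" "a = \<psi> id c" "monomial_data n id d" "b = \<psi> id d"
    by (meson torusE)
  then show "a \<otimes> b \<in> T"
    using psi_mult[of id c id d] psi_torus monomial_data_comp[of n id c id d] by (simp only: comp_id)
qed

lemma torus_carrier: "t \<in> T \<Longrightarrow> t \<in> carrier G"
  using torus_subgroup subgroup.mem_carrier by metis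

lemma normalizer_subgroup: "subgroup N G"
  unfolding torus_normalizer_def by (rule normalizer_imp_subgroup) (use torus_carrier in auto)

lemma normalizer_carrier: "m \<in> N \<Longrightarrow> m \<in> carrier G"
  using normalizer_subgroup subgroup.mem_carrier by metis

lemma torus_normal: "normal T (G\<lparr>carrier := N\<rparr>)"
  unfolding torus_normalizer_def by (rule subgroup_in_normalizer[OF torus_subgroup])

lemma torus_sub_normalizer: "T \<subseteq> N"
  using subgroup.subset[OF normal_imp_subgroup[OF torus_normal]] by simp

lemma sigma_N: "i \<in> {1..n} \<Longrightarrow> \<sigma> i \<in> N"
  using sigma_normalizer by (simp add: \<sigma>_def)

lemma sigma_carrier: "i \<in> {1..n} \<Longrightarrow> \<sigma> i \<in> carrier G"
  using sigma_N normalizer_carrier by blast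

lemma word_prod_Nil [simp]: "word_prod M [] = \<one>\<^bsub>M\<^esub>"
  and word_prod_Cons [simp]: "word_prod M (x # xs) = x \<otimes>\<^bsub>M\<^esub> word_prod M xs"
  by (simp_all add: word_prod_def)

lemma word_prod_closed: "subgroup H G \<Longrightarrow> set xs \<subseteq> H \<Longrightarrow> word_prod G xs \<in> H"
  by (induction xs) (auto simp: subgroup.one_closed subgroup.m_closed)

lemma word_prod_carrier: "set xs \<subseteq> carrier G \<Longrightarrow> word_prod G xs \<in> carrier G"
  using word_prod_closed[OF subgroup_self] .

lemma word_prod_snoc: 
  "set xs \<subseteq> carrier G \<Longrightarrow> x \<in> carrier G \<Longrightarrow> word_prod G (xs @ [x]) = word_prod G xs \<otimes> x"
  by (induction xs) (auto simp: m_assoc word_prod_carrier)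

lemma sigma_word:
  assumes "set is \<subseteq> {1..n}"
  shows "\<exists>c. monomial_data n (word_perm n is) c \<and> word_prod G (map \<sigma> is) = \<psi> (word_perm n is) c"
  using assms
proof (induction "is")
  case Nil
  show ?case unfolding word_perm_Nil list.map word_prod_Nil using monomial_data_one psi_one by metis
next
  case (Cons i "is")
  then obtain c where c: "monomial_data n (word_perm n is) c" "word_prod G (map \<sigma> is) = \<psi> (word_perm n is) c"
    by auto
  have i: "i \<in> {1..n}" using Cons.prems by simp
  note s = monomial_data_tits_sign[OF i]
  show ?case
    unfolding word_perm_Cons list.map word_prod_Cons c(2)
    using psi_mult[OF s c(1)] monomial_data_comp[OF s c(1)] sigma_eq[OF i] \<sigma>_def by metis
qed

text \<open>
  The permutation is a product of simple reflections; the corresponding product of the \<open>\<sigma>_i\<close> lies in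
  the normalizer, and \<open>\<psi> w c\<close> differs from it by an element of the torus.
\<close>
lemma psi_normalizer: "monomial_data n w c \<Longrightarrow> \<psi> w c \<in> N"
proof -
  assume c: "monomial_data n w c"
  obtain "is" where w: "set is \<subseteq> {1..n}" "word_perm n is = w"
    using signed_perm_is_word monomial_dataD(1)[OF c] by blast
  then obtain d where d: "monomial_data n w d" "word_prod G (map \<sigma> is) = \<psi> w d"
    using sigma_word by blast
  have "\<psi> w d \<in> N"
    unfolding d(2)[symmetric] using w sigma_N by (intro word_prod_closed normalizer_subgroup) auto
  then show ?thesis
    unfolding psi_torus_right[OF c d(1)]
    using psi_torus[OF monomial_data_divide[OF c d(1)]] torus_sub_normalizer normalizer_subgroup
    by (auto intro: subgroup.m_closed)
qed

lemma weyl_proj_mult: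
  assumes "a \<in> N" "b \<in> N"
  shows "weyl_proj G a \<otimes>\<^bsub>weyl_group G\<^esub> weyl_proj G b = weyl_proj G (a \<otimes> b)"
proof -
  interpret H: normal T "G\<lparr>carrier := N\<rparr>" by (rule torus_normal)
  show ?thesis
    using H.rcos_sum[of a b] assms
    by (simp add: weyl_group_def weyl_proj_def FactGroup_def r_coset_def set_mult_def)
qed

lemma weyl_group_carrier: "carrier (weyl_group G) = weyl_proj G ` N"
  by (auto simp: weyl_group_def weyl_proj_def FactGroup_def RCOSETS_def r_coset_def)

lemma weyl_group_one: "\<one>\<^bsub>weyl_group G\<^esub> = weyl_proj G \<one>"
  using torus_carrier by (auto simp: weyl_group_def weyl_proj_def FactGroup_def r_coset_def)

lemma weyl_proj_eqD:
  assumes "a \<in> N" "b \<in> N" "weyl_proj G a = weyl_proj G b"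
  obtains t where "t \<in> T" "a = t \<otimes> b"
proof -
  have "a \<in> T #> a" using rcos_self[OF normalizer_carrier[OF assms(1)] torus_subgroup] .
  then have "a \<in> T #> b" using assms by (simp add: weyl_proj_def)
  then show thesis using that by (auto simp: r_coset_def)
qed

lemma weyl_proj_psi:
  assumes "monomial_data n w c" "monomial_data n v d"
  shows "weyl_proj G (\<psi> w c) = weyl_proj G (\<psi> v d) \<longleftrightarrow> w = v"
proof
  assume "weyl_proj G (\<psi> w c) = weyl_proj G (\<psi> v d)"
  then obtain t where "t \<in> T" "\<psi> w c = t \<otimes> \<psi> v d"
    using weyl_proj_eqD psi_normalizer assms by metis
  then obtain e where e: "monomial_data n id e" "\<psi> w c = \<psi> id e \<otimes> \<psi> v d" by (metis torusE)
  then show "w = v"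
    using psi_mult[OF e(1) assms(2)] psi_eq_iff[OF assms(1) monomial_data_comp[OF e(1) assms(2)]] by simp
next
  assume wv: "w = v"
  let ?t = "\<psi> id (\<lambda>p. c p / d p)"
  have q: "monomial_data n id (\<lambda>p. c p / d p)" using monomial_data_divide assms wv by blast
  have "weyl_proj G (\<psi> w c) = weyl_proj G (\<psi> v d) \<otimes>\<^bsub>weyl_group G\<^esub> weyl_proj G ?t"
    using psi_torus_right assms weyl_proj_mult psi_normalizer q wv by metis
  also have "weyl_proj G ?t = \<one>\<^bsub>weyl_group G\<^esub>"
    unfolding weyl_group_one weyl_proj_def
    using coset_join2[OF _ torus_subgroup psi_torus[OF q]] torus_carrier[OF psi_torus[OF q]]
      coset_mult_one torus_carrier by (metis subsetI)
  also have "weyl_proj G (\<psi> v d) \<otimes>\<^bsub>weyl_group G\<^esub> \<one>\<^bsub>weyl_group G\<^esub> = weyl_proj G (\<psi> v d)"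
    unfolding weyl_group_one using weyl_proj_mult[OF psi_normalizer[OF assms(2)], of \<one>] psi_closed[OF assms(2)]
      subgroup.one_closed[OF normalizer_subgroup] by simp
  finally show "weyl_proj G (\<psi> w c) = weyl_proj G (\<psi> v d)" .
qed

lemma simple_word_eq:
  assumes "set is \<subseteq> {1..n}"
  shows "simple_word n G is = weyl_proj G (word_prod G (map \<sigma> is))"
  using assms
proof (induction "is")
  case Nil
  then show ?case by (simp add: simple_word_def weyl_group_one)
next
  case (Cons i "is")
  have "word_prod G (map \<sigma> is) \<in> N"
    using Cons.prems sigma_N by (intro word_prod_closed normalizer_subgroup) auto
  moreover have "simple_refl n G i = weyl_proj G (\<sigma> i)" using refl_eq Cons.prems by (simp add: \<sigma>_def)
  ultimately show ?case
    using Cons sigma_N weyl_proj_mult by (simp add: simple_word_def)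
qed

lemma simple_word_eq_iff:
  assumes "set is \<subseteq> {1..n}" "set js \<subseteq> {1..n}"
  shows "simple_word n G is = simple_word n G js \<longleftrightarrow> word_perm n is = word_perm n js"
  unfolding simple_word_eq[OF assms(1)] simple_word_eq[OF assms(2)]
  using sigma_word[OF assms(1)] sigma_word[OF assms(2)] weyl_proj_psi by metis

lemma reduced_word_iff: "reduced_word n G is \<longleftrightarrow> reduced n is"
  unfolding reduced_word_def reduced_def using simple_word_eq_iff by metis

lemma weyl_element_word:
  assumes "w \<in> carrier (weyl_group G)"
  obtains "is" where "reduced n is" "w = simple_word n G is"
proof -
  obtain m where "m \<in> N" "w = weyl_proj G m" using assms weyl_group_carrier by blast
  then obtain v c where v: "monomial_data n v c" "w = weyl_proj G (\<psi> v c)" using normalizer_sub by blast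
  obtain js where js: "set js \<subseteq> {1..n}" "word_perm n js = v" 
    using signed_perm_is_word monomial_dataD(1)[OF v(1)] by blast
  obtain "is" where r: "reduced n is" "word_perm n is = v" using reduced_exists js by metis
  then have set: "set is \<subseteq> {1..n}" by (simp add: reduced_def)
  have "w = simple_word n G is"
    unfolding v(2) simple_word_eq[OF set] using sigma_word[OF set] weyl_proj_psi v(1) r(2) by metis
  then show thesis using that r by blast
qed

lemma simple_word_carrier: "set is \<subseteq> {1..n} \<Longrightarrow> simple_word n G is \<in> carrier (weyl_group G)"
  unfolding weyl_group_carrier simple_word_eq
  using sigma_N by (intro imageI word_prod_closed normalizer_subgroup) auto

lemma simple_refl_word: "i \<in> {1..n} \<Longrightarrow> simple_refl n G i = simple_word n G [i]"
  using simple_word_eq[of "[i]"] refl_eq sigma_carrier[of i] by (simp add: \<sigma>_def)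

section \<open>Sections and their values on simple reflections\<close>

definition gen :: "('g set \<Rightarrow> 'g) \<Rightarrow> nat \<Rightarrow> 'g" where
  "gen S i = S (simple_refl n G i)"

lemma section_word:
  assumes "is_section n G S" "reduced n is"
  shows "S (simple_word n G is) = word_prod G (map (gen S) is)"
  using assms unfolding is_section_def reduced_word_iff gen_def by blast

lemma section_gen:
  assumes "is_section n G S" "i \<in> {1..n}"
  obtains t where "t \<in> T" "gen S i = t \<otimes> \<sigma> i"
proof -
  have w: "simple_refl n G i \<in> carrier (weyl_group G)"
    using simple_word_carrier[of "[i]"] simple_refl_word assms(2) by simp
  then have "gen S i \<in> N" "weyl_proj G (gen S i) = simple_refl n G i"
    using assms(1) unfolding is_section_def gen_def by auto
  then show thesis
    using that weyl_proj_eqD[of "gen S i" "\<sigma> i"] sigma_N refl_eq assms(2) by (metis \<sigma>_def)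
qed

lemma gen_carrier: "is_section n G S \<Longrightarrow> i \<in> {1..n} \<Longrightarrow> gen S i \<in> carrier G"
  by (erule section_gen, assumption) (auto simp: torus_carrier sigma_carrier)

lemma section_eqI:
  assumes S: "is_section n G S" and S': "is_section n G S'"
    and gen: "\<And>i. i \<in> {1..n} \<Longrightarrow> gen S i = gen S' i"
  shows "S = S'"
proof
  fix w
  show "S w = S' w"
  proof (cases "w \<in> carrier (weyl_group G)")
    case True
    then obtain "is" where r: "reduced n is" "w = simple_word n G is" by (rule weyl_element_word)
    then have "map (gen S) is = map (gen S') is" using gen by (auto simp: reduced_def)
    then show ?thesis unfolding r(2) section_word[OF S r(1)] section_word[OF S' r(1)] by (simp only:)
  next
    case False
    have "S w = undefined" "S' w = undefined"
      using S S' False unfolding is_section_def by (auto simp: PiE_def extensional_def)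
    then show ?thesis by simp
  qed
qed

text \<open>
  A reduced word is built up by ascents, so that the cocycle condition identifies the product of the
  lifts of its letters with the lift of the element, whichever reduced word is taken.
\<close>
lemma section_exists:
  assumes F: "length_cocycle n F" 
    and gen: "\<And>i. i \<in> {1..n} \<Longrightarrow> monomial_data n (srefl n i) (F (srefl n i))"
  obtains S where "is_section n G S" "\<And>i. i \<in> {1..n} \<Longrightarrow> gen S i = \<psi> (srefl n i) (F (srefl n i))"
proof -
  let ?g = "\<lambda>i. \<psi> (srefl n i) (F (srefl n i))"
  have word: "monomial_data n (word_perm n is) (F (word_perm n is)) \<and> 
     word_prod G (map ?g is) = \<psi> (word_perm n is) (F (word_perm n is))" if "reduced n is" for "is"
    using that
  proof (induction "is" rule: rev_induct)
    case Nil
    have "F id = (\<lambda>_. 1)" using F by (auto simp: length_cocycle_def)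
    then show ?case unfolding word_perm_Nil list.map word_prod_Nil using monomial_data_one psi_one by metis
  next
    case (snoc i "is")
    note r = reduced_snocD[OF snoc.prems]
    let ?w = "word_perm n is"
    have IH: "monomial_data n ?w (F ?w)" "word_prod G (map ?g is) = \<psi> ?w (F ?w)" using snoc.IH r by auto
    have w: "signed_perm n ?w" using IH monomial_dataD by blast
    have cocycle: "F (?w \<circ> srefl n i) p = F (srefl n i) p * F ?w (srefl n i p)" if "p < 2 * n" for p
      using F w r that unfolding length_cocycle_def by (auto simp: mult.commute)
    have m: "monomial_data n (?w \<circ> srefl n i) (\<lambda>p. F (srefl n i) p * F ?w (srefl n i p))"
      by (rule monomial_data_comp[OF IH(1) gen[OF r(2)]])
    have m': "monomial_data n (?w \<circ> srefl n i) (F (?w \<circ> srefl n i))"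
      using monomial_data_cong[OF m, of "F (?w \<circ> srefl n i)"] cocycle by simp
    have "word_prod G (map ?g (is @ [i])) = \<psi> ?w (F ?w) \<otimes> ?g i"
    proof -
      have "set (map ?g is) \<subseteq> carrier G" using r(1) gen psi_closed by (auto simp: reduced_def)
      then show ?thesis
        using word_prod_snoc[of "map ?g is" "?g i"] psi_closed[OF gen[OF r(2)]] IH(2) by simp
    qed
    also have "\<dots> = \<psi> (?w \<circ> srefl n i) (\<lambda>p. F (srefl n i) p * F ?w (srefl n i p))"
      by (rule psi_mult[OF IH(1) gen[OF r(2)]])
    also have "\<dots> = \<psi> (?w \<circ> srefl n i) (F (?w \<circ> srefl n i))"
      by (rule psi_cong[OF m m']) (simp add: cocycle)
    finally have "word_prod G (map ?g (is @ [i])) = \<psi> (?w \<circ> srefl n i) (F (?w \<circ> srefl n i))" .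
    moreover have "word_perm n (is @ [i]) = ?w \<circ> srefl n i" by (simp add: word_perm_append)
    ultimately show ?case using m' by (simp only:)
  qed
  define S where "S = (\<lambda>w \<in> carrier (weyl_group G). 
     let v = (THE v. \<exists>is. reduced n is \<and> w = simple_word n G is \<and> v = word_perm n is) in \<psi> v (F v))"
  have S: "S (simple_word n G is) = \<psi> (word_perm n is) (F (word_perm n is))" if "reduced n is" for "is"
  proof -
    have set: "set is \<subseteq> {1..n}" using that by (simp add: reduced_def)
    have "(THE v. \<exists>js. reduced n js \<and> simple_word n G is = simple_word n G js \<and> v = word_perm n js) = word_perm n is"
    proof (rule the_equality)
      show "\<exists>js. reduced n js \<and> simple_word n G is = simple_word n G js \<and> word_perm n is = word_perm n js"
        using that by blast
      fix v assume "\<exists>js. reduced n js \<and> simple_word n G is = simple_word n G js \<and> v = word_perm n js"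
      then obtain js where js: "reduced n js" "simple_word n G is = simple_word n G js" "v = word_perm n js" by blast
      then have "set js \<subseteq> {1..n}" by (simp add: reduced_def)
      then show "v = word_perm n is" using simple_word_eq_iff[OF set] js by metis
    qed
    then show ?thesis using simple_word_carrier[OF set] by (simp add: S_def Let_def)
  qed
  have S_gen: "gen S i = ?g i" if "i \<in> {1..n}" for i
    unfolding gen_def simple_refl_word[OF that] S[OF reduced_single[OF that]] by simp
  have "is_section n G S"
    unfolding is_section_def
  proof (intro conjI ballI allI impI)
    show "S \<in> carrier (weyl_group G) \<rightarrow>\<^sub>E N"
    proof (rule PiE_I)
      fix w assume "w \<in> carrier (weyl_group G)"
      then obtain "is" where "reduced n is" "w = simple_word n G is" by (rule weyl_element_word)
      then show "S w \<in> N" using S word psi_normalizer by auto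
    qed (simp add: S_def)
    fix w assume "w \<in> carrier (weyl_group G)"
    then obtain "is" where r: "reduced n is" "w = simple_word n G is" by (rule weyl_element_word)
    then have set: "set is \<subseteq> {1..n}" by (simp add: reduced_def)
    show "weyl_proj G (S w) = w"
      unfolding r(2) S[OF r(1)] unfolding simple_word_eq[OF set]
      using sigma_word[OF set] weyl_proj_psi word[OF r(1)] by metis
  next
    fix "is" assume "reduced_word n G is"
    then have r: "reduced n is" by (simp add: reduced_word_iff)
    then have "map (\<lambda>i. S (simple_refl n G i)) is = map ?g is"
      using S_gen by (auto simp: reduced_def gen_def)
    then show "S (simple_word n G is) = word_prod G (map (\<lambda>i. S (simple_refl n G i)) is)"
      using S[OF r] word[OF r] by (simp only:)
  qed
  then show thesis using that S_gen by blast
qed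

lemma section_braid:
  assumes "is_section n G S" "reduced n is" "reduced n js" "word_perm n is = word_perm n js"
  shows "word_prod G (map (gen S) is) = word_prod G (map (gen S) js)"
proof -
  have "set is \<subseteq> {1..n}" "set js \<subseteq> {1..n}" using assms by (simp_all add: reduced_def)
  then have "simple_word n G is = simple_word n G js" using simple_word_eq_iff assms by simp
  then show ?thesis using section_word assms by metis
qed

lemma tits_section_exists:
  obtains S where "is_section n G S" "\<And>i. i \<in> {1..n} \<Longrightarrow> gen S i = \<sigma> i"
  using section_exists[OF length_cocycle_tits_sign monomial_data_tits_sign] sigma_eq
  by (metis \<sigma>_def)

lemma tits_section: "is_section n G (tits_section n G)" "i \<in> {1..n} \<Longrightarrow> gen (tits_section n G) i = \<sigma> i"
proof -
  obtain S where S: "is_section n G S" "\<And>i. i \<in> {1..n} \<Longrightarrow> gen S i = \<sigma> i"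
    by (rule tits_section_exists) blast
  have "tits_section n G = S"
    unfolding tits_section_def
  proof (rule the_equality)
    show "is_section n G S \<and> (\<forall>i\<in>{1..n}. S (simple_refl n G i) = sigma G (simple_root n i))"
      using S by (simp add: gen_def \<sigma>_def)
    fix S' assume S': "is_section n G S' \<and> (\<forall>i\<in>{1..n}. S' (simple_refl n G i) = sigma G (simple_root n i))"
    show "S' = S"
      by (rule section_eqI) (use S S' in \<open>auto simp: gen_def \<sigma>_def\<close>)
  qed
  then show "is_section n G (tits_section n G)" "i \<in> {1..n} \<Longrightarrow> gen (tits_section n G) i = \<sigma> i"
    using S by simp_all
qed

end

section \<open>Simple root values of torus elements\<close>

text \<open>
  The simple root values of \<open>s_i(t)\<close> in terms of those of \<open>t\<close>: the value at \<open>j\<close> is multiplied by the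
  value at \<open>i\<close> to the power \<open>- \<langle>\<alpha>_j, \<alpha>_i\<^sup>\<or>\<rangle>\<close>.
\<close>
definition refl_values :: "nat \<Rightarrow> nat \<Rightarrow> (nat \<Rightarrow> 'a::field) \<Rightarrow> nat \<Rightarrow> 'a" where
  "refl_values n i v j =
     (if j = i then inverse (v i) else if Suc j = i then v j * v i
      else if j = Suc i then (if j = n then v j * (v i)\<^sup>2 else v j * v i) else v j)"

text \<open>
  The simple root values of the torus element \<open>t_i s_i(t_j) s_i(s_j(t_k)) ...\<close> that is split off from
  \<open>t_i \<sigma>_i t_j \<sigma>_j t_k \<sigma>_k ...\<close>, where \<open>b i\<close> are the values of \<open>t_i\<close>.
\<close>
fun word_values :: "nat \<Rightarrow> (nat \<Rightarrow> nat \<Rightarrow> 'a::field) \<Rightarrow> nat list \<Rightarrow> nat \<Rightarrow> 'a" where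
  "word_values n b [] = (\<lambda>_. 1)"
| "word_values n b (i # is) = (\<lambda>j. b i j * refl_values n i (word_values n b is) j)"

lemma refl_values_self: "refl_values n i v i = inverse (v i)"
  and refl_values_below: "refl_values n (Suc k) v k = v k * v (Suc k)"
  and refl_values_above: "Suc i \<noteq> n \<Longrightarrow> refl_values n i v (Suc i) = v (Suc i) * v i"
  and refl_values_last: "refl_values (Suc i) i v (Suc i) = v (Suc i) * (v i)\<^sup>2"
  and refl_values_far: "j \<noteq> i \<Longrightarrow> Suc j \<noteq> i \<Longrightarrow> j \<noteq> Suc i \<Longrightarrow> refl_values n i v j = v j"
  by (simp_all add: refl_values_def)

lemma refl_values_one [simp]: "refl_values n i (\<lambda>_. 1) = (\<lambda>_. 1)"
  by (simp add: refl_values_def fun_eq_iff)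

lemma refl_values_cong:
  "i \<in> {1..n} \<Longrightarrow> j \<in> {1..n} \<Longrightarrow> (\<And>k. k \<in> {1..n} \<Longrightarrow> v k = v' k) \<Longrightarrow> refl_values n i v j = refl_values n i v' j"
  by (simp add: refl_values_def)

lemma refl_values_nonzero:
  "i \<in> {1..n} \<Longrightarrow> j \<in> {1..n} \<Longrightarrow> (\<And>k. k \<in> {1..n} \<Longrightarrow> v k \<noteq> 0) \<Longrightarrow> refl_values n i v j \<noteq> 0"
  by (simp add: refl_values_def)

context monomial_model
begin

definition val :: "'g \<Rightarrow> nat \<Rightarrow> 'a" where "val t j = root_char G (simple_root n j) t"

lemma val_psi: "j \<in> {1..n} \<Longrightarrow> monomial_data n id c \<Longrightarrow> val (\<psi> id c) j = c (j - 1) / c j"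
  by (simp add: val_def root_char_eq)

lemma val_nonzero: 
  assumes "t \<in> T" "j \<in> {1..n}" shows "val t j \<noteq> 0"
proof -
  obtain c where c: "monomial_data n id c" "t = \<psi> id c" using assms(1) by (rule torusE)
  have "c (j - 1) \<noteq> 0" "c j \<noteq> 0" using monomial_dataD(2)[OF c(1)] assms(2) by auto
  then show ?thesis using val_psi[OF assms(2) c(1)] c(2) by simp
qed

lemma val_mult:
  assumes "t \<in> T" "u \<in> T" "j \<in> {1..n}" shows "val (t \<otimes> u) j = val t j * val u j"
proof -
  obtain c where c: "monomial_data n id c" "t = \<psi> id c" using assms(1) by (rule torusE)
  obtain d where d: "monomial_data n id d" "u = \<psi> id d" using assms(2) by (rule torusE)
  have m: "monomial_data n id (\<lambda>p. d p * c p)"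
    using monomial_data_comp[OF c(1) d(1)] by (simp only: comp_id id_apply)
  have tu: "t \<otimes> u = \<psi> id (\<lambda>p. d p * c p)"
    unfolding c(2) d(2) using psi_mult[OF c(1) d(1)] by (simp only: comp_id id_apply)
  have "val t j = c (j - 1) / c j" "val u j = d (j - 1) / d j"
    using val_psi[OF assms(3) c(1)] val_psi[OF assms(3) d(1)] c(2) d(2) by simp_all
  then show ?thesis unfolding tu val_psi[OF assms(3) m] by (simp add: mult.commute)
qed

lemma val_one: "j \<in> {1..n} \<Longrightarrow> val \<one> j = 1"
  using val_psi[OF _ monomial_data_one] psi_one by simp

lemma torus_one: "\<one> \<in> T" and torus_mult: "t \<in> T \<Longrightarrow> u \<in> T \<Longrightarrow> t \<otimes> u \<in> T"
  and torus_inv: "t \<in> T \<Longrightarrow> inv t \<in> T"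
  using torus_subgroup by (auto simp: subgroup.one_closed subgroup.m_closed subgroup.m_inv_closed)

lemma val_inv: 
  assumes "t \<in> T" "j \<in> {1..n}" shows "val (inv t) j = inverse (val t j)"
proof -
  have "val t j * val (inv t) j = 1"
    using val_mult[OF assms(1) torus_inv[OF assms(1)] assms(2)] val_one[OF assms(2)] torus_carrier[OF assms(1)] by simp
  then show ?thesis by (rule inverse_unique[symmetric])
qed

text \<open>
  Equal values of the simple roots mean that the coefficients are proportional along the first
  \<open>n + 1\<close> positions.  These include the mirror pair \<open>n - 1\<close>, \<open>n\<close>, which determines the quotient of the
  multipliers, and the mirror relation extends the proportionality to all positions.
\<close>
lemma torus_eqI:
  assumes "t \<in> T" "u \<in> T" "\<And>j. j \<in> {1..n} \<Longrightarrow> val t j = val u j" shows "t = u"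
proof -
  obtain c where c: "monomial_data n id c" "t = \<psi> id c" using assms(1) by (rule torusE)
  obtain d where d: "monomial_data n id d" "u = \<psi> id d" using assms(2) by (rule torusE)
  have nz: "c p \<noteq> 0" "d p \<noteq> 0" if "p < 2 * n" for p
    using monomial_dataD(2)[OF c(1) that] monomial_dataD(2)[OF d(1) that] by auto
  define k where "k = d 0 / c 0"
  have low: "d p = k * c p" if "p \<le> n" for p
    using that
  proof (induction p)
    case 0
    then show ?case using nz(1)[of 0] n_ge by (simp add: k_def)
  next
    case (Suc p)
    have "c p / c (Suc p) = d p / d (Suc p)"
      using assms(3)[of "Suc p"] val_psi[OF _ c(1), of "Suc p"] val_psi[OF _ d(1), of "Suc p"] c d Suc.prems by simp
    moreover have "d p = k * c p" using Suc by simp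
    moreover have "c p \<noteq> 0" "c (Suc p) \<noteq> 0" "d (Suc p) \<noteq> 0" using Suc.prems n_ge by (auto intro!: nz)
    ultimately show ?case by (simp add: field_simps)
  qed
  obtain \<mu> \<mu>' where \<mu>: "\<And>p q. Suc (p + q) = 2 * n \<Longrightarrow> c p * c q = \<mu>" "\<And>p q. Suc (p + q) = 2 * n \<Longrightarrow> d p * d q = \<mu>'"
    using c(1) d(1) unfolding monomial_data_id by metis
  have k: "k \<noteq> 0" using nz[of 0] n_ge by (simp add: k_def)
  have "c (n - 1) * c n = \<mu>" "d (n - 1) * d n = \<mu>'" using \<mu> n_ge by auto
  then have kk: "\<mu>' = k * k * \<mu>" using low[of "n - 1"] low[of n] by (simp add: mult_ac)
  have "d p = k * c p" if "p < 2 * n" for p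
  proof (cases "p \<le> n")
    case False
    define q where "q = 2 * n - 1 - p"
    have q: "Suc (p + q) = 2 * n" "q \<le> n" "q < 2 * n" using False that by (auto simp: q_def)
    have "d p * (k * c q) = k * k * (c p * c q)" using \<mu>[OF q(1)] kk low[OF q(2)] by simp
    then show ?thesis using k nz[OF q(3)] by (simp add: field_simps)
  qed (rule low)
  then have "\<psi> id c = \<psi> id d" using psi_eq_iff[OF c(1) d(1)] k by blast
  then show ?thesis using c d by simp
qed

lemma torus_exists:
  assumes "\<And>j. j \<in> {1..n} \<Longrightarrow> x j \<noteq> (0 :: 'a)"
  obtains t where "t \<in> T" "\<And>j. j \<in> {1..n} \<Longrightarrow> val t j = x j"
proof -
  \<comment> \<open>the quotients of all consecutive diagonal entries, symmetric under mirror images\<close>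
  define y where "y j = (if j \<le> n then x j else x (2 * n - j))" for j
  define c where "c p = inverse (\<Prod>j\<in>{1..p}. y j)" for p
  have y: "y j \<noteq> 0" if "j \<in> {1..<2 * n}" for j
  proof (cases "j \<le> n")
    case False
    then have "2 * n - j \<in> {1..n}" using that by auto
    then show ?thesis using False assms by (simp add: y_def)
  qed (use that assms in \<open>auto simp: y_def\<close>)
  have step: "c p = c (Suc p) * y (Suc p)" if "Suc p < 2 * n" for p
    using y[of "Suc p"] that by (simp add: c_def)
  have nz: "c p \<noteq> 0" if "p < 2 * n" for p
    using y that by (auto simp: c_def)
  have mirror: "c p * c q = c 0 * c (2 * n - 1)" if "Suc (p + q) = 2 * n" for p q
    using that
  proof (induction p arbitrary: q)
    case 0
    then have "q = 2 * n - 1" by simp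
    then show ?case by simp
  next
    case (Suc p)
    have "y (Suc p) = y (Suc q)"
    proof -
      have "2 * n - Suc q = Suc p" "2 * n - Suc p = Suc q" "Suc p \<le> n \<and> Suc q \<le> n \<longrightarrow> p = q"
        using Suc.prems by auto
      moreover have "Suc p \<le> n \<or> Suc q \<le> n" using Suc.prems by linarith
      ultimately show ?thesis by (auto simp: y_def)
    qed
    moreover have "c p * c (Suc q) = c 0 * c (2 * n - 1)" using Suc.prems by (intro Suc.IH) simp
    moreover have "c p = c (Suc p) * y (Suc p)" "c q = c (Suc q) * y (Suc q)" using Suc.prems by (auto intro!: step)
    ultimately show ?case by (simp add: mult_ac)
  qed
  have c: "monomial_data n id c" unfolding monomial_data_id using nz mirror by blast
  have "val (\<psi> id c) j = x j" if "j \<in> {1..n}" for j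
  proof -
    have "c (j - 1) = c j * y j" "c j \<noteq> 0" using step[of "j - 1"] nz[of j] that by auto
    then show ?thesis using val_psi[OF that c] that by (simp add: y_def)
  qed
  then show thesis using that psi_torus[OF c] by blast
qed

lemma coweight:
  assumes "i \<in> {1..n}" "x \<noteq> 0"
  shows "coweight n G i x \<in> T" "j \<in> {1..n} \<Longrightarrow> val (coweight n G i x) j = (if j = i then x else 1)"
proof -
  obtain t where t: "t \<in> T" "\<And>j. j \<in> {1..n} \<Longrightarrow> val t j = (if j = i then x else 1)"
    by (rule torus_exists[of "\<lambda>j. if j = i then x else 1"]) (use assms in auto)
  have "coweight n G i x = t"
    unfolding coweight_def val_def[symmetric]
    by (rule the_equality) (use t torus_eqI in auto)
  then show "coweight n G i x \<in> T" "j \<in> {1..n} \<Longrightarrow> val (coweight n G i x) j = (if j = i then x else 1)"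
    using t by auto
qed

lemma torus_point:
  assumes "\<And>j. j \<in> {1..n} \<Longrightarrow> x j \<noteq> 0"
  shows "torus_point n G x \<in> T" "j \<in> {1..n} \<Longrightarrow> val (torus_point n G x) j = x j"
proof -
  let ?w = "\<lambda>js. word_prod G (map (\<lambda>j. coweight n G j (x j)) js)"
  have w: "?w js \<in> T \<and> (\<forall>k \<in> {1..n}. val (?w js) k = prod_list (map (\<lambda>j. if k = j then x j else 1) js))"
    if "set js \<subseteq> {1..n}" for js
    using that
  proof (induction js)
    case Nil
    then show ?case by (simp add: torus_one val_one)
  next
    case (Cons i js)
    then have "coweight n G i (x i) \<in> T" "?w js \<in> T" using coweight assms by auto
    then show ?case using Cons coweight(2) assms by (auto simp: torus_mult val_mult)
  qed
  define js where "js = [1..<Suc n]"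
  have js: "set js = {1..n}" "distinct js" by (auto simp: js_def simp del: upt_Suc)
  have tp: "torus_point n G x = ?w js" by (simp only: torus_point_def js_def)
  show "torus_point n G x \<in> T" unfolding tp using w[of js] js by auto
  assume j: "j \<in> {1..n}"
  have "prod_list (map (\<lambda>i. if j = i then x i else 1) js) = (\<Prod>i\<in>set js. if j = i then x i else 1)"
    using prod.distinct_set_conv_list[OF js(2)] by metis
  also have "\<dots> = x j" unfolding js(1) using j by simp
  finally show "val (torus_point n G x) j = x j" unfolding tp using w[of js] j js by auto
qed

section \<open>The simple reflections on the torus\<close>

definition conj_sigma :: "nat \<Rightarrow> 'g \<Rightarrow> 'g" where
  "conj_sigma i t = \<sigma> i \<otimes> t \<otimes> inv (\<sigma> i)"

lemma sigma_psi: "i \<in> {1..n} \<Longrightarrow> \<sigma> i = \<psi> (srefl n i) (tits_sign (srefl n i))"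
  by (simp add: \<sigma>_def sigma_eq)

lemma conj_sigma:
  assumes i: "i \<in> {1..n}" and t: "t \<in> T"
  shows "conj_sigma i t \<in> T" "\<sigma> i \<otimes> t = conj_sigma i t \<otimes> \<sigma> i"
    "j \<in> {1..n} \<Longrightarrow> val (conj_sigma i t) j = refl_values n i (val t) j"
proof -
  let ?s = "srefl n i" and ?e = "tits_sign (srefl n i) :: nat \<Rightarrow> 'a"
  obtain c where c: "monomial_data n id c" "t = \<psi> id c" using t by (rule torusE)
  note s = monomial_data_tits_sign[OF i, where 'a = 'a]
  obtain \<mu> where \<mu>: "\<And>p q. Suc (p + q) = 2 * n \<Longrightarrow> c p * c q = \<mu>"
    using c(1) unfolding monomial_data_id by metis
  have nz: "c p \<noteq> 0" if "p < 2 * n" for p using monomial_dataD(2)[OF c(1) that] .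
  have cs: "monomial_data n id (\<lambda>p. c (?s p))"
    unfolding monomial_data_id using nz srefl_less[OF i] \<mu> srefl_mirror[OF i] by blast
  have "\<sigma> i \<otimes> t = \<psi> ?s (\<lambda>p. c p * ?e p)"
    unfolding sigma_psi[OF i] c(2) using psi_mult[OF s c(1)] by (simp only: comp_id id_apply)
  moreover have "\<psi> id (\<lambda>p. c (?s p)) \<otimes> \<sigma> i = \<psi> ?s (\<lambda>p. ?e p * c p)"
    unfolding sigma_psi[OF i] using psi_mult[OF cs s] by (simp add: id_comp srefl_involution[OF i])
  ultimately have comm: "\<sigma> i \<otimes> t = \<psi> id (\<lambda>p. c (?s p)) \<otimes> \<sigma> i" by (simp add: mult.commute)
  have eq: "conj_sigma i t = \<psi> id (\<lambda>p. c (?s p))"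
    unfolding conj_sigma_def comm using psi_closed[OF cs] sigma_carrier[OF i] by (simp add: m_assoc)
  show "conj_sigma i t \<in> T" unfolding eq by (rule psi_torus[OF cs])
  show "\<sigma> i \<otimes> t = conj_sigma i t \<otimes> \<sigma> i" unfolding eq by (rule comm)
  assume j: "j \<in> {1..n}"
  have v: "val t k = c (k - 1) / c k" if "k \<in> {1..n}" for k using val_psi[OF that c(1)] c(2) by simp
  have lhs: "val (conj_sigma i t) j = c (?s (j - 1)) / c (?s j)" unfolding eq by (rule val_psi[OF j cs])
  consider "j = i" | "Suc j = i" | "j = Suc i" "j \<noteq> n" | "j = Suc i" "j = n" | "j \<noteq> i" "Suc j \<noteq> i" "j \<noteq> Suc i" by blast
  then show "val (conj_sigma i t) j = refl_values n i (val t) j"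
  proof cases
    case 1
    obtain k where k: "i = Suc k" using i by (cases i) auto
    show ?thesis using lhs v[OF i] k 1 by (simp add: refl_values_def)
  next
    case 2
    have "?s (j - 1) = j - 1" "?s j = i" using 2 i j by (auto intro: srefl_fix)
    moreover have "c j \<noteq> 0" "c i \<noteq> 0" using nz i j by auto
    ultimately show ?thesis unfolding lhs using v[OF i] v[OF j] 2 by (auto simp: refl_values_def)
  next
    case 3
    have "?s (j - 1) = i - 1" "?s j = j" using 3 i j by (auto simp: srefl_def)
    moreover have "c i \<noteq> 0" "c j \<noteq> 0" using nz i j by auto
    ultimately show ?thesis unfolding lhs using v[OF i] v[OF j] 3 by (auto simp: refl_values_def)
  next
    case 4
    have s: "?s (j - 1) = i - 1" "?s j = Suc n" using 4 i j by (auto simp: srefl_def)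
    have "c (i - 1) * c (Suc n) = c i * c n" using \<mu>[of "i - 1" "Suc n"] \<mu>[of i n] 4 i by auto
    moreover have "c i \<noteq> 0" "c n \<noteq> 0" "c (i - 1) \<noteq> 0" "c (Suc n) \<noteq> 0" using i j n_ge by (auto intro!: nz)
    ultimately have "c (i - 1) / c (Suc n) = c i / c n * (c (i - 1) / c i)\<^sup>2"
      by (simp add: field_simps power2_eq_square)
    then show ?thesis unfolding lhs s using v[OF i] v[OF j] 4 by (auto simp: refl_values_def)
  next
    case 5
    have "?s (j - 1) = j - 1" "?s j = j" using 5 i j by (auto intro!: srefl_fix)
    then show ?thesis unfolding lhs using v[OF j] 5 by (simp add: refl_values_def)
  qed
qed

lemma twisted_word:
  assumes "set is \<subseteq> {1..n}" "\<And>i. i \<in> {1..n} \<Longrightarrow> t i \<in> T" "\<And>i. i \<in> {1..n} \<Longrightarrow> g i = t i \<otimes> \<sigma> i"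
    and b: "\<And>i j. i \<in> {1..n} \<Longrightarrow> j \<in> {1..n} \<Longrightarrow> b i j = val (t i) j"
  shows "\<exists>u \<in> T. word_prod G (map g is) = u \<otimes> word_prod G (map \<sigma> is) \<and> 
      (\<forall>j \<in> {1..n}. val u j = word_values n b is j)"
  using assms(1)
proof (induction "is")
  case Nil
  then show ?case by (intro bexI[of _ \<one>]) (simp_all add: val_one torus_one)
next
  case (Cons i "is")
  then obtain u where u: "u \<in> T" "word_prod G (map g is) = u \<otimes> word_prod G (map \<sigma> is)"
      "\<forall>j \<in> {1..n}. val u j = word_values n b is j" by auto
  have i: "i \<in> {1..n}" and set: "set is \<subseteq> {1..n}" using Cons.prems by auto
  let ?w = "word_prod G (map \<sigma> is)"
  have w: "?w \<in> carrier G" using set sigma_carrier by (intro word_prod_carrier) auto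
  note c = conj_sigma[OF i u(1)]
  note carr = w sigma_carrier[OF i] torus_carrier[OF u(1)] torus_carrier[OF assms(2)[OF i]] torus_carrier[OF c(1)]
  have "word_prod G (map g (i # is)) = t i \<otimes> (\<sigma> i \<otimes> u) \<otimes> ?w"
    using carr by (simp add: u(2) assms(3)[OF i] m_assoc)
  also have "\<dots> = (t i \<otimes> conj_sigma i u) \<otimes> word_prod G (map \<sigma> (i # is))"
    unfolding c(2) using carr by (simp add: m_assoc)
  finally have "word_prod G (map g (i # is)) = (t i \<otimes> conj_sigma i u) \<otimes> word_prod G (map \<sigma> (i # is))" .
  moreover have "val (t i \<otimes> conj_sigma i u) j = word_values n b (i # is) j" if j: "j \<in> {1..n}" for j
    using val_mult[OF assms(2)[OF i] c(1) j] c(3)[OF j] b[OF i j] refl_values_cong[OF i j, of "val u" "word_values n b is"] u(3)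
    by simp
  ultimately show ?case using torus_mult[OF assms(2)[OF i] c(1)] by blast
qed

section \<open>Coordinates of sections\<close>

definition twist :: "('g set \<Rightarrow> 'g) \<Rightarrow> nat \<Rightarrow> 'g" where
  "twist S i = gen S i \<otimes> inv (\<sigma> i)"

text \<open>
  The matrix of the values \<open>\<alpha>_j(t_i)\<close> for \<open>S(s_i) = t_i \<sigma>_i\<close>.
\<close>
definition coords :: "('g set \<Rightarrow> 'g) \<Rightarrow> nat \<Rightarrow> nat \<Rightarrow> 'a" where
  "coords S i j = val (twist S i) j"

lemma twist:
  assumes "is_section n G S" "i \<in> {1..n}"
  shows "twist S i \<in> T" "gen S i = twist S i \<otimes> \<sigma> i"
proof -
  obtain t where t: "t \<in> T" "gen S i = t \<otimes> \<sigma> i" using section_gen[OF assms] .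
  then have "twist S i = t"
    unfolding twist_def using sigma_carrier[OF assms(2)] torus_carrier[OF t(1)] by (simp add: m_assoc)
  then show "twist S i \<in> T" "gen S i = twist S i \<otimes> \<sigma> i" using t by auto
qed

lemma twist_unique: 
  "i \<in> {1..n} \<Longrightarrow> t \<in> T \<Longrightarrow> gen S i = t \<otimes> \<sigma> i \<Longrightarrow> twist S i = t"
  unfolding twist_def using sigma_carrier torus_carrier by (simp add: m_assoc)

lemma coords_nonzero: "is_section n G S \<Longrightarrow> i \<in> {1..n} \<Longrightarrow> j \<in> {1..n} \<Longrightarrow> coords S i j \<noteq> 0"
  unfolding coords_def using val_nonzero twist by blast

text \<open>
  The Tits section satisfies the same braid relation, so that the words in the \<open>\<sigma>_i\<close> cancel and an
  equation in the torus remains.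
\<close>
lemma coords_braid:
  assumes S: "is_section n G S" and r: "reduced n is" "reduced n js" "word_perm n is = word_perm n js"
    and j: "j \<in> {1..n}"
  shows "word_values n (coords S) is j = word_values n (coords S) js j"
proof -
  have set: "set is \<subseteq> {1..n}" "set js \<subseteq> {1..n}" using r by (simp_all add: reduced_def)
  obtain u where u: "u \<in> T" "word_prod G (map (gen S) is) = u \<otimes> word_prod G (map \<sigma> is)"
      "\<forall>j \<in> {1..n}. val u j = word_values n (coords S) is j"
    using twisted_word[OF set(1), of "twist S" "gen S" "coords S"] twist[OF S] coords_def by metis
  obtain u' where u': "u' \<in> T" "word_prod G (map (gen S) js) = u' \<otimes> word_prod G (map \<sigma> js)"
      "\<forall>j \<in> {1..n}. val u' j = word_values n (coords S) js j"
    using twisted_word[OF set(2), of "twist S" "gen S" "coords S"] twist[OF S] coords_def by metis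
  have "map (gen (tits_section n G)) is = map \<sigma> is" "map (gen (tits_section n G)) js = map \<sigma> js"
    using tits_section(2) set by auto
  then have braid: "word_prod G (map \<sigma> is) = word_prod G (map \<sigma> js)"
    using section_braid[OF tits_section(1) r] by (simp only:)
  have "word_prod G (map \<sigma> js) \<in> carrier G" using set sigma_carrier by (intro word_prod_carrier) auto
  then have "u = u'"
    using section_braid[OF S r] u(1,2) u'(1,2) torus_carrier unfolding braid by (metis r_cancel)
  then show ?thesis using u(3) u'(3) j by metis
qed

end

section \<open>Solving the braid relations\<close>

lemma chain_val_generic: "i \<noteq> n - 1 \<Longrightarrow> chain_val n a i = a i i * (a i (Suc i))\<^sup>2"
  and chain_val_last: "chain_val n a (n - 1) = a (n - 1) (n - 1) * (a (n - 1) (n - 2))\<^sup>2"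
  by (simp_all add: chain_val_def)

lemma t_coord_generic:
  assumes "n \<ge> 6" "1 \<le> i" "i \<le> n - 2"
  shows "t_coord n a i i = a i i" "t_coord n a i (Suc i) = a i (Suc i)"
    "1 \<le> j \<Longrightarrow> Suc j = i \<Longrightarrow> t_coord n a i j = inverse (a i i) * inverse (a i (Suc i))"
    "1 \<le> j \<Longrightarrow> Suc j \<noteq> i \<Longrightarrow> j \<noteq> i \<Longrightarrow> j \<noteq> Suc i \<Longrightarrow> t_coord n a i j = 1"
proof -
  have n: "n \<noteq> 1" "n \<noteq> 2" "n - 2 \<noteq> 0" "Suc 0 \<noteq> n" using assms by auto
  show "t_coord n a i i = a i i" "t_coord n a i (Suc i) = a i (Suc i)"
  proof -
    have "i \<noteq> i - 1" "Suc i \<noteq> i - 1" using assms(2) by auto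
    then show "t_coord n a i i = a i i" "t_coord n a i (Suc i) = a i (Suc i)"
      unfolding t_coord_def using assms(3) by (simp_all add: numeral_2_eq_2)
  qed
  show "t_coord n a i j = inverse (a i i) * inverse (a i (Suc i))" if "1 \<le> j" "Suc j = i"
  proof -
    have "i \<noteq> 1" "j = i - 1" using that by auto
    then show ?thesis unfolding t_coord_def using assms(3) by simp
  qed
  show "t_coord n a i j = 1" if "1 \<le> j" "Suc j \<noteq> i" "j \<noteq> i" "j \<noteq> Suc i"
  proof -
    have "j \<noteq> i - 1" using that by auto
    then show ?thesis unfolding t_coord_def using assms(3) that by (simp add: numeral_2_eq_2)
  qed
qed

lemma t_coord_penultimate:
  assumes "n \<ge> 6" "i = n - 1"
  shows "t_coord n a i i = a i i" "t_coord n a i (n - 2) = a i (n - 2)"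
    "t_coord n a i n = inverse ((a i (n - 2))\<^sup>2) * inverse ((a i i)\<^sup>2)"
    "j \<noteq> n - 2 \<Longrightarrow> j \<noteq> i \<Longrightarrow> j \<noteq> n \<Longrightarrow> t_coord n a i j = 1"
proof -
  have "n - 1 \<noteq> 1" "\<not> n - 1 \<le> n - 2" "n - 1 \<noteq> n - 2" "n \<noteq> n - 2" "n \<noteq> n - 1" using assms(1) by auto
  then show "t_coord n a i i = a i i" "t_coord n a i (n - 2) = a i (n - 2)"
    "t_coord n a i n = inverse ((a i (n - 2))\<^sup>2) * inverse ((a i i)\<^sup>2)"
    "j \<noteq> n - 2 \<Longrightarrow> j \<noteq> i \<Longrightarrow> j \<noteq> n \<Longrightarrow> t_coord n a i j = 1"
    unfolding t_coord_def assms(2) by (simp_all only: if_True if_False refl simp_thms)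
qed

lemma t_coord_last:
  assumes "n \<ge> 6"
  shows "t_coord n a n n = inverse ((a n (n - 1))\<^sup>2)" "t_coord n a n (n - 1) = a n (n - 1)"
    "j \<noteq> n - 1 \<Longrightarrow> j \<noteq> n \<Longrightarrow> t_coord n a n j = 1"
proof -
  have "n \<noteq> 1" "\<not> n \<le> n - 2" "n \<noteq> n - 1" using assms by auto
  then show "t_coord n a n n = inverse ((a n (n - 1))\<^sup>2)" "t_coord n a n (n - 1) = a n (n - 1)"
    "j \<noteq> n - 1 \<Longrightarrow> j \<noteq> n \<Longrightarrow> t_coord n a n j = 1"
    unfolding t_coord_def by (simp_all only: if_True if_False refl simp_thms)
qed

text \<open>
  Commuting pairs \<open>i\<close>, \<open>j\<close> give \<open>b i j = b j i = 1\<close>, by comparing the coordinates next to \<open>i\<close> and \<open>j\<close>;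
  if \<open>j = i + 2\<close>, the common neighbour only gives \<open>b i j = b j i\<close>, and a further neighbour is needed.
  In the braid relation of length three between \<open>i\<close> and \<open>i + 1\<close> the coordinate \<open>i - 1\<close> expresses
  \<open>b i (i - 1)\<close> through the other two entries of its row, for \<open>i + 2 = n\<close> the coordinate \<open>n\<close> expresses
  \<open>b (n - 1) n\<close> in the same way, and the coordinate \<open>i\<close> links the chain values of
  the two rows.  The relation of length four determines the last row and yields that the square of the chain value is \<open>1\<close>.
\<close>
lemma braid_values_params:
  fixes b :: "nat \<Rightarrow> nat \<Rightarrow> 'a::field"
  assumes n: "n \<ge> 6" and nz: "\<And>i j. i \<in> {1..n} \<Longrightarrow> j \<in> {1..n} \<Longrightarrow> b i j \<noteq> 0"
    and two: "\<And>i j k. i \<in> {1..n} \<Longrightarrow> j \<in> {1..n} \<Longrightarrow> k \<in> {1..n} \<Longrightarrow> Suc i < j \<Longrightarrow>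
      word_values n b [i, j] k = word_values n b [j, i] k"
    and three: "\<And>i k. i \<in> {1..n} \<Longrightarrow> k \<in> {1..n} \<Longrightarrow> Suc i < n \<Longrightarrow>
      word_values n b [i, Suc i, i] k = word_values n b [Suc i, i, Suc i] k"
    and four: "\<And>k. k \<in> {1..n} \<Longrightarrow>
      word_values n b [n - 1, n, n - 1, n] k = word_values n b [n, n - 1, n, n - 1] k"
  shows "section_params n b" "\<And>i j. i \<in> {1..n} \<Longrightarrow> j \<in> {1..n} \<Longrightarrow> t_coord n b i j = b i j"
proof -
  note rv = refl_values_self refl_values_below refl_values_above refl_values_last refl_values_far
  have far: "b i j = 1 \<and> b j i = 1" if ij: "1 \<le> i" "j \<le> n" "Suc i < j" for i j
  proof -
    have nz': "b i q \<noteq> 0" "b j q \<noteq> 0" if "1 \<le> q" "q \<le> n" for q using nz that ij by auto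
    have E: "b i k * refl_values n i (b j) k = b j k * refl_values n j (b i) k" if "1 \<le> k" "k \<le> n" for k
      using two[of i j k] that ij by simp
    show ?thesis
    proof (cases "j = Suc (Suc i)")
      case False
      then obtain p where p: "j = Suc p" "Suc i < p" using ij by (cases j) auto
      have "b i j = 1"
        using E[of p] ij p nz'[of p] by (simp add: rv)
      moreover have "b j i = 1"
        using E[of "Suc i"] ij p nz'[of "Suc i"] by (simp add: rv)
      ultimately show ?thesis by simp
    next
      case j: True
      have eq: "b i j = b j i"
        using E[of "Suc i"] ij j nz'[of "Suc i"] by (simp add: rv)
      show ?thesis
      proof (cases "i = 1")
        case True
        then have "b i j = 1"
          using E[of "Suc j"] ij j n nz'[of "Suc j"] by (simp add: rv)
        then show ?thesis using eq by simp
      next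
        case False
        then obtain p where p: "i = Suc p" "1 \<le> p" using ij by (cases i) auto
        have "b j i = 1"
          using E[of p] ij j p nz'[of p] by (simp add: rv)
        then show ?thesis using eq by simp
      qed
    qed
  qed
  have left: "b (Suc k) (Suc k) * b (Suc k) (Suc (Suc k)) * b (Suc k) k = 1" if k: "1 \<le> k" "Suc (Suc k) < n" for k
  proof -
    have "b (Suc (Suc k)) k = 1" using far[of k "Suc (Suc k)"] k by auto
    moreover have "b (Suc k) k \<noteq> 0" "b (Suc k) (Suc k) \<noteq> 0" "b (Suc k) (Suc (Suc k)) \<noteq> 0" "b (Suc (Suc k)) (Suc k) \<noteq> 0"
      by (rule nz; use k in simp)+
    ultimately show ?thesis
      using three[of "Suc k" k] k by (simp add: rv field_simps)
  qed
  have last: "b (Suc i) n * ((b (Suc i) i)\<^sup>2 * (b (Suc i) (Suc i))\<^sup>2) = 1" if i: "n = Suc (Suc i)" for i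
  proof -
    have "b i n = 1" using far[of i n] i n by auto
    moreover have "b i i \<noteq> 0" "b i (Suc i) \<noteq> 0" "b (Suc i) i \<noteq> 0" "b (Suc i) (Suc i) \<noteq> 0" "b (Suc i) n \<noteq> 0"
      by (rule nz; use i n in simp)+
    ultimately show ?thesis
      using three[of i n] i n by (simp add: rv field_simps power2_eq_square)
  qed
  have adjacent: "b i i * (b i (Suc i))\<^sup>2 * (b (Suc i) (Suc i) * (b (Suc i) i)\<^sup>2) = 1" 
    if i: "1 \<le> i" "Suc i < n" for i
  proof -
    have "b i i \<noteq> 0" "b i (Suc i) \<noteq> 0" "b (Suc i) i \<noteq> 0" "b (Suc i) (Suc i) \<noteq> 0"
      by (rule nz; use i in simp)+
    then show ?thesis
      using three[of i i] i by (simp add: rv field_simps power2_eq_square)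
  qed
  obtain m where m: "n = Suc (Suc (Suc m))" "1 \<le> m"
  proof
    show "n = Suc (Suc (Suc (n - 3)))" "1 \<le> n - 3" using n by simp_all
  qed
  let ?i = "Suc (Suc m)"
  have nz_end: "b ?i (Suc m) \<noteq> 0" "b n (Suc m) \<noteq> 0" "b ?i ?i \<noteq> 0" "b ?i n \<noteq> 0" "b n ?i \<noteq> 0" "b n n \<noteq> 0"
    by (rule nz; use m in simp)+
  have end_n: "b n n * (b n ?i)\<^sup>2 = 1"
    using four[of "Suc m"] m nz_end by (simp add: rv field_simps power2_eq_square)
  have end_chain: "(b ?i ?i * b ?i n)\<^sup>2 = 1"
  proof -
    have "b ?i ?i * (b ?i n * (b ?i ?i * b ?i n)) * (b n n * (b n ?i)\<^sup>2) * (b n n * (b n ?i)\<^sup>2) = 1"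
      using four[of ?i] m nz_end by (simp add: rv field_simps power2_eq_square)
    then show ?thesis unfolding end_n by (simp add: power2_eq_square mult_ac)
  qed
  have last': "b ?i n * ((b ?i (Suc m))\<^sup>2 * (b ?i ?i)\<^sup>2) = 1" using last[of "Suc m"] m by simp
  show coord: "t_coord n b i j = b i j" if ij: "i \<in> {1..n}" "j \<in> {1..n}" for i j
  proof -
    have far': "b i j = 1" if "Suc i < j \<or> Suc j < i" using far[of i j] far[of j i] ij that by auto
    consider "i \<le> n - 2" | "i = n - 1" | "i = n" using ij by fastforce
    then show ?thesis
    proof cases
      case 1
      have i: "1 \<le> i" using ij by simp
      note tc = t_coord_generic[OF n i 1, where a = b]
      consider "Suc j = i" | "j = i" | "j = Suc i" | "Suc j < i \<or> Suc i < j" by linarith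
      then show ?thesis
      proof cases
        case 1
        then have "b i i * b i (Suc i) * b i j = 1" using left[of j] ij \<open>i \<le> n - 2\<close> n by auto
        then have "inverse (b i i * b i (Suc i)) = b i j" by (rule inverse_unique)
        then show ?thesis using tc(3)[of j] 1 ij by (simp add: mult.commute)
      qed (use tc(1,2) tc(4)[of j] far' ij in auto)
    next
      case 2
      note tc = t_coord_penultimate[OF n 2, where a = b]
      consider "j = n - 2" | "j = i" | "j = n" | "Suc j < i" using ij 2 by fastforce
      then show ?thesis
      proof cases
        case 3
        have "((b ?i (Suc m))\<^sup>2 * (b ?i ?i)\<^sup>2) * b ?i n = 1" using last' by (simp add: mult.commute)
        then have "inverse ((b ?i (Suc m))\<^sup>2 * (b ?i ?i)\<^sup>2) = b ?i n" by (rule inverse_unique)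
        moreover have "i = ?i" "n - 2 = Suc m" using 2 m by auto
        ultimately show ?thesis using tc(3) 3 by (simp add: mult.commute)
      qed (use tc(1,2) tc(4)[of j] far' ij 2 n in auto)
    next
      case 3
      note tc = t_coord_last[OF n, where a = b]
      consider "j = n - 1" | "j = n" | "Suc j < n" using ij by fastforce
      then show ?thesis
      proof cases
        case 2
        have "(b n ?i)\<^sup>2 * b n n = 1" using end_n by (simp add: mult.commute)
        then have "inverse ((b n ?i)\<^sup>2) = b n n" by (rule inverse_unique)
        moreover have "n - 1 = ?i" using m by simp
        ultimately show ?thesis using tc(1) 2 3 by simp
      qed (use tc(2) tc(3)[of j] far' 3 in auto)
    qed
  qed
  have sq: "(chain_val n b (n - 1))\<^sup>2 = 1"
  proof -
    let ?x = "b ?i ?i" and ?y = "b ?i (Suc m)" and ?z = "b ?i n"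
    have "(?x * ?y\<^sup>2)\<^sup>2 = (?x * ?y\<^sup>2)\<^sup>2 * (?x * ?z)\<^sup>2" by (simp only: end_chain mult_1_right)
    also have "\<dots> = (?z * (?y\<^sup>2 * ?x\<^sup>2))\<^sup>2" by (simp add: power2_eq_square mult_ac)
    finally have "(?x * ?y\<^sup>2)\<^sup>2 = 1" by (simp only: last' power_one)
    moreover have "n - 1 = ?i" "n - 2 = Suc m" using m by auto
    ultimately show ?thesis unfolding chain_val_last by simp
  qed
  have step: "chain_val n b i = chain_val n b (Suc i)" if i: "1 \<le> i" "Suc i < n" for i
  proof (cases "Suc (Suc i) = n")
    case False
    have nz': "b (Suc i) i \<noteq> 0" "b (Suc i) (Suc i) \<noteq> 0" "b (Suc i) (Suc (Suc i)) \<noteq> 0"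
      by (rule nz; use i False in simp)+
    let ?u = "b (Suc i) (Suc i)" and ?v = "b (Suc i) (Suc (Suc i))" and ?w = "b (Suc i) i"
    let ?A = "b i i * (b i (Suc i))\<^sup>2"
    have l: "?u * ?v * ?w = 1" using left[of i] i False by simp
    have "?A = ?A * ((?u * ?v * ?w) * (?u * ?v * ?w))" by (simp only: l mult_1_right)
    also have "\<dots> = (?A * (?u * ?w\<^sup>2)) * (?u * ?v\<^sup>2)" by (simp add: power2_eq_square mult_ac)
    also have "\<dots> = ?u * ?v\<^sup>2" by (simp only: adjacent[OF i] mult_1_left)
    finally show ?thesis using chain_val_generic[of i n b] chain_val_generic[of "Suc i" n b] i False by simp
  next
    case True
    then have "chain_val n b i * chain_val n b (Suc i) = 1"
      using adjacent[OF i] by (auto simp: chain_val_def)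
    moreover have "chain_val n b (Suc i) * chain_val n b (Suc i) = 1"
      using sq True by (auto simp: power2_eq_square)
    ultimately show ?thesis by (metis mult.assoc mult.right_neutral mult.left_neutral)
  qed
  have chain: "chain_val n b (Suc m) = chain_val n b 1" if "Suc m \<le> n - 1" for m
    using that
  proof (induction m)
    case (Suc m)
    then show ?case using step[of "Suc m"] by simp
  qed simp
  show "section_params n b"
    unfolding section_params_def
  proof (intro conjI ballI sq)
    fix i assume "i \<in> {1..n - 1}"
    then show "chain_val n b i = chain_val n b 1" using chain[of "i - 1"] by simp
  qed (rule nz; use n in auto)+
qed

lemma section_params_chain:
  assumes "n \<ge> 6" "section_params n a"
  shows "i \<in> {1..n - 1} \<Longrightarrow> chain_val n a i = a 1 1 * (a 1 2)\<^sup>2" "(a 1 1 * (a 1 2)\<^sup>2)\<^sup>2 = 1"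
proof -
  have c: "chain_val n a i = chain_val n a 1" if "i \<in> {1..n - 1}" for i
    using assms(2) that unfolding section_params_def by blast
  have 1: "chain_val n a 1 = a 1 1 * (a 1 2)\<^sup>2"
    using chain_val_generic[of 1 n a] assms(1) by (simp add: numeral_2_eq_2)
  show "i \<in> {1..n - 1} \<Longrightarrow> chain_val n a i = a 1 1 * (a 1 2)\<^sup>2" using c 1 by metis
  have "(chain_val n a (n - 1))\<^sup>2 = 1" using assms(2) unfolding section_params_def by blast
  then show "(a 1 1 * (a 1 2)\<^sup>2)\<^sup>2 = 1" using c[of "n - 1"] 1 assms(1) by simp
qed

lemma section_params_chain_generic:
  assumes "n \<ge> 6" "section_params n a" "1 \<le> i" "i \<le> n - 2"
  shows "a i i * (a i (Suc i))\<^sup>2 = a 1 1 * (a 1 2)\<^sup>2"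
proof -
  have "i \<in> {1..n - 1}" "i \<noteq> n - 1" using assms by auto
  then show ?thesis using section_params_chain(1)[OF assms(1,2)] chain_val_generic by metis
qed

lemma section_params_chain_penultimate:
  assumes "n \<ge> 6" "section_params n a" "i = n - 1"
  shows "a i i * (a i (n - 2))\<^sup>2 = a 1 1 * (a 1 2)\<^sup>2"
proof -
  have "i \<in> {1..n - 1}" using assms by auto
  then show ?thesis using section_params_chain(1)[OF assms(1,2)] chain_val_last assms(3) by metis
qed

lemma section_params_nonzero:
  assumes "section_params n a"
  shows "i \<in> {1..n - 2} \<Longrightarrow> a i i \<noteq> 0" "i \<in> {1..n - 2} \<Longrightarrow> a i (Suc i) \<noteq> 0"
    "a (n - 1) (n - 2) \<noteq> 0" "a (n - 1) (n - 1) \<noteq> 0" "a n (n - 1) \<noteq> 0"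
  using assms unfolding section_params_def by auto

lemma t_coord_nonzero:
  assumes n: "n \<ge> 6" and a: "section_params n a" and i: "i \<in> {1..n}" and j: "j \<in> {1..n}"
  shows "t_coord n a i j \<noteq> 0"
proof -
  note nz = section_params_nonzero[OF a]
  consider "i \<le> n - 2" | "i = n - 1" | "i = n" using i by fastforce
  then show ?thesis
  proof cases
    case 1
    have i1: "1 \<le> i" using i by simp
    have ai: "a i i \<noteq> 0" "a i (Suc i) \<noteq> 0" using nz(1,2)[of i] 1 i1 by auto
    consider "Suc j = i" | "j = i" | "j = Suc i" | "Suc j \<noteq> i" "j \<noteq> i" "j \<noteq> Suc i" by blast
    then show ?thesis
    proof cases
      case a: 1
      then have "t_coord n a i j = inverse (a i i) * inverse (a i (Suc i))"
        using j by (intro t_coord_generic(3)[OF n i1 1]) auto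
      then show ?thesis using ai by simp
    next
      case a: 4
      then have "t_coord n a i j = 1" using j by (intro t_coord_generic(4)[OF n i1 1]) auto
      then show ?thesis by simp
    qed (use t_coord_generic(1,2)[OF n i1 1, where a = a] ai in simp_all)
  next
    case 2
    consider "j = n - 2" | "j = i" | "j = n" | "j \<noteq> n - 2" "j \<noteq> i" "j \<noteq> n" by blast
    then show ?thesis using t_coord_penultimate[OF n 2, where a = a] nz(3,4) 2 by cases auto
  next
    case 3
    consider "j = n - 1" | "j = n" | "j \<noteq> n - 1" "j \<noteq> n" by blast
    then show ?thesis using t_coord_last[OF n, where a = a] nz(5) 3 by cases auto
  qed
qed

text \<open>
  The entry \<open>t_coord n a i k\<close> at a neighbour \<open>k\<close> of \<open>i\<close> determines \<open>x i\<close>.  Equality of the chain values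
  gives the condition at \<open>i\<close> itself, and the conditions at the remaining neighbour follow.
\<close>
lemma t_coord_rescale:
  fixes a :: "nat \<Rightarrow> nat \<Rightarrow> 'a::field"
  assumes n: "n \<ge> 6" and a: "section_params n a" and a': "section_params n a'"
    and eq: "a 1 1 * (a 1 2)\<^sup>2 = a' 1 1 * (a' 1 2)\<^sup>2"
  obtains x where "\<And>i. i \<in> {1..n} \<Longrightarrow> x i \<noteq> 0"
    "\<And>i j. i \<in> {1..n} \<Longrightarrow> j \<in> {1..n} \<Longrightarrow>
       x j * t_coord n a i j = t_coord n a' i j * refl_values n i x j"
proof -
  \<comment> \<open>a neighbour of each node whose coordinate is a free parameter\<close>
  define k where "k i = (if i = n then n - 1 else if i = n - 1 then n - 2 else Suc i)" for i
  define x where "x i = a i (k i) / a' i (k i)" for i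
  note nz = section_params_nonzero[OF a] and nz' = section_params_nonzero[OF a']
  have x: "x i \<noteq> 0" if i: "i \<in> {1..n}" for i
  proof -
    consider "i \<in> {1..n - 2}" | "i = n - 1" | "i = n" using i by fastforce
    then show ?thesis
    proof cases
      case 1
      then have "k i = Suc i" using n by (auto simp: k_def)
      then show ?thesis using nz(2)[OF 1] nz'(2)[OF 1] by (simp add: x_def)
    next
      case 2
      then have "k i = n - 2" using n by (auto simp: k_def)
      then show ?thesis using nz(3) nz'(3) 2 by (simp add: x_def)
    next
      case 3
      then have "k i = n - 1" by (simp add: k_def)
      then show ?thesis using nz(5) nz'(5) 3 by (simp add: x_def)
    qed
  qed
  have below: "inverse u * inverse (z * v) = z * (inverse (u * z\<^sup>2) * inverse v)"
    if "z \<noteq> 0" for u v z :: 'a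
    using that by (simp add: power2_eq_square field_simps)
  have last: "inverse ((z * v)\<^sup>2) * inverse (u\<^sup>2) = inverse (v\<^sup>2) * inverse ((u * z\<^sup>2)\<^sup>2) * z\<^sup>2"
    if "z \<noteq> 0" for u v z :: 'a
    using that by (simp add: power2_eq_square field_simps)
  have diag: "z * inverse ((z * v)\<^sup>2) = inverse (v\<^sup>2) * inverse z" if "z \<noteq> 0" for v z :: 'a
  proof -
    have "z * inverse ((z * v)\<^sup>2) = (z * inverse z) * (inverse (v\<^sup>2) * inverse z)"
      by (simp only: power2_eq_square inverse_mult_distrib mult_ac)
    then show ?thesis using that by simp
  qed
  have solve: "u' = u * z\<^sup>2" if "u * (z * v)\<^sup>2 = u' * v\<^sup>2" "v \<noteq> 0" for u u' v z :: 'a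
    using that by (simp add: power_mult_distrib)
  have main: "x j * t_coord n a i j = t_coord n a' i j * refl_values n i x j" 
    if i: "i \<in> {1..n}" and j: "j \<in> {1..n}" for i j
  proof -
    have xi0: "x i \<noteq> 0" using x[OF i] .
    consider "i \<le> n - 2" | "i = n - 1" | "i = n" using i by fastforce
    then show ?thesis
    proof cases
      case 1
      have i1: "1 \<le> i" using i by simp
      have ni: "a i (Suc i) \<noteq> 0" "a' i (Suc i) \<noteq> 0" 
        using nz(2)[of i] nz'(2)[of i] 1 i by auto
      have "k i = Suc i" using 1 n by (auto simp: k_def)
      then have xi: "a i (Suc i) = x i * a' i (Suc i)" using ni by (simp add: x_def)
      have "a i i * (a i (Suc i))\<^sup>2 = a' i i * (a' i (Suc i))\<^sup>2"
        using section_params_chain_generic[OF n a i1 1] section_params_chain_generic[OF n a' i1 1] eq by simp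
      then have aii: "a' i i = a i i * (x i)\<^sup>2" using solve ni unfolding xi by blast
      note tc = t_coord_generic[OF n i1 1, where 'a = 'a]
      consider "Suc j = i" | "j = i" | "j = Suc i" | "Suc j \<noteq> i" "j \<noteq> i" "j \<noteq> Suc i" by blast
      then show ?thesis
      proof cases
        case 1
        have j1: "1 \<le> j" using j by simp
        show ?thesis unfolding tc(3)[OF j1 1] aii xi below[OF xi0] using 1 by (auto simp: refl_values_below mult_ac)
      next
        case 2
        then show ?thesis using tc(1) xi0 by (simp add: refl_values_self aii power2_eq_square mult_ac)
      next
        case 3
        moreover have "Suc i \<noteq> n" using \<open>i \<le> n - 2\<close> n by auto
        ultimately show ?thesis using tc(2) by (simp add: refl_values_above xi mult_ac)
      next
        case 4
        have j1: "1 \<le> j" using j by simp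
        show ?thesis using 4 tc(4)[OF j1 4] by (simp add: refl_values_far)
      qed
    next
      case 2
      have ni: "a i (n - 2) \<noteq> 0" "a' i (n - 2) \<noteq> 0" using nz(3) nz'(3) 2 by auto
      have "k i = n - 2" using 2 n by (auto simp: k_def)
      then have xi: "a i (n - 2) = x i * a' i (n - 2)" using ni by (simp add: x_def)
      have "a i i * (a i (n - 2))\<^sup>2 = a' i i * (a' i (n - 2))\<^sup>2"
        using section_params_chain_penultimate[OF n a 2] section_params_chain_penultimate[OF n a' 2] eq by simp
      then have aii: "a' i i = a i i * (x i)\<^sup>2" using solve ni unfolding xi by blast
      note tc = t_coord_penultimate[OF n 2, where 'a = 'a]
      consider "j = n - 2" | "j = i" | "j = n" | "j \<noteq> n - 2" "j \<noteq> i" "j \<noteq> n" by blast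
      then show ?thesis
      proof cases
        case 1
        then have ij: "i = Suc j" using 2 n by auto
        show ?thesis unfolding 1 tc(2) xi using refl_values_below[of n j x] ij 1 by (simp add: mult_ac)
      next
        case 2
        then show ?thesis using tc(1) xi0 by (simp add: refl_values_self aii power2_eq_square mult_ac)
      next
        case 3
        then have ij: "n = Suc i" using 2 n by auto
        show ?thesis unfolding 3 tc(3) aii xi last[OF xi0] using refl_values_last[of i x] ij by (simp add: mult_ac)
      next
        case 4
        then have "Suc j \<noteq> i" "j \<noteq> Suc i" using 2 n by auto
        then show ?thesis using tc(4)[OF 4] 4 by (simp add: refl_values_far)
      qed
    next
      case 3
      have ni: "a n (n - 1) \<noteq> 0" "a' n (n - 1) \<noteq> 0" using nz(5) nz'(5) by auto
      have xi: "a n (n - 1) = x n * a' n (n - 1)" using ni by (simp add: x_def k_def)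
      note tc = t_coord_last[OF n, where 'a = 'a]
      have xn: "x n \<noteq> 0" using xi0 3 by simp
      consider "j = n - 1" | "j = n" | "j \<noteq> n - 1" "j \<noteq> n" by blast
      then show ?thesis
      proof cases
        case 1
        then have ij: "n = Suc j" using n by auto
        have "refl_values n n x j = x j * x n" using refl_values_below[of n j x] unfolding ij[symmetric] .
        moreover have "t_coord n a n j = x n * a' n (n - 1)" "t_coord n a' n j = a' n (n - 1)"
          unfolding 1 tc(2) xi by (rule refl)+
        ultimately show ?thesis unfolding 3 by (simp only: mult_ac)
      next
        case 2
        show ?thesis unfolding 2 3 tc(1) xi refl_values_self by (rule diag[OF xn])
      next
        case c3: 3
        then have "Suc j \<noteq> n" "j \<noteq> Suc n" using j by auto
        then show ?thesis using tc(3)[OF c3] c3 3 by (simp add: refl_values_far)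
      qed
    qed
  qed
  show thesis using that[OF x main] .
qed

section \<open>Orders, conjugacy and the order profiles\<close>

lemma refl_values_inverse:
  "refl_values n i (\<lambda>k. inverse (v k)) j = inverse (refl_values n i v j)"
  by (simp add: refl_values_def power_inverse)

context monomial_model
begin

text \<open>
  Every section arises from parameters: its own coordinates satisfy all relations.
\<close>
lemma coords_params:
  assumes S: "is_section n G S"
  shows "section_params n (coords S)"
    "i \<in> {1..n} \<Longrightarrow> j \<in> {1..n} \<Longrightarrow> t_coord n (coords S) i j = coords S i j"
proof -
  have two: "word_values n (coords S) [i, j] k = word_values n (coords S) [j, i] k"
    if "i \<in> {1..n}" "j \<in> {1..n}" "k \<in> {1..n}" "Suc i < j" for i j k
    using that by (intro coords_braid[OF S] reduced_two braid_two) auto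
  have three: "word_values n (coords S) [i, Suc i, i] k = word_values n (coords S) [Suc i, i, Suc i] k"
    if "i \<in> {1..n}" "k \<in> {1..n}" "Suc i < n" for i k
    using that by (intro coords_braid[OF S] reduced_three braid_three) auto
  have four: "word_values n (coords S) [n - 1, n, n - 1, n] k = word_values n (coords S) [n, n - 1, n, n - 1] k"
    if "k \<in> {1..n}" for k
    using that n_ge by (intro coords_braid[OF S] reduced_four braid_four) auto
  note p = braid_values_params[of n "coords S", OF n_ge coords_nonzero[OF S] two three four]
  show "section_params n (coords S)" by (rule p(1))
  show "i \<in> {1..n} \<Longrightarrow> j \<in> {1..n} \<Longrightarrow> t_coord n (coords S) i j = coords S i j" by (rule p(2))
qed

lemma section_given_byD:
  assumes "section_given_by n G a S"
  shows "is_section n G S" "section_params n a"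
    "i \<in> {1..n} \<Longrightarrow> j \<in> {1..n} \<Longrightarrow> coords S i j = t_coord n a i j"
proof -
  show S: "is_section n G S" and a: "section_params n a" using assms by (simp_all add: section_given_by_def)
  assume i: "i \<in> {1..n}" and j: "j \<in> {1..n}"
  have tp: "torus_point n G (t_coord n a i) \<in> T" "val (torus_point n G (t_coord n a i)) j = t_coord n a i j"
    using torus_point[of "t_coord n a i"] t_coord_nonzero[OF n_ge a i] j by auto
  have "gen S i = torus_point n G (t_coord n a i) \<otimes> \<sigma> i"
    using assms i by (simp add: section_given_by_def gen_def \<sigma>_def)
  then have "twist S i = torus_point n G (t_coord n a i)" by (rule twist_unique[OF i tp(1)])
  then show "coords S i j = t_coord n a i j" using tp(2) by (simp add: coords_def)
qed

lemma section_given_by_coords: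
  assumes S: "is_section n G S" shows "section_given_by n G (coords S) S"
  unfolding section_given_by_def
proof (intro conjI ballI S coords_params(1)[OF S])
  fix i assume i: "i \<in> {1..n}"
  have nz: "t_coord n (coords S) i j \<noteq> 0" if "j \<in> {1..n}" for j
    using coords_params(2)[OF S i that] coords_nonzero[OF S i that] by simp
  have "torus_point n G (t_coord n (coords S) i) = twist S i"
  proof (rule torus_eqI[OF torus_point(1)[OF nz] twist(1)[OF S i]])
    fix j assume j: "j \<in> {1..n}"
    show "val (torus_point n G (t_coord n (coords S) i)) j = val (twist S i) j"
      using torus_point(2)[OF nz j] coords_params(2)[OF S i j] by (simp add: coords_def)
  qed
  then show "S (simple_refl n G i) = torus_point n G (t_coord n (coords S) i) \<otimes> sigma G (simple_root n i)"
    using twist(2)[OF S i] by (simp add: gen_def \<sigma>_def)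
qed

text \<open>
  The common value of the chain, expressed through the coordinates of the section.
\<close>
definition chain :: "('g set \<Rightarrow> 'g) \<Rightarrow> 'a" where
  "chain S = coords S 1 1 * (coords S 1 2)\<^sup>2"

lemma chain_given_by:
  assumes "section_given_by n G a S" shows "a 1 1 * (a 1 2)\<^sup>2 = chain S"
proof -
  have "coords S 1 1 = a 1 1" "coords S 1 2 = a 1 2"
    using section_given_byD(3)[OF assms, of 1 1] section_given_byD(3)[OF assms, of 1 2] n_ge
    by (simp_all add: t_coord_def)
  then show ?thesis by (simp add: chain_def)
qed

lemma chain_cases:
  assumes "is_section n G S" shows "chain S = 1 \<or> chain S = - 1"
  using section_params_chain(2)[OF n_ge coords_params(1)[OF assms]] 
  by (simp add: chain_def power2_eq_1_iff)

lemma minus_one_neq: "(- 1 :: 'a) \<noteq> 1"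
  using two_nz by (metis add.left_inverse one_add_one)

lemma T_conjugate_iff:
  assumes S: "is_section n G S" and S': "is_section n G S'"
  shows "T_conjugate G S S' \<longleftrightarrow> (\<exists>t \<in> T. \<forall>i \<in> {1..n}. t \<otimes> gen S i \<otimes> inv t = gen S' i)"
proof
  assume "T_conjugate G S S'"
  then show "\<exists>t \<in> T. \<forall>i \<in> {1..n}. t \<otimes> gen S i \<otimes> inv t = gen S' i"
    unfolding T_conjugate_def gen_def using simple_word_carrier[of "[_]"] simple_refl_word
    by (metis bot.extremum empty_set insert_subset list.simps(15))
next
  assume "\<exists>t \<in> T. \<forall>i \<in> {1..n}. t \<otimes> gen S i \<otimes> inv t = gen S' i"
  then obtain t where t: "t \<in> T" "\<And>i. i \<in> {1..n} \<Longrightarrow> t \<otimes> gen S i \<otimes> inv t = gen S' i" by blast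
  note tc = torus_carrier[OF t(1)]
  have word: "t \<otimes> word_prod G (map (gen S) is) \<otimes> inv t = word_prod G (map (gen S') is)"
    if "set is \<subseteq> {1..n}" for "is"
    using that
  proof (induction "is")
    case Nil
    then show ?case using tc by simp
  next
    case (Cons i "is")
    let ?w = "word_prod G (map (gen S) is)"
    have i: "i \<in> {1..n}" and set: "set is \<subseteq> {1..n}" using Cons.prems by auto
    have w: "?w \<in> carrier G" using set gen_carrier[OF S] by (intro word_prod_carrier) auto
    note g = gen_carrier[OF S i]
    have "t \<otimes> word_prod G (map (gen S) (i # is)) \<otimes> inv t = t \<otimes> gen S i \<otimes> (inv t \<otimes> t) \<otimes> ?w \<otimes> inv t"
      using tc g w by (simp add: m_assoc)
    also have "\<dots> = (t \<otimes> gen S i \<otimes> inv t) \<otimes> (t \<otimes> ?w \<otimes> inv t)"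
      using tc g w by (simp only: m_assoc m_closed inv_closed)
    finally show ?case using t(2)[OF i] Cons.IH[OF set] by simp
  qed
  show "T_conjugate G S S'"
    unfolding T_conjugate_def
  proof (intro bexI[OF _ t(1)] ballI)
    fix w assume "w \<in> carrier (weyl_group G)"
    then obtain "is" where r: "reduced n is" "w = simple_word n G is" by (rule weyl_element_word)
    then show "t \<otimes> S w \<otimes> inv t = S' w"
      using word section_word[OF S r(1)] section_word[OF S' r(1)] by (simp add: reduced_def)
  qed
qed

text \<open>
  Since \<open>t t_i \<sigma>_i t\<^sup>-\<^sup>1 = t t_i s_i(t)\<^sup>-\<^sup>1 \<sigma>_i\<close>, conjugation multiplies \<open>t_i\<close> by \<open>t s_i(t)\<^sup>-\<^sup>1\<close>.
\<close>
lemma conjugate_gen_iff: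
  assumes S: "is_section n G S" and S': "is_section n G S'" and i: "i \<in> {1..n}" and t: "t \<in> T"
  shows "t \<otimes> gen S i \<otimes> inv t = gen S' i \<longleftrightarrow>
    (\<forall>j \<in> {1..n}. val t j * coords S i j = coords S' i j * refl_values n i (val t) j)"
proof -
  note ti = torus_inv[OF t] and u = twist[OF S i] and u' = twist[OF S' i]
  note c = conj_sigma[OF i ti]
  let ?v = "t \<otimes> twist S i \<otimes> conj_sigma i (inv t)"
  note carr = sigma_carrier[OF i] torus_carrier[OF t] torus_carrier[OF ti] torus_carrier[OF u(1)]
    torus_carrier[OF u'(1)] torus_carrier[OF c(1)]
  have v: "?v \<in> T" by (intro torus_mult t u(1) c(1))
  have "t \<otimes> gen S i \<otimes> inv t = t \<otimes> twist S i \<otimes> (\<sigma> i \<otimes> inv t)"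
    using carr by (simp add: u(2) m_assoc)
  also have "\<dots> = ?v \<otimes> \<sigma> i" unfolding c(2) using carr by (simp add: m_assoc)
  finally have "t \<otimes> gen S i \<otimes> inv t = gen S' i \<longleftrightarrow> ?v \<otimes> \<sigma> i = twist S' i \<otimes> \<sigma> i"
    by (simp add: u'(2))
  also have "\<dots> \<longleftrightarrow> ?v = twist S' i" using carr torus_carrier[OF v] by (metis r_cancel)
  also have "\<dots> \<longleftrightarrow> (\<forall>j \<in> {1..n}. val ?v j = coords S' i j)"
    unfolding coords_def using torus_eqI[OF v u'(1)] by metis
  also have "\<dots> \<longleftrightarrow> (\<forall>j \<in> {1..n}. val t j * coords S i j = coords S' i j * refl_values n i (val t) j)"
  proof (intro ball_cong refl)
    fix j assume j: "j \<in> {1..n}"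
    have nz: "refl_values n i (val t) j \<noteq> 0" by (rule refl_values_nonzero[OF i j val_nonzero[OF t]])
    have "val ?v j = val t j * coords S i j * refl_values n i (val (inv t)) j"
      unfolding val_mult[OF torus_mult[OF t u(1)] c(1) j] val_mult[OF t u(1) j] c(3)[OF j] coords_def ..
    also have "refl_values n i (val (inv t)) j = inverse (refl_values n i (val t) j)"
      unfolding refl_values_inverse[symmetric] by (rule refl_values_cong[OF i j val_inv[OF t]])
    finally have "val ?v j = val t j * coords S i j / refl_values n i (val t) j"
      by (simp only: divide_inverse)
    then show "val ?v j = coords S' i j \<longleftrightarrow> val t j * coords S i j = coords S' i j * refl_values n i (val t) j"
      by (simp only: nonzero_divide_eq_eq[OF nz])
  qed
  finally show ?thesis .
qed

text \<open>
  In the product \<open>\<alpha>_1(t_1) \<alpha>_2(t_1)\<^sup>2\<close> conjugation contributes the factors \<open>\<alpha>_1(t)\<^sup>2\<close> and \<open>\<alpha>_1(t)\<^sup>-\<^sup>2\<close>.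
  For the converse the values found by rescaling are attained by an element of the torus.
\<close>
lemma T_conjugate_chain:
  assumes S: "is_section n G S" and S': "is_section n G S'"
  shows "T_conjugate G S S' \<longleftrightarrow> chain S = chain S'"
proof
  assume "T_conjugate G S S'"
  then obtain t where t: "t \<in> T" "\<And>i. i \<in> {1..n} \<Longrightarrow> t \<otimes> gen S i \<otimes> inv t = gen S' i"
    unfolding T_conjugate_iff[OF S S'] by blast
  have 1: "1 \<in> {1..n}" "2 \<in> {1..n}" using n_ge by auto
  have "\<forall>j \<in> {1..n}. val t j * coords S 1 j = coords S' 1 j * refl_values n 1 (val t) j"
    using t conjugate_gen_iff[OF S S' 1(1) t(1)] 1 by blast
  then have "val t 1 * coords S 1 1 = coords S' 1 1 * inverse (val t 1)"
    "val t 2 * coords S 1 2 = coords S' 1 2 * (val t 2 * val t 1)"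
    using 1 n_ge by (auto simp: refl_values_def)
  moreover have "val t 1 \<noteq> 0" "val t 2 \<noteq> 0" using val_nonzero[OF t(1)] 1 by auto
  ultimately have "coords S' 1 1 = coords S 1 1 * (val t 1)\<^sup>2" "coords S 1 2 = coords S' 1 2 * val t 1"
    by (auto simp: field_simps power2_eq_square)
  then show "chain S = chain S'" by (simp add: chain_def power_mult_distrib)
next
  assume "chain S = chain S'"
  then obtain x where x: "\<And>i. i \<in> {1..n} \<Longrightarrow> x i \<noteq> 0"
    "\<And>i j. i \<in> {1..n} \<Longrightarrow> j \<in> {1..n} \<Longrightarrow>
       x j * t_coord n (coords S) i j = t_coord n (coords S') i j * refl_values n i x j"
    using t_coord_rescale[OF n_ge coords_params(1)[OF S] coords_params(1)[OF S']] unfolding chain_def by metis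
  obtain t where t: "t \<in> T" "\<And>j. j \<in> {1..n} \<Longrightarrow> val t j = x j" using torus_exists[of x] x(1) by metis
  have "t \<otimes> gen S i \<otimes> inv t = gen S' i" if i: "i \<in> {1..n}" for i
    unfolding conjugate_gen_iff[OF S S' i t(1)]
  proof
    fix j assume j: "j \<in> {1..n}"
    have "refl_values n i (val t) j = refl_values n i x j" by (rule refl_values_cong[OF i j t(2)])
    then show "val t j * coords S i j = coords S' i j * refl_values n i (val t) j"
      using x(2)[OF i j] t(2)[OF j] coords_params(2)[OF S i j] coords_params(2)[OF S' i j] by simp
  qed
  then show "T_conjugate G S S'" unfolding T_conjugate_iff[OF S S'] using t(1) by blast
qed

lemma psi_square:
  assumes i: "i \<in> {1..n}" and c: "monomial_data n (srefl n i) c"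
  shows "monomial_data n id (\<lambda>p. c p * c (srefl n i p))"
    "\<psi> (srefl n i) c \<otimes> \<psi> (srefl n i) c = \<psi> id (\<lambda>p. c p * c (srefl n i p))"
  using monomial_data_comp[OF c c] psi_mult[OF c c] by (simp_all only: srefl_comp_self[OF i])

lemma psi_signs:
  assumes d: "monomial_data n id d" and signs: "\<And>p. p < 2 * n \<Longrightarrow> d p * d p = 1"
  shows "\<psi> id d \<otimes> \<psi> id d = \<one>"
    "p < 2 * n \<Longrightarrow> q < 2 * n \<Longrightarrow> d p \<noteq> d q \<Longrightarrow> \<psi> id d \<noteq> \<one>"
proof -
  have "\<psi> id d \<otimes> \<psi> id d = \<psi> id (\<lambda>p. d p * d p)" "monomial_data n id (\<lambda>p. d p * d p)"
    using psi_mult[OF d d] monomial_data_comp[OF d d] by (simp_all only: comp_id id_apply)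
  then show "\<psi> id d \<otimes> \<psi> id d = \<one>"
    using psi_cong[OF _ monomial_data_one] signs psi_one by metis
  show "p < 2 * n \<Longrightarrow> q < 2 * n \<Longrightarrow> d p \<noteq> d q \<Longrightarrow> \<psi> id d \<noteq> \<one>"
    unfolding psi_one[symmetric] psi_eq_iff[OF d monomial_data_one]
    by (metis mult_left_cancel mult_zero_left one_neq_zero)
qed

lemma psi_srefl_neq_one:
  assumes i: "i \<in> {1..n}" and c: "monomial_data n (srefl n i) c"
  shows "\<psi> (srefl n i) c \<noteq> \<one>"
proof
  assume "\<psi> (srefl n i) c = \<one>"
  then have "srefl n i i = i"
    using psi_eq_iff[OF c monomial_data_one] psi_one by simp
  then show False using i by (auto simp: srefl_def split: if_splits)
qed

lemma ord_of_square:
  assumes x: "x \<in> carrier G" "x \<noteq> \<one>" and four: "(x \<otimes> x) \<otimes> (x \<otimes> x) = \<one>"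
  shows "ord x = (if x \<otimes> x = \<one> then 2 else 4)"
proof -
  have iff: "x [^] k = \<one> \<longleftrightarrow> ord x dvd k" for k :: nat by (rule pow_eq_id[OF x(1)])
  have "x [^] (4 :: nat) = (x \<otimes> x) \<otimes> (x \<otimes> x)" using x by (simp add: numeral_eq_Suc m_assoc)
  then have 4: "ord x dvd 4" using iff four by metis
  have 1: "ord x \<noteq> 1" using iff[of 1] x by auto
  have 2: "x \<otimes> x = \<one> \<longleftrightarrow> ord x dvd 2" using iff[of 2] x(1) by (simp add: numeral_2_eq_2)
  have "ord x \<le> 4" using 4 by (auto dest: dvd_imp_le)
  then have "ord x \<in> {0, 1, 2, 3, 4}" by auto
  then show ?thesis using 1 2 4 by auto
qed

lemma ord_conj:
  assumes "t \<in> carrier G" "x \<in> carrier G" shows "ord (t \<otimes> x \<otimes> inv t) = ord x"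
proof -
  have pow: "(t \<otimes> x \<otimes> inv t) [^] k = t \<otimes> x [^] k \<otimes> inv t" for k :: nat
  proof (induction k)
    case (Suc k)
    have "(t \<otimes> x \<otimes> inv t) [^] Suc k = (t \<otimes> x [^] k \<otimes> inv t) \<otimes> (t \<otimes> x \<otimes> inv t)"
      by (simp only: nat_pow_Suc Suc.IH)
    also have "\<dots> = t \<otimes> x [^] k \<otimes> (inv t \<otimes> t) \<otimes> x \<otimes> inv t"
      using assms by (simp only: m_assoc m_closed inv_closed nat_pow_closed)
    finally show ?case using assms by (simp add: m_assoc)
  qed (use assms in simp)
  have "t \<otimes> y \<otimes> inv t = \<one> \<longleftrightarrow> y = \<one>" if "y \<in> carrier G" for y
    using assms(1) that by (metis inv_closed inv_equality inv_inv m_closed r_inv r_one l_cancel_one)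
  then have "(t \<otimes> x \<otimes> inv t) [^] k = \<one> \<longleftrightarrow> x [^] k = \<one>" for k :: nat
    unfolding pow using assms by simp
  then show ?thesis
    using ord_unique[of "t \<otimes> x \<otimes> inv t" "ord x"] pow_eq_id assms by simp
qed

lemma chain_tits: "chain (tits_section n G) = 1"
proof -
  have "coords (tits_section n G) 1 j = 1" if "j \<in> {1..n}" for j
  proof -
    have "1 \<in> {1..n}" using n_ge by simp
    then have "twist (tits_section n G) 1 = \<one>"
      using tits_section(2) sigma_carrier by (simp add: twist_def)
    then show ?thesis using val_one[OF that] by (simp add: coords_def)
  qed
  then show ?thesis using n_ge by (simp add: chain_def)
qed

lemma ord_tits:
  assumes i: "i \<in> {1..n}" shows "ord (\<sigma> i) = 4"
proof -
  let ?s = "srefl n i" and ?e = "tits_sign (srefl n i) :: nat \<Rightarrow> 'a"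
  note m = monomial_data_tits_sign[OF i, where 'a = 'a]
  note sq = psi_square[OF i m]
  obtain k where k: "i = Suc k" using i by (cases i) auto
  have e: "?e p * ?e (?s p) = (if Suc p = i \<or> p = i \<or> Suc (p + i) = 2 * n \<or> p + i = 2 * n then - 1 else 1)" for p
    unfolding tits_sign_srefl[OF i] using k i odd_neq_double[of k n] by (auto simp: srefl_def)
  \<comment> \<open>a position that the reflection does not move\<close>
  define q where "q = (if i = 1 then 2 else (0 :: nat))"
  have "?e i * ?e (?s i) \<noteq> ?e q * ?e (?s q)"
    unfolding e using i n_ge minus_one_neq by (auto simp: q_def)
  moreover have "i < 2 * n" "q < 2 * n" using i n_ge by (auto simp: q_def)
  ultimately have "\<sigma> i \<otimes> \<sigma> i \<noteq> \<one>"
    unfolding sigma_psi[OF i] sq(2) using psi_signs(2)[OF sq(1), of i q] e by simp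
  moreover have "(\<sigma> i \<otimes> \<sigma> i) \<otimes> (\<sigma> i \<otimes> \<sigma> i) = \<one>"
    unfolding sigma_psi[OF i] sq(2) by (rule psi_signs(1)[OF sq(1)]) (simp add: e)
  moreover have "\<sigma> i \<noteq> \<one>" unfolding sigma_psi[OF i] by (rule psi_srefl_neq_one[OF i m])
  ultimately show ?thesis using ord_of_square[OF sigma_carrier[OF i]] by simp
qed

text \<open>
  The square has the entry \<open>- 1\<close> exactly at the positions that change between the two halves.
\<close>
lemma ord_split:
  assumes i: "i \<in> {1..n}"
  shows "ord (\<psi> (srefl n i) (split_sign n (srefl n i))) = (if i < n then 2 else 4)"
proof -
  let ?s = "srefl n i" and ?e = "split_sign n (srefl n i) :: nat \<Rightarrow> 'a"
  let ?x = "\<psi> ?s ?e"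
  note m = monomial_data_split_sign[OF i, where 'a = 'a]
  note sq = psi_square[OF i m]
  have e: "?e p * ?e (?s p) = (if n \<le> p \<longleftrightarrow> n \<le> ?s p then 1 else - 1)" for p
  proof -
    have "(if n \<le> p \<and> ?s p < n then - 1 else 1) * (if n \<le> ?s p \<and> p < n then - 1 else 1)
        = (if n \<le> p \<longleftrightarrow> n \<le> ?s p then 1 else - 1 :: 'a)" by auto
    then have "?e p * ?e (?s p) = half_sign n p * (half_sign n p * (half_sign n (?s p) * (half_sign n (?s p) *
        (if n \<le> p \<longleftrightarrow> n \<le> ?s p then 1 else - 1))))"
      unfolding split_sign_def srefl_involution[OF i] by (simp only: mult_ac)
    then show ?thesis by (simp only: half_sign_cancel)
  qed
  have "?x \<otimes> ?x = \<one> \<longleftrightarrow> i < n"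
  proof
    assume one: "?x \<otimes> ?x = \<one>"
    show "i < n"
    proof (rule ccontr)
      assume "\<not> i < n"
      then have "i = n" using i by simp
      then have "?e n * ?e (?s n) \<noteq> ?e 0 * ?e (?s 0)"
        unfolding e using n_ge minus_one_neq by (auto simp: srefl_def)
      then have "\<psi> id (\<lambda>p. ?e p * ?e (?s p)) \<noteq> \<one>"
        by (rule psi_signs(2)[OF sq(1), rotated -1]) (use n_ge e in auto)
      then show False using one unfolding sq(2) by simp
    qed
  next
    assume "i < n"
    then have "n \<le> p \<longleftrightarrow> n \<le> ?s p" if "p < 2 * n" for p using i that by (auto simp: srefl_def)
    then show "?x \<otimes> ?x = \<one>"
      unfolding sq(2) psi_one[symmetric] by (intro psi_cong[OF sq(1) monomial_data_one]) (simp only: e simp_thms if_True)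
  qed
  moreover have "(?x \<otimes> ?x) \<otimes> (?x \<otimes> ?x) = \<one>"
    unfolding sq(2) by (rule psi_signs(1)[OF sq(1)]) (simp add: e)
  ultimately show ?thesis
    using ord_of_square[OF psi_closed[OF m] psi_srefl_neq_one[OF i m]] by simp
qed

lemma ord_gen_conjugate:
  assumes S: "is_section n G S" and S': "is_section n G S'" and "chain S = chain S'" and i: "i \<in> {1..n}"
  shows "ord (gen S i) = ord (gen S' i)"
  using assms T_conjugate_chain[OF S S'] T_conjugate_iff[OF S S'] ord_conj[OF torus_carrier gen_carrier[OF S i]]
  by metis

text \<open>
  Its chain value is not \<open>1\<close>, because the orders at \<open>s_1\<close> distinguish it from the Tits section.
\<close>
lemma split_section_exists:
  obtains S where "is_section n G S" "chain S = - 1"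
    "\<And>i. i \<in> {1..n} \<Longrightarrow> ord (gen S i) = (if i < n then 2 else 4)"
proof -
  obtain S where S: "is_section n G S" 
      "\<And>i. i \<in> {1..n} \<Longrightarrow> gen S i = \<psi> (srefl n i) (split_sign n (srefl n i))"
    using section_exists[OF length_cocycle_split_sign monomial_data_split_sign] by metis
  have ord: "ord (gen S i) = (if i < n then 2 else 4)" if "i \<in> {1..n}" for i
    unfolding S(2)[OF that] by (rule ord_split[OF that])
  have 1: "1 \<in> {1..n}" "1 < n" using n_ge by auto
  have "chain S \<noteq> 1"
  proof
    assume "chain S = 1"
    then have "ord (gen S 1) = ord (\<sigma> 1)"
      using ord_gen_conjugate[OF S(1) tits_section(1) _ 1(1)] chain_tits tits_section(2)[OF 1(1)] by simp
    then show False using ord[OF 1(1)] ord_tits[OF 1(1)] 1(2) by simp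
  qed
  then show thesis using that S(1) ord chain_cases by blast
qed

lemma ord_gen:
  assumes S: "is_section n G S" and i: "i \<in> {1..n}"
  shows "ord (gen S i) = (if i < n \<and> chain S = - 1 then 2 else 4)"
proof (cases "chain S = - 1")
  case True
  obtain S' where S': "is_section n G S'" "chain S' = - 1"
      "\<And>i. i \<in> {1..n} \<Longrightarrow> ord (gen S' i) = (if i < n then 2 else 4)"
    by (rule split_section_exists) blast
  then show ?thesis using ord_gen_conjugate[OF S S'(1) _ i] True i by simp
next
  case False
  then show ?thesis
    using ord_gen_conjugate[OF S tits_section(1) _ i] chain_cases[OF S] chain_tits tits_section(2)[OF i] ord_tits[OF i]
    by simp
qed

lemma gen_square_one_iff:
  assumes S: "is_section n G S" and i: "i \<in> {1..n}"
  shows "gen S i [^] (2 :: nat) = \<one> \<longleftrightarrow> i < n \<and> chain S = - 1"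
  unfolding pow_eq_id[OF gen_carrier[OF S i]] ord_gen[OF S i] by auto

lemma order_profile_eq:
  assumes "is_section n G S"
  shows "order_profile n G S = (\<lambda>i \<in> {1..n}. if i < n \<and> chain S = - 1 then 2 else 4)"
  unfolding order_profile_def gen_def[symmetric] using ord_gen[OF assms] by (auto simp: restrict_def fun_eq_iff)

lemma order_profile_eq_iff:
  assumes "is_section n G S" "is_section n G S'"
  shows "order_profile n G S = order_profile n G S' \<longleftrightarrow> chain S = chain S'"
proof
  assume "order_profile n G S = order_profile n G S'"
  then have "order_profile n G S 1 = order_profile n G S' 1" by simp
  then have "chain S = - 1 \<longleftrightarrow> chain S' = - 1"
    unfolding order_profile_eq[OF assms(1)] order_profile_eq[OF assms(2)] using n_ge by (auto split: if_splits)
  then show "chain S = chain S'" using chain_cases assms by metis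
qed (use order_profile_eq assms in simp)

definition profile :: "bool \<Rightarrow> nat \<Rightarrow> nat" where
  "profile b = (\<lambda>i \<in> {1..n}. if i < n \<and> b then 2 else 4)"

lemma order_profiles_eq: "order_profiles n G = {profile True, profile False}"
proof -
  have mem: "order_profile n G S \<in> order_profiles n G" if "is_section n G S" for S
    using that by (auto simp: order_profiles_def)
  obtain S where S: "is_section n G S" "chain S = - 1" by (rule split_section_exists) blast
  have "order_profile n G S = profile True" "order_profile n G (tits_section n G) = profile False"
    using order_profile_eq[OF S(1)] order_profile_eq[OF tits_section(1)] S(2) chain_tits minus_one_neq
    by (simp_all add: profile_def)
  then have "profile True \<in> order_profiles n G" "profile False \<in> order_profiles n G"
    using mem[OF S(1)] mem[OF tits_section(1)] by simp_all
  moreover have "P = profile True \<or> P = profile False" if "P \<in> order_profiles n G" for P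
  proof -
    obtain S where "is_section n G S" "P = order_profile n G S" using \<open>P \<in> order_profiles n G\<close> by (auto simp: order_profiles_def)
    then show ?thesis using order_profile_eq by (cases "chain S = - 1") (simp_all add: profile_def)
  qed
  ultimately show ?thesis by blast
qed

lemma profile_less: "profile_less n (profile False) (profile True)" "\<not> profile_less n (profile b) (profile False)"
  "\<not> profile_less n (profile b) (profile b)"
  using n_ge by (auto simp: profile_less_def profile_def intro!: bexI[of _ 1])

lemma profile_neq: "profile True \<noteq> profile False"
  using profile_less by metis

lemma maximal_profile_iff: "maximal_profile n G P \<longleftrightarrow> P = profile True"
  unfolding maximal_profile_def order_profiles_eq using profile_less by (metis insert_iff singletonD)

lemma optimal_iff:
  assumes S: "is_section n G S" shows "optimal_section n G S \<longleftrightarrow> chain S = - 1"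
proof -
  have "order_profile n G S = profile (chain S = - 1)" using order_profile_eq[OF S] by (simp add: profile_def)
  then show ?thesis
    unfolding optimal_section_def maximal_profile_iff using S profile_neq by (cases "chain S = - 1") auto
qed

end

theorem proposition3p10:
  fixes G :: "('g, 'a::alg_closed_field) rooted_group" and n :: nat
  assumes "n \<ge> 6"
    and "(2 :: 'a) \<noteq> 0"
    and "adjoint_type_C n G"
    and "realization n G"
  shows
    "(\<forall>S a. section_given_by n G a S \<and> (\<forall>i \<in> {1..n - 1}. chain_val n a i = - 1) \<longrightarrow>
        optimal_section n G S \<and>
        (\<forall>i \<in> {1..n - 1}. S (simple_refl n G i) [^]\<^bsub>G\<^esub> (2 :: nat) = \<one>\<^bsub>G\<^esub>) \<and>
        S (simple_refl n G n) [^]\<^bsub>G\<^esub> (2 :: nat) \<noteq> \<one>\<^bsub>G\<^esub>)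
     \<and> \<not> optimal_section n G (tits_section n G)
     \<and> (\<forall>i \<in> {1..n}. tits_section n G (simple_refl n G i) [^]\<^bsub>G\<^esub> (2 :: nat) \<noteq> \<one>\<^bsub>G\<^esub>)
     \<and> card (order_profiles n G) = 2
     \<and> (\<forall>S S'. is_section n G S \<and> is_section n G S' \<longrightarrow>
          (T_conjugate G S S' \<longleftrightarrow>
             (\<exists>a a'. section_given_by n G a S \<and> section_given_by n G a' S' \<and>
                a 1 1 * (a 1 2)\<^sup>2 = a' 1 1 * (a' 1 2)\<^sup>2)) \<and>
          (T_conjugate G S S' \<longleftrightarrow> order_profile n G S = order_profile n G S'))"
proof -
  obtain \<psi> where "monomial_model G n \<psi>" using monomial_model_exists[OF assms] .
  then interpret monomial_model G n \<psi> .
  show ?thesis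
  proof (intro conjI allI impI ballI)
    fix S a assume Sa: "section_given_by n G a S \<and> (\<forall>i \<in> {1..n - 1}. chain_val n a i = - 1)"
    then have S: "is_section n G S" and a: "section_params n a" using section_given_byD by blast+
    have "1 \<in> {1..n - 1}" using n_ge by simp
    then have "chain S = - 1"
      using section_params_chain(1)[OF n_ge a, of 1] chain_given_by[of a S] Sa by metis
    then show "optimal_section n G S" "S (simple_refl n G n) [^]\<^bsub>G\<^esub> (2 :: nat) \<noteq> \<one>\<^bsub>G\<^esub>"
      "i \<in> {1..n - 1} \<Longrightarrow> S (simple_refl n G i) [^]\<^bsub>G\<^esub> (2 :: nat) = \<one>\<^bsub>G\<^esub>" for i
      using optimal_iff[OF S] gen_square_one_iff[OF S, of n] gen_square_one_iff[OF S, of i] n_ge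
      by (auto simp: gen_def)
  next
    show "\<not> optimal_section n G (tits_section n G)"
      using optimal_iff[OF tits_section(1)] chain_tits minus_one_neq by simp
    show "tits_section n G (simple_refl n G i) [^]\<^bsub>G\<^esub> (2 :: nat) \<noteq> \<one>\<^bsub>G\<^esub>" if "i \<in> {1..n}" for i
      using gen_square_one_iff[OF tits_section(1) that] chain_tits minus_one_neq by (simp add: gen_def)
    show "card (order_profiles n G) = 2" unfolding order_profiles_eq using profile_neq by simp
  next
    fix S S' assume "is_section n G S \<and> is_section n G S'"
    then have S: "is_section n G S" and S': "is_section n G S'" by simp_all
    show "T_conjugate G S S' \<longleftrightarrow>
       (\<exists>a a'. section_given_by n G a S \<and> section_given_by n G a' S' \<and> a 1 1 * (a 1 2)\<^sup>2 = a' 1 1 * (a' 1 2)\<^sup>2)"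
      unfolding T_conjugate_chain[OF S S'] 
      using chain_given_by section_given_by_coords[OF S] section_given_by_coords[OF S'] by metis
    show "T_conjugate G S S' \<longleftrightarrow> order_profile n G S = order_profile n G S'"
      unfolding T_conjugate_chain[OF S S'] order_profile_eq_iff[OF S S'] ..
  qed
qed

end
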